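(* Define, for polynomials $p$ on $\mathbb{R}^m$ and $z\in\mathbb{R}^m$, $$\mathcal V(p)(z):=\frac{1}{(2\pi)^{m/2}}\int_{\mathbb{R}^m}K(iy,z)\,\mathcal F\big(p(\cdot)e^{-|\cdot|^2/2}\big)(y)\,dy,\qquad K(iy,z):=e^{-\Delta_{(y)}/2}E_\kappa(iy,z).$$ Then $\mathcal V(\partial_jp)=T_j\mathcal V(p)$ for every polynomial $p$ and every $j=1,\dots,m$, where $T_j$ acts in the variable $z$.
   Context: Let $G\subset O(m)$ be a finite reflection group with root system $R$, fixed positive subsystem $R_+$, and let $\kappa:R\to[0,\infty)$ be a $G$-invariant multiplicity function. For $\alpha\in R$, $\sigma_\alpha x=x-2\langle x,\alpha\rangle\alpha/\|\alpha\|^2$. The Dunkl operators are $T_jf(x)=\partial_jf(x)+\sum_{\alpha\in R_+}\kappa(\alpha)\alpha_j\frac{f(x)-f(\sigma_\alpha x)}{\langle \alpha,x\rangle}$. The Dunkl kernel $E_\kappa(x,y)$ (holomorphically extended to $\mathbb{C}^m\times\mathbb{C}^m$) is the unique function with $T^{(x)}_jE_\kappa(x,y)=y_jE_\kappa(x,y)$ and $E_\kappa(0,y)=1$. $\Delta_{(y)}$ is the ordinary Laplacian in $y$ and $e^{-\Delta_{(y)}/2}F(y)=\sum_{n\ge0}\frac{(-1)^n}{2^nn!}\Delta_{(y)}^nF(y)$, which converges for $F(y)=E_\kappa(iy,z)$. The Fourier transform is $\mathcal Ff(y)=(2\pi)^{-m/2}\int_{\mathbb{R}^m}e^{-i\langle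 x,y\rangle}f(x)\,dx$. *)

theory Defs
  imports "HOL-Analysis.Analysis"
begin

definition refl :: "real^'n \<Rightarrow> real^'n \<Rightarrow> real^'n" where
  "refl \<alpha> x = x - (2 * (x \<bullet> \<alpha>) / (\<alpha> \<bullet> \<alpha>)) *\<^sub>R \<alpha>"

definition root_system :: "(real^'n) set \<Rightarrow> bool" where
  "root_system R \<longleftrightarrow> finite R \<and> 0 \<notin> R \<and>
     (\<forall>\<alpha>\<in>R. \<forall>c::real. c *\<^sub>R \<alpha> \<in> R \<longleftrightarrow> c = 1 \<or> c = -1) \<and>
     (\<forall>\<alpha>\<in>R. \<forall>\<beta>\<in>R. refl \<alpha> \<beta> \<in> R)"

definition positive_subsystem :: "(real^'n) set \<Rightarrow> (real^'n) set \<Rightarrow> bool" where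
  "positive_subsystem R Rp \<longleftrightarrow>
     (\<exists>\<beta>. (\<forall>\<alpha>\<in>R. \<alpha> \<bullet> \<beta> \<noteq> 0) \<and> Rp = {\<alpha>\<in>R. \<alpha> \<bullet> \<beta> > 0})"

inductive_set refl_group :: "(real^'n) set \<Rightarrow> (real^'n \<Rightarrow> real^'n) set" for R where
  id: "id \<in> refl_group R"
| step: "g \<in> refl_group R \<Longrightarrow> \<beta> \<in> R \<Longrightarrow> (refl \<beta> \<circ> g) \<in> refl_group R"

definition partial :: "'n \<Rightarrow> (real^'n \<Rightarrow> complex) \<Rightarrow> real^'n \<Rightarrow> complex" where
  "partial j f y = vector_derivative (\<lambda>t. f (y + t *\<^sub>R axis j 1)) (at 0)"

definition dir_deriv :: "real^'n \<Rightarrow> (real^'n \<Rightarrow> complex) \<Rightarrow> real^'n \<Rightarrow> complex" where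
  "dir_deriv v f y = vector_derivative (\<lambda>t. f (y + t *\<^sub>R v)) (at 0)"

definition laplacian :: "(real^'n \<Rightarrow> complex) \<Rightarrow> real^'n \<Rightarrow> complex" where
  "laplacian f y = (\<Sum>k\<in>UNIV. partial k (partial k f) y)"

definition heat_op :: "(real^'n \<Rightarrow> complex) \<Rightarrow> real^'n \<Rightarrow> complex" where
  "heat_op F y = (\<Sum>n. complex_of_real ((-1)^n / (2^n * fact n)) * (laplacian ^^ n) F y)"

text \<open>Difference quotient (f(x) - f(\<sigma>_\<alpha> x))/<\<alpha>,x>, extended continuously to the hyperplane
  <\<alpha>,x> = 0 by its limit 2/|\<alpha>|^2 \<partial>_\<alpha> f(x).\<close>
definition dunkl_diff :: "real^'n \<Rightarrow> (real^'n \<Rightarrow> complex) \<Rightarrow> real^'n \<Rightarrow> complex" where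
  "dunkl_diff \<alpha> f x =
     (if x \<bullet> \<alpha> = 0 then complex_of_real (2 / (\<alpha> \<bullet> \<alpha>)) * dir_deriv \<alpha> f x
      else (f x - f (refl \<alpha> x)) / complex_of_real (\<alpha> \<bullet> x))"

definition dunkl_op :: "(real^'n) set \<Rightarrow> (real^'n \<Rightarrow> real) \<Rightarrow> 'n \<Rightarrow> (real^'n \<Rightarrow> complex) \<Rightarrow> real^'n \<Rightarrow> complex" where
  "dunkl_op Rp \<kappa> j f x = partial j f x + (\<Sum>\<alpha>\<in>Rp. complex_of_real (\<kappa> \<alpha> * \<alpha> $ j) * dunkl_diff \<alpha> f x)"

definition cvec :: "real^'n \<Rightarrow> complex^'n" where
  "cvec x = (\<chi> k. complex_of_real (x $ k))"

definition ivec :: "real^'n \<Rightarrow> complex^'n" where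
  "ivec y = (\<chi> k. \<i> * complex_of_real (y $ k))"

definition imul2 :: "(complex^'n) \<times> (complex^'n) \<Rightarrow> (complex^'n) \<times> (complex^'n)" where
  "imul2 q = ((\<chi> k. \<i> * fst q $ k), (\<chi> k. \<i> * snd q $ k))"

definition holo2 :: "(complex^'n \<Rightarrow> complex^'n \<Rightarrow> complex) \<Rightarrow> bool" where
  "holo2 F \<longleftrightarrow> (\<forall>p. \<exists>D. ((\<lambda>q. F (fst q) (snd q)) has_derivative D) (at p) \<and>
                        (\<forall>v. D (imul2 v) = \<i> * D v))"

definition dunkl_kernel :: "(real^'n) set \<Rightarrow> (real^'n \<Rightarrow> real) \<Rightarrow> complex^'n \<Rightarrow> complex^'n \<Rightarrow> complex" where
  "dunkl_kernel Rp \<kappa> = (THE F. holo2 F \<and> (\<forall>y. F 0 y = 1) \<and>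
      (\<forall>y j x. dunkl_op Rp \<kappa> j (\<lambda>x'. F (cvec x') y) x = y $ j * F (cvec x) y))"

definition poly_fun :: "(real^'n \<Rightarrow> complex) \<Rightarrow> bool" where
  "poly_fun p \<longleftrightarrow> (\<exists>(A :: ('n \<Rightarrow> nat) set) (c :: ('n \<Rightarrow> nat) \<Rightarrow> complex). finite A \<and>
      (\<forall>x. p x = (\<Sum>a\<in>A. c a * (\<Prod>k\<in>UNIV. complex_of_real (x $ k) ^ a k))))"

definition fourier :: "(real^'n \<Rightarrow> complex) \<Rightarrow> real^'n \<Rightarrow> complex" where
  "fourier f y = complex_of_real ((2 * pi) powr (- real CARD('n) / 2)) *
     (LINT x|lborel. exp (- \<i> * complex_of_real (x \<bullet> y)) * f x)"

definition Kfun :: "(real^'n) set \<Rightarrow> (real^'n \<Rightarrow> real) \<Rightarrow> real^'n \<Rightarrow> real^'n \<Rightarrow> complex" where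
  "Kfun Rp \<kappa> y z = heat_op (\<lambda>y'. dunkl_kernel Rp \<kappa> (ivec y') (cvec z)) y"

definition Vop :: "(real^'n) set \<Rightarrow> (real^'n \<Rightarrow> real) \<Rightarrow> (real^'n \<Rightarrow> complex) \<Rightarrow> real^'n \<Rightarrow> complex" where
  "Vop Rp \<kappa> p z = complex_of_real ((2 * pi) powr (- real CARD('n) / 2)) *
     (LINT y|lborel. Kfun Rp \<kappa> y z * fourier (\<lambda>x. p x * complex_of_real (exp (- ((norm x) ^ 2) / 2))) y)"

end

theory Submission
  imports Defs "HOL-Probability.Characteristic_Functions" "HOL-Complex_Analysis.Conformal_Mappings"
begin

text \<open>
  For \<open>\<kappa> \<ge> 0\<close> the operator \<open>n + \<Sum> \<kappa>(\<alpha>) (1 - \<sigma>\<^sub>\<alpha>)\<close> is invertible for every \<open>n \<ge> 1\<close>, so the Euler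
  equation \<open>\<Sum> x\<^sub>j T\<^sub>j E = \<langle>x, y\<rangle> E\<close> determines the homogeneous parts \<open>E\<^sub>n\<close> of the Dunkl kernel
  recursively, with \<open>|E\<^sub>n| \<le> C\<^sup>n / n!\<close> on bounded sets. Equivariance of the recursion makes \<open>E\<^sub>n\<close> symmetric in its
  arguments; applying \<open>T\<^sub>j\<close> to it shows that the vector \<open>T E\<^sub>n - y E\<^bsub>n-1\<^esub>\<close> solves a homogeneous
  equation of the same type, which has only the zero solution. Hence \<open>E = \<Sum> E\<^sub>n\<close> is the Dunkl kernel.

  The Fourier transform of \<open>p e\<^bsup>-|x|\<^sup>2/2\<^esup>\<close> is \<open>q e\<^bsup>-|y|\<^sup>2/2\<^esup>\<close> for a polynomial \<open>q\<close>, and replacing \<open>p\<close>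
  by \<open>\<partial>\<^sub>j p\<close> replaces \<open>q\<close> by \<open>i \<partial>\<^sub>j q\<close>. Since \<open>e\<^bsup>-\<Delta>/2\<^esup> y\<^sub>j = (y\<^sub>j - \<partial>\<^sub>j) e\<^bsup>-\<Delta>/2\<^esup>\<close>, integration by parts turns
  multiplication of the kernel by \<open>i y\<^sub>j\<close> into differentiation of \<open>p\<close>. In particular only the
  parts \<open>E\<^sub>n\<close> with \<open>n \<le> deg p\<close> contribute to \<open>V(p)\<close>, and on these \<open>T\<^sub>j\<close> in \<open>z\<close> is multiplication by \<open>i y\<^sub>j\<close>.
\<close>

text \<open>\<open>dunkl_kernel\<close> is a definite description, so nothing is known about it
  until existence and uniqueness are both proved. Its eigenvalue equation constrains a candidate
  only at real first arguments. Uniqueness therefore has two stages: an energy estimate over group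
  orbits in \<open>real^'n\<close>, then analytic continuation to \<open>complex^'n\<close>.

  Symmetry of the kernel matters because \<open>Kfun\<close> has the integration variable in the
  first argument and z in the second, whereas the eigenvalue equation concerns the first.

  The bound with n! comes from positivity: the group-algebra inverse of the operator in degree n has
  nonnegative coefficients with sum 1/n, hence norm at most 1/n, and n steps of the recursion give
  1/n!.

  T_j is never moved under the integral. Expanding E_n over words separates its variables, so
  pairing it with p leaves a finite combination of functions of z, and the limits taken in
  evaluating V(p) are all taken at fixed z.\<close>

section \<open>Gaussian integrals on Euclidean space\<close>

lemma
  fixes f :: "'a::euclidean_space \<Rightarrow> real \<Rightarrow> 'b::{real_normed_field,banach,second_countable_topology}"
  assumes f: "\<And>b. b \<in> Basis \<Longrightarrow> integrable lborel (f b)"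
  shows integrable_lborel_prod_Basis: "integrable lborel (\<lambda>x. \<Prod>b\<in>Basis. f b (x \<bullet> b))"
    and integral_lborel_prod_Basis:
      "(LINT x|lborel. (\<Prod>b\<in>Basis. f b (x \<bullet> b))) = (\<Prod>b\<in>Basis. (LINT t|lborel. f b t))"
proof -
  interpret product_sigma_finite "\<lambda>b::'a. lborel :: real measure"
    by unfold_locales
  have f_meas [measurable]: "f b \<in> borel_measurable borel" if "b \<in> Basis" for b
    using borel_measurable_integrable[OF f[OF that]] by simp
  have meas: "(\<lambda>x. \<Prod>b\<in>Basis. f b (x \<bullet> b)) \<in> borel_measurable borel"
    by (rule borel_measurable_prod) (measurable; simp)
  have T: "(\<lambda>g. \<Sum>b\<in>Basis. g b *\<^sub>R b) \<in> measurable (\<Pi>\<^sub>M b\<in>Basis. lborel) (borel :: 'a measure)"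
    by measurable
  have eq: "(\<Prod>b\<in>Basis. f b ((\<Sum>c\<in>Basis. g c *\<^sub>R c) \<bullet> b)) = (\<Prod>b\<in>Basis. f b (g b))"
    for g :: "'a \<Rightarrow> real"
    by (intro prod.cong refl) (simp add: inner_sum_left inner_Basis if_distrib cong: if_cong)
  show "integrable lborel (\<lambda>x. \<Prod>b\<in>Basis. f b (x \<bullet> b))"
    using product_integrable_prod[of Basis f, OF _ f]
    by (subst lborel_eq) (simp add: integrable_distr_eq[OF T meas] eq)
  show "(LINT x|lborel. (\<Prod>b\<in>Basis. f b (x \<bullet> b))) = (\<Prod>b\<in>Basis. (LINT t|lborel. f b t))"
    using product_integral_prod[of Basis f, OF _ f]
    by (subst lborel_eq) (simp add: integral_distr[OF T meas] eq)
qed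

lemma norm_power2_eq_sum_Basis: "(norm x)\<^sup>2 = (\<Sum>b\<in>Basis. (x \<bullet> b)\<^sup>2)" for x :: "'a::euclidean_space"
  by (subst power2_norm_eq_inner, subst euclidean_inner) (simp add: power2_eq_square)

text \<open>Half of the exponent of the Gaussian weight \<open>exp (- (norm x)\<^sup>2 / 2)\<close>
  will be spent on absorbing polynomial and exponential factors; this is the half that remains. In
  one dimension it is a multiple of the normal density of variance 2.\<close>

lemma integrable_exp_neg_norm_power2:
  "integrable lborel (\<lambda>x::'a::euclidean_space. exp (- (norm x)\<^sup>2 / 4))"
proof -
  have "integrable lborel (\<lambda>t. sqrt (4 * pi) * normal_density 0 (sqrt 2) t)"
    by simp
  then have "integrable lborel (\<lambda>t::real. exp (- t\<^sup>2 / 4))"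
    by (simp add: normal_density_def)
  from integrable_lborel_prod_Basis[of "\<lambda>_. \<lambda>t. exp (- t\<^sup>2 / 4)", OF this]
  have "integrable lborel (\<lambda>x::'a. \<Prod>b\<in>Basis. exp (- (x \<bullet> b)\<^sup>2 / 4))" .
  also have "(\<lambda>x::'a. \<Prod>b\<in>Basis. exp (- (x \<bullet> b)\<^sup>2 / 4)) = (\<lambda>x. exp (- (norm x)\<^sup>2 / 4))"
    by (simp add: exp_sum[symmetric] norm_power2_eq_sum_Basis sum_divide_distrib sum_negf)
  finally show ?thesis .
qed

lemma std_normal_fourier:
  fixes s :: real
  shows "integrable lborel (\<lambda>t. exp (- \<i> * complex_of_real (t * s)) * complex_of_real (exp (- t\<^sup>2 / 2)))"
    and "(LINT t|lborel. exp (- \<i> * complex_of_real (t * s)) * complex_of_real (exp (- t\<^sup>2 / 2)))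
       = complex_of_real (sqrt (2 * pi) * exp (- s\<^sup>2 / 2))"
proof -
  have int: "integrable lborel (\<lambda>t::real. exp (- t\<^sup>2 / 2))"
  proof -
    have "integrable lborel (\<lambda>t. sqrt (2 * pi) * normal_density 0 1 t)"
      by simp
    then show ?thesis by (simp add: normal_density_def)
  qed
  show "integrable lborel (\<lambda>t. exp (- \<i> * complex_of_real (t * s)) * complex_of_real (exp (- t\<^sup>2 / 2)))"
    by (rule Bochner_Integration.integrable_bound[OF int]) (auto simp: norm_mult)
  \<comment> \<open>Characteristic functions carry the opposite sign in the exponent, hence the
    argument - s.\<close>
  have "char std_normal_distribution (- s) = (CLINT t|lborel. std_normal_density t *\<^sub>R iexp (- s * t))"
    unfolding char_def by (subst integral_density) auto
  also have "\<dots> = (CLINT t|lborel. (1 / sqrt (2 * pi)) *\<^sub>R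
      (exp (- \<i> * complex_of_real (t * s)) * complex_of_real (exp (- t\<^sup>2 / 2))))"
    by (intro Bochner_Integration.integral_cong refl)
       (simp add: std_normal_density_def scaleR_conv_of_real mult_ac)
  finally have "complex_of_real (exp (- s\<^sup>2 / 2)) = (1 / sqrt (2 * pi)) *\<^sub>R
     (LINT t|lborel. exp (- \<i> * complex_of_real (t * s)) * complex_of_real (exp (- t\<^sup>2 / 2)))"
    by (simp add: char_std_normal_distribution)
  then show "(LINT t|lborel. exp (- \<i> * complex_of_real (t * s)) * complex_of_real (exp (- t\<^sup>2 / 2)))
       = complex_of_real (sqrt (2 * pi) * exp (- s\<^sup>2 / 2))"
    by (simp add: scaleR_conv_of_real field_simps)
qed

lemma integral_fourier_gaussian:
  fixes y :: "'a::euclidean_space"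
  shows "(LINT x|lborel. exp (- \<i> * complex_of_real (x \<bullet> y)) * complex_of_real (exp (- (norm x)\<^sup>2 / 2)))
    = complex_of_real (sqrt (2 * pi) ^ DIM('a) * exp (- (norm y)\<^sup>2 / 2))"
proof -
  let ?f = "\<lambda>b t. exp (- \<i> * complex_of_real (t * (y \<bullet> b))) * complex_of_real (exp (- t\<^sup>2 / 2))"
  have exp_prod: "(\<Prod>b\<in>Basis. exp (- (x \<bullet> b)\<^sup>2 / 2)) = exp (- (norm x)\<^sup>2 / 2)" for x :: 'a
    by (simp add: exp_sum[symmetric] norm_power2_eq_sum_Basis sum_divide_distrib sum_negf)
  have exp_prod': "(\<Prod>b\<in>Basis. complex_of_real (exp (- (x \<bullet> b)\<^sup>2 / 2))) =
      complex_of_real (exp (- (norm x)\<^sup>2 / 2))" for x :: 'a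
    by (simp only: exp_prod[symmetric] of_real_prod)
  have exp_prod'': "(\<Prod>b\<in>Basis. exp (- \<i> * complex_of_real ((x \<bullet> b) * (y \<bullet> b)))) =
      exp (- \<i> * complex_of_real (x \<bullet> y))" for x
    by (subst euclidean_inner[of x y]) (simp add: exp_sum[symmetric] sum_negf sum_distrib_left[symmetric])
  have "(\<Prod>b\<in>Basis. ?f b (x \<bullet> b)) =
      exp (- \<i> * complex_of_real (x \<bullet> y)) * complex_of_real (exp (- (norm x)\<^sup>2 / 2))" for x
    by (simp only: prod.distrib exp_prod' exp_prod'')
  then have "(LINT x|lborel. exp (- \<i> * complex_of_real (x \<bullet> y)) * complex_of_real (exp (- (norm x)\<^sup>2 / 2)))
    = (LINT x|lborel. (\<Prod>b\<in>Basis. ?f b (x \<bullet> b)))"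
    by simp
  also have "\<dots> = (\<Prod>b\<in>Basis. complex_of_real (sqrt (2 * pi) * exp (- (y \<bullet> b)\<^sup>2 / 2)))"
    by (subst integral_lborel_prod_Basis) (use std_normal_fourier in auto)
  also have "\<dots> = complex_of_real (\<Prod>b\<in>Basis. (sqrt (2 * pi) * exp (- (y \<bullet> b)\<^sup>2 / 2)))"
    by simp
  also have "\<dots> = complex_of_real (sqrt (2 * pi) ^ DIM('a) * exp (- (norm y)\<^sup>2 / 2))"
    by (simp only: prod.distrib exp_prod prod_constant)
  finally show ?thesis .
qed

section \<open>Translation invariance and integrals of derivatives\<close>

lemma lborel_translate:
  fixes f :: "'a::euclidean_space \<Rightarrow> 'b::{banach,second_countable_topology}"
  assumes "integrable lborel f"
  shows "integrable lborel (\<lambda>x. f (x + c))" "(LINT x|lborel. f (x + c)) = (LINT x|lborel. f x)"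
proof -
  have [measurable]: "f \<in> borel_measurable borel"
    using borel_measurable_integrable[OF assms] by simp
  have d: "lborel = distr lborel borel (\<lambda>x. x + c)"
    using lborel_distr_plus[of c] by (simp add: add.commute[of _ c])
  have "integrable (distr lborel borel (\<lambda>x. x + c)) f"
    using assms d by simp
  then show "integrable lborel (\<lambda>x. f (x + c))"
    by (subst (asm) integrable_distr_eq) auto
  have "(LINT x|lborel. f x) = (LINT x|distr lborel borel (\<lambda>x. x + c). f x)"
    using d by simp
  also have "\<dots> = (LINT x|lborel. f (x + c))"
    by (subst integral_distr) auto
  finally show "(LINT x|lborel. f (x + c)) = (LINT x|lborel. f x)" by simp
qed

text \<open>Partial derivatives are taken at parameter 0 only. Moving the base point along the line
  turns this into differentiability at every parameter, which the fundamental theorem and termwise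
  differentiation require.\<close>

lemma has_vector_derivative_line_shift:
  fixes x v :: "'a::real_vector"
  assumes "((\<lambda>s. f ((x + t *\<^sub>R v) + s *\<^sub>R v)) has_vector_derivative d) (at 0)"
  shows "((\<lambda>t. f (x + t *\<^sub>R v)) has_vector_derivative d) (at t)"
proof -
  have "((\<lambda>s. f ((x + t *\<^sub>R v) + s *\<^sub>R v)) has_vector_derivative d) (at (t - t))"
    using assms by simp
  moreover have "((\<lambda>s. s - t) has_vector_derivative 1) (at t)"
    by (auto intro!: derivative_eq_intros)
  ultimately have "((\<lambda>s. f ((x + t *\<^sub>R v) + s *\<^sub>R v)) \<circ> (\<lambda>s. s - t) has_vector_derivative 1 *\<^sub>R d) (at t)"
    by (rule vector_diff_chain_at[rotated])
  then show ?thesis by (simp add: o_def scaleR_diff_left)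
qed

text \<open>The integral of \<open>h (x + v) - h x\<close> over all \<open>x\<close> vanishes by translation invariance; writing the
  difference as the integral of the derivative along the segment and exchanging integrals
  gives the claim.\<close>

lemma integral_directional_derivative_eq_0:
  fixes h d :: "'a::euclidean_space \<Rightarrow> complex"
  assumes deriv: "\<And>x. ((\<lambda>t. h (x + t *\<^sub>R v)) has_vector_derivative d x) (at 0)"
    and cont: "continuous_on UNIV d"
    and h: "integrable lborel h" and d: "integrable lborel d"
  shows "(LINT x|lborel. d x) = 0"
proof -
  have d_meas [measurable]: "d \<in> borel_measurable borel"
    using cont by (rule borel_measurable_continuous_onI)
  have deriv_t: "((\<lambda>t. h (x + t *\<^sub>R v)) has_vector_derivative d (x + t *\<^sub>R v)) (at t)" for x t
    by (rule has_vector_derivative_line_shift[OF deriv])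
  have FTC: "(LINT t|lborel. indicator {0..1} t *\<^sub>R d (x + t *\<^sub>R v)) = h (x + v) - h x" for x
  proof -
    have "has_bochner_integral lborel (\<lambda>t. indicator {0..1} t *\<^sub>R d (x + t *\<^sub>R v))
        (h (x + 1 *\<^sub>R v) - h (x + 0 *\<^sub>R v))"
      by (rule has_bochner_integral_FTC_Icc)
         (auto intro: deriv_t has_vector_derivative_at_within
            intro!: continuous_intros continuous_on_compose2[OF cont])
    then show ?thesis
      by (simp add: has_bochner_integral_integral_eq)
  qed
  let ?f = "\<lambda>t x. indicator {0..1::real} t *\<^sub>R d (x + t *\<^sub>R v)"
  have inner: "(LINT x|lborel. norm (?f t x)) = indicator {0..1} t *\<^sub>R (LINT x|lborel. norm (d x))" for t
    using lborel_translate(2)[of "\<lambda>x. norm (d x)" "t *\<^sub>R v"] d by (simp add: indicator_def)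
  have int: "integrable (lborel \<Otimes>\<^sub>M lborel) (case_prod ?f)"
  proof (rule lborel_pair.Fubini_integrable)
    show "case_prod ?f \<in> borel_measurable (lborel \<Otimes>\<^sub>M lborel)"
      by measurable
    show "integrable lborel (\<lambda>t. LINT x|lborel. norm (case_prod ?f (t, x)))"
      by (simp only: prod.case inner) simp
    show "AE t in lborel. integrable lborel (\<lambda>x. case_prod ?f (t, x))"
      using lborel_translate(1)[OF d] by simp
  qed
  have "(LINT x|lborel. LINT t|lborel. ?f t x) = (LINT t|lborel. LINT x|lborel. ?f t x)"
    using lborel_pair.Fubini_integral[OF int] .
  also have "\<dots> = (LINT t|lborel. indicator {0..1::real} t *\<^sub>R (LINT x|lborel. d x))"
    by (simp only: integral_scaleR_right lborel_translate(2)[OF d])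
  also have "\<dots> = (LINT x|lborel. d x)"
    by simp
  finally have "(LINT x|lborel. d x) = (LINT x|lborel. h (x + v) - h x)"
    by (simp add: FTC)
  also have "\<dots> = 0"
    using lborel_translate[OF h, of v] h by simp
  finally show ?thesis .
qed

section \<open>Gaussian domination and termwise differentiation\<close>

text \<open>The exponential series gives s^n <= n! e^s, which merges the power into the exponential
  factor. The square of s/2 - (r + 1) being nonnegative then trades the linear exponent for half of
  the Gaussian one and a constant.\<close>

lemma exp_linear_gaussian_bound:
  fixes s r :: real
  assumes "s \<ge> 0"
  shows "s ^ n * exp (r * s) * exp (- s\<^sup>2 / 2) \<le> fact n * exp ((r + 1)\<^sup>2) * exp (- s\<^sup>2 / 4)"
proof -
  have "s ^ n / fact n \<le> exp s"
  proof -
    have "s ^ n / fact n = (\<Sum>i\<in>{n}. s ^ i /\<^sub>R fact i)"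
      by (simp add: field_simps)
    also have "\<dots> \<le> exp s"
      unfolding exp_def using assms by (intro sum_le_suminf summable_exp_generic) auto
    finally show ?thesis .
  qed
  then have 1: "s ^ n \<le> fact n * exp s"
    by (simp add: field_simps)
  have "exp s * exp (r * s) * exp (- s\<^sup>2 / 2) = exp ((r + 1) * s - s\<^sup>2 / 2)"
    by (simp add: exp_add[symmetric] algebra_simps)
  also have "\<dots> \<le> exp ((r + 1)\<^sup>2 - s\<^sup>2 / 4)"
  proof -
    have "0 \<le> (s / 2 - (r + 1))\<^sup>2" by simp
    then have "(r + 1) * s - s\<^sup>2 / 2 \<le> (r + 1)\<^sup>2 - s\<^sup>2 / 4"
      by (simp add: power2_eq_square algebra_simps)
    then show ?thesis by simp
  qed
  also have "\<dots> = exp ((r + 1)\<^sup>2) * exp (- s\<^sup>2 / 4)"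
    by (simp add: exp_add[symmetric])
  finally have 2: "exp s * exp (r * s) * exp (- s\<^sup>2 / 2) \<le> exp ((r + 1)\<^sup>2) * exp (- s\<^sup>2 / 4)" .
  have "s ^ n * exp (r * s) * exp (- s\<^sup>2 / 2) \<le> fact n * exp s * exp (r * s) * exp (- s\<^sup>2 / 2)"
    using 1 by (intro mult_right_mono) auto
  also have "\<dots> = fact n * (exp s * exp (r * s) * exp (- s\<^sup>2 / 2))"
    by simp
  also have "\<dots> \<le> fact n * (exp ((r + 1)\<^sup>2) * exp (- s\<^sup>2 / 4))"
    using 2 by (intro mult_left_mono) auto
  finally show ?thesis by (simp add: mult_ac)
qed

lemma integrable_exp_linear_gaussian:
  "integrable lborel (\<lambda>x::'a::euclidean_space. norm x ^ n * exp (r * norm x) * exp (- (norm x)\<^sup>2 / 2))"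
proof (rule Bochner_Integration.integrable_bound)
  show "integrable lborel (\<lambda>x::'a. fact n * exp ((r + 1)\<^sup>2) * exp (- (norm x)\<^sup>2 / 4))"
    using integrable_exp_neg_norm_power2 by simp
  show "AE x in lborel. norm (norm x ^ n * exp (r * norm x) * exp (- (norm (x::'a))\<^sup>2 / 2))
      \<le> norm (fact n * exp ((r + 1)\<^sup>2) * exp (- (norm x)\<^sup>2 / 4))"
    using exp_linear_gaussian_bound[of "norm x" n r for x :: 'a] by (auto simp: abs_mult)
qed measurable

text \<open>Weierstrass test for derivatives: since \<open>M\<close> does not depend on the point of
  S and the bound is proportional to \<open>norm h\<close>, the tails of the derivative series are
  small uniformly in the sense that \<open>has_derivative_series\<close> asks for.\<close>

lemma has_derivative_suminf:
  fixes f :: "nat \<Rightarrow> 'a::real_normed_vector \<Rightarrow> 'b::banach"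
  assumes S: "convex S" "open S" "x \<in> S"
    and deriv: "\<And>n x. x \<in> S \<Longrightarrow> (f n has_derivative f' n x) (at x)"
    and bound: "\<And>n x h. x \<in> S \<Longrightarrow> norm (f' n x h) \<le> M n * norm h"
    and M: "summable M"
    and sums: "\<And>x. x \<in> S \<Longrightarrow> summable (\<lambda>n. f n x)"
  shows "((\<lambda>x. \<Sum>n. f n x) has_derivative (\<lambda>h. \<Sum>n. f' n x h)) (at x)"
proof -
  have summ: "summable (\<lambda>n. norm (f' n x h))" if "x \<in> S" for x h
    by (rule summable_comparison_test'[OF summable_mult2[OF M, of "norm h"]]) (use bound that in auto)
  have "\<forall>\<^sub>F n in sequentially. \<forall>x\<in>S. \<forall>h. norm ((\<Sum>i<n. f' i x h) - (\<Sum>i. f' i x h)) \<le> e * norm h"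
    if "e > 0" for e
  proof -
    have "(\<lambda>n. \<Sum>k. M (k + n)) \<longlonglongrightarrow> 0"
      by (rule suminf_exist_split2[OF M])
    then have "\<forall>\<^sub>F n in sequentially. (\<Sum>k. M (k + n)) < e"
      using order_tendstoD(2) \<open>e > 0\<close> by blast
    then show ?thesis
    proof eventually_elim
      case (elim n)
      show ?case
      proof (intro ballI allI)
        fix x h assume x: "x \<in> S"
        have "(\<Sum>i. f' i x h) - (\<Sum>i<n. f' i x h) = (\<Sum>i. f' (i + n) x h)"
          using suminf_split_initial_segment[OF summable_norm_cancel[OF summ[OF x]], of h n] by simp
        then have "norm ((\<Sum>i<n. f' i x h) - (\<Sum>i. f' i x h)) = norm (\<Sum>i. f' (i + n) x h)"
          by (metis norm_minus_commute)
        also have "\<dots> \<le> (\<Sum>i. M (i + n) * norm h)"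
          using bound[OF x] M by (intro norm_suminf_le summable_mult2) (auto simp: summable_iff_shift)
        also have "\<dots> = (\<Sum>i. M (i + n)) * norm h"
          using M by (intro suminf_mult2[symmetric]) (auto simp: summable_iff_shift)
        also have "\<dots> \<le> e * norm h"
          using elim by (intro mult_right_mono) auto
        finally show "norm ((\<Sum>i<n. f' i x h) - (\<Sum>i. f' i x h)) \<le> e * norm h" .
      qed
    qed
  qed
  from has_derivative_series[where f=f and f'=f' and g'="\<lambda>x h. \<Sum>i. f' i x h" and S=S and x=x,
      OF S(1) has_derivative_at_withinI[OF deriv] this S(3) summable_sums[OF sums[OF S(3)]]]
  obtain g where g: "\<And>x. x \<in> S \<Longrightarrow> (\<lambda>n. f n x) sums g x"
    "\<And>x. x \<in> S \<Longrightarrow> (g has_derivative (\<lambda>h. \<Sum>i. f' i x h)) (at x within S)"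
    by auto
  have "(g has_derivative (\<lambda>h. \<Sum>i. f' i x h)) (at x)"
    using g(2)[OF S(3)] at_within_open[OF S(3,2)] by simp
  then show ?thesis
    by (rule has_derivative_transform_within_open[OF _ S(2,3)]) (use g(1) sums_unique in blast)
qed

section \<open>Polynomial functions\<close>

text \<open>\<open>partial\<close> is a \<open>vector_derivative\<close>, whose value says nothing
  unless the derivative exists. Calculus rules are therefore proved for this relation and
  transferred to \<open>partial\<close> by uniqueness of derivatives.\<close>

definition has_partial :: "'n \<Rightarrow> (real^'n \<Rightarrow> complex) \<Rightarrow> (real^'n \<Rightarrow> complex) \<Rightarrow> bool" where
  "has_partial j f f' \<longleftrightarrow> (\<forall>y. ((\<lambda>t. f (y + t *\<^sub>R axis j 1)) has_vector_derivative f' y) (at 0))"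

lemma has_partial_imp_partial: "has_partial j f f' \<Longrightarrow> partial j f = f'"
  by (auto simp: has_partial_def partial_def vector_derivative_at)

lemma has_partial_const [intro]: "has_partial j (\<lambda>_. c) (\<lambda>_. 0)"
  by (simp add: has_partial_def)

lemma has_partial_add [intro]:
  "has_partial j f f' \<Longrightarrow> has_partial j g g' \<Longrightarrow> has_partial j (\<lambda>y. f y + g y) (\<lambda>y. f' y + g' y)"
  by (auto simp: has_partial_def intro!: derivative_intros)

lemma has_partial_mult [intro]:
  assumes "has_partial j f f'" "has_partial j g g'"
  shows "has_partial j (\<lambda>y. f y * g y) (\<lambda>y. f y * g' y + f' y * g y)"
  unfolding has_partial_def
proof
  fix y
  have "((\<lambda>t. f (y + t *\<^sub>R axis j 1) * g (y + t *\<^sub>R axis j 1)) has_vector_derivative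
      f (y + 0 *\<^sub>R axis j 1) * g' y + f' y * g (y + 0 *\<^sub>R axis j 1)) (at 0)"
    using assms unfolding has_partial_def by (intro has_vector_derivative_mult) auto
  then show "((\<lambda>t. f (y + t *\<^sub>R axis j 1) * g (y + t *\<^sub>R axis j 1)) has_vector_derivative
      f y * g' y + f' y * g y) (at 0)" by simp
qed

lemma has_partial_coord [intro]:
  fixes j k :: "'n::finite"
  shows "has_partial j (\<lambda>y. complex_of_real (y $ k)) (\<lambda>y. if k = j then 1 else 0)"
proof -
  have "((\<lambda>t. complex_of_real (y $ k + t * (axis j 1 :: real^'n) $ k)) has_vector_derivative
      complex_of_real (if k = j then 1 else 0)) (at 0)" for y :: "real^'n"
    by (rule derivative_eq_intros refl | simp add: axis_def)+
  then show ?thesis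
    by (auto simp: has_partial_def axis_def)
qed

text \<open>Polynomials are generated by the operations whose commutation with derivatives,
  Laplacian and heat operator is studied below, so that inductions need no multi-indices. The index
  is only an upper bound for the degree.\<close>

inductive poly_deg_le :: "nat \<Rightarrow> (real^'n \<Rightarrow> complex) \<Rightarrow> bool" where
  const: "poly_deg_le d (\<lambda>_. c)"
| coord: "poly_deg_le d f \<Longrightarrow> poly_deg_le (Suc d) (\<lambda>y. complex_of_real (y $ k) * f y)"
| add: "poly_deg_le d f \<Longrightarrow> poly_deg_le d g \<Longrightarrow> poly_deg_le d (\<lambda>y. f y + g y)"

lemma poly_deg_le_mono: "poly_deg_le d f \<Longrightarrow> d \<le> e \<Longrightarrow> poly_deg_le e f"
proof (induction arbitrary: e rule: poly_deg_le.induct)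
  case (coord d f k)
  then obtain e' where "e = Suc e'" "d \<le> e'" by (cases e) auto
  with coord show ?case by (auto intro: poly_deg_le.intros)
qed (auto intro: poly_deg_le.intros)

lemma poly_deg_le_cmult: "poly_deg_le d f \<Longrightarrow> poly_deg_le d (\<lambda>y. c * f y)"
proof (induction rule: poly_deg_le.induct)
  case (coord d f k)
  from poly_deg_le.coord[OF coord.IH, of k] show ?case by (simp add: mult_ac)
qed (auto intro: poly_deg_le.intros simp: distrib_left)

lemma poly_deg_le_mult:
  "poly_deg_le d f \<Longrightarrow> poly_deg_le e g \<Longrightarrow> poly_deg_le (d + e) (\<lambda>y. f y * g y)"
proof (induction rule: poly_deg_le.induct)
  case (const d c)
  then show ?case by (auto intro: poly_deg_le_mono[OF poly_deg_le_cmult])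
next
  case (coord d f k)
  from poly_deg_le.coord[OF coord.IH[OF coord.prems], of k] show ?case by (simp add: mult_ac)
qed (auto intro: poly_deg_le.intros simp: distrib_right)

lemma poly_deg_le_sum:
  "(\<And>i. i \<in> I \<Longrightarrow> poly_deg_le d (f i)) \<Longrightarrow> poly_deg_le d (\<lambda>y. \<Sum>i\<in>I. f i y)"
  by (induction I rule: infinite_finite_induct) (auto intro: poly_deg_le.intros)

text \<open>The last conjunct repairs truncated subtraction: for d = 0 the bound d - 1 would only
  say that the derivative is constant. The coordinate case needs it to vanish there, since otherwise
  multiplication by a coordinate would raise the degree to 1.\<close>

lemma poly_deg_le_has_partial_ex:
  assumes "poly_deg_le d f"
  shows "\<exists>f'. has_partial j f f' \<and> poly_deg_le (d - 1) f' \<and> (d = 0 \<longrightarrow> f' = (\<lambda>_. 0))"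
  using assms
proof (induction rule: poly_deg_le.induct)
  case (const d c)
  then show ?case by (intro exI[of _ "\<lambda>_. 0"]) (auto intro: poly_deg_le.const)
next
  case (coord d f k)
  then obtain f' where f': "has_partial j f f'" "poly_deg_le (d - 1) f'" "d = 0 \<Longrightarrow> f' = (\<lambda>_. 0)"
    by auto
  have "poly_deg_le d (\<lambda>y. complex_of_real (y $ k) * f' y)"
  proof (cases d)
    case 0
    then show ?thesis using f'(3) by (auto intro: poly_deg_le.const)
  next
    case (Suc e)
    then show ?thesis using f'(2) by (auto intro: poly_deg_le.coord)
  qed
  moreover have "poly_deg_le d (\<lambda>y. (if k = j then 1 else 0) * f y)"
    using coord.hyps by (rule poly_deg_le_cmult)
  ultimately have "poly_deg_le d (\<lambda>y. complex_of_real (y $ k) * f' y + (if k = j then 1 else 0) * f y)"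
    by (rule poly_deg_le.add)
  then show ?case
    using has_partial_mult[OF has_partial_coord[of j k] f'(1)] by auto
next
  case (add d f g)
  then show ?case by (fastforce intro: poly_deg_le.add)
qed

lemma
  assumes "poly_deg_le d f"
  shows poly_deg_le_has_partial: "has_partial j f (partial j f)"
    and poly_deg_le_partial: "poly_deg_le (d - 1) (partial j f)"
    and partial_degree_0: "d = 0 \<Longrightarrow> partial j f = (\<lambda>_. 0)"
  using poly_deg_le_has_partial_ex[OF assms, of j] has_partial_imp_partial by metis+

lemma poly_deg_le_partial': "poly_deg_le d f \<Longrightarrow> poly_deg_le d (partial j f)"
  by (rule poly_deg_le_mono[OF poly_deg_le_partial]) auto

lemma partial_const [simp]: "partial j (\<lambda>_. c) = (\<lambda>_. 0)"
  by (rule has_partial_imp_partial) auto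

lemma partial_add:
  assumes "poly_deg_le d f" "poly_deg_le e g"
  shows "partial j (\<lambda>y. f y + g y) = (\<lambda>y. partial j f y + partial j g y)"
  using assms by (intro has_partial_imp_partial has_partial_add poly_deg_le_has_partial)

lemma partial_sum:
  assumes "\<And>i. i \<in> I \<Longrightarrow> poly_deg_le d (f i)"
  shows "partial j (\<lambda>y. \<Sum>i\<in>I. f i y) = (\<lambda>y. \<Sum>i\<in>I. partial j (f i) y)"
  using assms
proof (induction I rule: infinite_finite_induct)
  case (insert i I)
  then show ?case
    using partial_add[of d "f i" d "\<lambda>y. \<Sum>i\<in>I. f i y" j] by (auto intro: poly_deg_le_sum)
qed auto

lemma partial_coord:
  assumes "poly_deg_le d f"
  shows "partial j (\<lambda>y. complex_of_real (y $ k) * f y) =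
    (\<lambda>y. complex_of_real (y $ k) * partial j f y + (if k = j then 1 else 0) * f y)"
  using assms by (intro has_partial_imp_partial has_partial_mult has_partial_coord poly_deg_le_has_partial)

lemma partial_cmult:
  assumes "poly_deg_le d f"
  shows "partial j (\<lambda>y. c * f y) = (\<lambda>y. c * partial j f y)"
  using has_partial_mult[OF has_partial_const poly_deg_le_has_partial[OF assms], of j c]
  by (auto dest: has_partial_imp_partial)

lemma partial_commute:
  assumes "poly_deg_le d f"
  shows "partial j (partial k f) = partial k (partial j f)"
  using assms
proof (induction rule: poly_deg_le.induct)
  case (coord d f l)
  note p = poly_deg_le_partial'[OF coord.hyps]
  note pc = poly_deg_le.coord[OF p] poly_deg_le_cmult[OF coord.hyps]
  show ?case
    by (simp only: partial_coord[OF coord.hyps] partial_add[OF pc] partial_coord[OF p]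
        partial_cmult[OF coord.hyps] coord.IH) (auto simp: fun_eq_iff)
next
  case (add d f g)
  show ?case
    by (simp only: partial_add[OF add.hyps] partial_add[OF poly_deg_le_partial'[OF add.hyps(1)]
        poly_deg_le_partial'[OF add.hyps(2)]] add.IH)
qed simp

text \<open>A drop by one degree instead of two is enough: it makes the Laplacian nilpotent on
  polynomials, so their heat series terminates.\<close>

lemma poly_deg_le_laplacian:
  assumes "poly_deg_le d f"
  shows "poly_deg_le (d - 1) (laplacian f)"
proof -
  have "laplacian f = (\<lambda>y. \<Sum>k\<in>UNIV. partial k (partial k f) y)"
    by (auto simp: laplacian_def)
  then show ?thesis
    using poly_deg_le_partial'[OF poly_deg_le_partial[OF assms]] by (auto intro: poly_deg_le_sum)
qed

lemma laplacian_degree_0: "poly_deg_le 0 f \<Longrightarrow> laplacian f = (\<lambda>_. 0)"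
  by (auto simp: laplacian_def partial_degree_0)

lemma laplacian_0 [simp]: "laplacian (\<lambda>_. 0) = (\<lambda>_. 0)"
  by (auto simp: laplacian_def)

lemma laplacian_add:
  assumes "poly_deg_le d f" "poly_deg_le e g"
  shows "laplacian (\<lambda>y. f y + g y) = (\<lambda>y. laplacian f y + laplacian g y)"
  by (simp add: laplacian_def fun_eq_iff partial_add[OF assms]
      partial_add[OF poly_deg_le_partial[OF assms(1)] poly_deg_le_partial[OF assms(2)]] sum.distrib)

lemma laplacian_cmult:
  assumes "poly_deg_le d f"
  shows "laplacian (\<lambda>y. c * f y) = (\<lambda>y. c * laplacian f y)"
  by (simp add: laplacian_def fun_eq_iff partial_cmult[OF assms]
      partial_cmult[OF poly_deg_le_partial[OF assms(1)]] sum_distrib_left)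

text \<open>This is the commutator [\<Delta>, y_j] = 2 d_j; only the terms with k = j contribute to
  it. Its iterates yield the heat operator's commutation rule.\<close>

lemma laplacian_coord:
  assumes "poly_deg_le d f"
  shows "laplacian (\<lambda>y. complex_of_real (y $ j) * f y) =
    (\<lambda>y. complex_of_real (y $ j) * laplacian f y + 2 * partial j f y)"
proof
  fix y
  note p = poly_deg_le_partial'[OF assms]
  note pc = poly_deg_le.coord[OF p] poly_deg_le_cmult[OF assms]
  have "laplacian (\<lambda>y. complex_of_real (y $ j) * f y) y =
     (\<Sum>k\<in>UNIV. complex_of_real (y $ j) * partial k (partial k f) y + (if j = k then 2 * partial j f y else 0))"
    unfolding laplacian_def
    by (simp only: partial_coord[OF assms] partial_add[OF pc] partial_coord[OF p] partial_cmult[OF assms])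
       (auto intro!: sum.cong)
  also have "\<dots> = complex_of_real (y $ j) * laplacian f y + 2 * partial j f y"
    by (simp add: sum.distrib laplacian_def sum_distrib_left)
  finally show "laplacian (\<lambda>y. complex_of_real (y $ j) * f y) y =
    complex_of_real (y $ j) * laplacian f y + 2 * partial j f y" .
qed

lemma partial_laplacian:
  assumes "poly_deg_le d f"
  shows "partial j (laplacian f) = laplacian (partial j f)"
proof -
  note p = poly_deg_le_partial'[OF assms]
  have "partial j (laplacian f) = partial j (\<lambda>y. \<Sum>k\<in>UNIV. partial k (partial k f) y)"
    by (simp add: laplacian_def[abs_def])
  also have "\<dots> = (\<lambda>y. \<Sum>k\<in>UNIV. partial j (partial k (partial k f)) y)"
    by (intro partial_sum[of _ d] poly_deg_le_partial' p)
  also have "\<dots> = laplacian (partial j f)"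
    by (simp add: laplacian_def fun_eq_iff partial_commute[OF p, of j] partial_commute[OF assms, of j])
  finally show ?thesis .
qed

lemma poly_deg_le_laplacian_funpow:
  "poly_deg_le d f \<Longrightarrow> poly_deg_le (d - n) ((laplacian ^^ n) f)"
proof (induction n)
  case (Suc n)
  have "poly_deg_le (d - n - 1) ((laplacian ^^ Suc n) f)"
    using poly_deg_le_laplacian[OF Suc.IH[OF Suc.prems]] by simp
  then show ?case by simp
qed auto

lemma poly_deg_le_laplacian_funpow': "poly_deg_le d f \<Longrightarrow> poly_deg_le d ((laplacian ^^ n) f)"
  by (rule poly_deg_le_mono[OF poly_deg_le_laplacian_funpow]) auto

lemma laplacian_funpow_0 [simp]: "(laplacian ^^ n) (\<lambda>_. 0) = (\<lambda>_. 0)"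
  by (induction n) auto

lemma laplacian_funpow_eq_0:
  assumes "poly_deg_le d f" "n > d"
  shows "(laplacian ^^ n) f = (\<lambda>_. 0)"
proof -
  obtain m where n: "n = m + Suc d"
    using assms(2) less_iff_Suc_add[of d n] by auto
  have "(laplacian ^^ Suc d) f = (\<lambda>_. 0)"
    using laplacian_degree_0[of "(laplacian ^^ d) f"] poly_deg_le_laplacian_funpow[OF assms(1), of d] by simp
  then show ?thesis
    unfolding n funpow_add by (simp del: funpow.simps)
qed

lemma laplacian_funpow_add:
  assumes "poly_deg_le d f" "poly_deg_le e g"
  shows "(laplacian ^^ n) (\<lambda>y. f y + g y) = (\<lambda>y. (laplacian ^^ n) f y + (laplacian ^^ n) g y)"
  by (induction n) (simp_all add: laplacian_add[OF poly_deg_le_laplacian_funpow[OF assms(1)]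
        poly_deg_le_laplacian_funpow[OF assms(2)]])

lemma laplacian_funpow_cmult:
  assumes "poly_deg_le d f"
  shows "(laplacian ^^ n) (\<lambda>y. c * f y) = (\<lambda>y. c * (laplacian ^^ n) f y)"
  by (induction n) (simp_all add: laplacian_cmult[OF poly_deg_le_laplacian_funpow[OF assms]])

lemma partial_laplacian_funpow:
  assumes "poly_deg_le d f"
  shows "partial j ((laplacian ^^ n) f) = (laplacian ^^ n) (partial j f)"
  by (induction n) (simp_all add: partial_laplacian[OF poly_deg_le_laplacian_funpow[OF assms]])

lemma laplacian_funpow_coord:
  assumes "poly_deg_le d f"
  shows "(laplacian ^^ n) (\<lambda>y. complex_of_real (y $ j) * f y) =
    (\<lambda>y. complex_of_real (y $ j) * (laplacian ^^ n) f y + 2 * of_nat n * (laplacian ^^ (n - 1)) (partial j f) y)"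
proof (induction n)
  case (Suc n)
  note L = poly_deg_le_laplacian_funpow'[OF assms]
  note P = poly_deg_le_laplacian_funpow'[OF poly_deg_le_partial'[OF assms]]
  have "(laplacian ^^ Suc n) (\<lambda>y. complex_of_real (y $ j) * f y) =
     (\<lambda>y. complex_of_real (y $ j) * (laplacian ^^ Suc n) f y + 2 * (laplacian ^^ n) (partial j f) y
        + 2 * of_nat n * laplacian ((laplacian ^^ (n - 1)) (partial j f)) y)"
    by (simp only: funpow.simps o_apply Suc.IH
        laplacian_add[OF poly_deg_le.coord[OF L] poly_deg_le_cmult[OF P]]
        laplacian_coord[OF L] laplacian_cmult[OF P] partial_laplacian_funpow[OF assms])
  \<comment> \<open>For n = 0 the truncated exponent n - 1 does no harm, because its term carries
    the factor \<open>of_nat n\<close>.\<close>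
  also have "\<dots> = (\<lambda>y. complex_of_real (y $ j) * (laplacian ^^ Suc n) f y
      + 2 * of_nat (Suc n) * (laplacian ^^ (Suc n - 1)) (partial j f) y)"
    by (cases n) (auto simp: fun_eq_iff algebra_simps)
  finally show ?case .
qed simp

section \<open>The heat operator on polynomials\<close>

text \<open>The upper limit N is free so that f can also be summed up to \<open>Suc d\<close>, the
  range that its product with a coordinate requires in \<open>heat_op_coord\<close>.\<close>

lemma heat_op_poly_sum:
  assumes "poly_deg_le d f" "d \<le> N"
  shows "heat_op f y = (\<Sum>n\<le>N. complex_of_real ((-1)^n / (2^n * fact n)) * (laplacian ^^ n) f y)"
  unfolding heat_op_def
  by (rule suminf_finite) (use laplacian_funpow_eq_0[OF assms(1)] assms(2) in auto)

lemma poly_deg_le_heat_op: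
  assumes "poly_deg_le d f"
  shows "poly_deg_le d (heat_op f)"
proof -
  have "heat_op f = (\<lambda>y. \<Sum>n\<le>d. complex_of_real ((-1)^n / (2^n * fact n)) * (laplacian ^^ n) f y)"
    using heat_op_poly_sum[OF assms order.refl] by auto
  then show ?thesis
    by (simp only: poly_deg_le_sum[OF poly_deg_le_cmult[OF poly_deg_le_laplacian_funpow'[OF assms]]])
qed

lemma heat_op_0 [simp]: "heat_op (\<lambda>_. 0) = (\<lambda>_. 0)"
  by (auto simp: heat_op_def)

lemma heat_op_add:
  assumes "poly_deg_le d f" "poly_deg_le e g"
  shows "heat_op (\<lambda>y. f y + g y) = (\<lambda>y. heat_op f y + heat_op g y)"
proof -
  have f: "poly_deg_le (max d e) f" and g: "poly_deg_le (max d e) g"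
    using assms by (auto intro: poly_deg_le_mono)
  show ?thesis
    by (simp add: fun_eq_iff heat_op_poly_sum[OF f order.refl] heat_op_poly_sum[OF g order.refl]
        heat_op_poly_sum[OF poly_deg_le.add[OF f g] order.refl] laplacian_funpow_add[OF f g]
        sum.distrib distrib_left)
qed

lemma heat_op_cmult:
  assumes "poly_deg_le d f"
  shows "heat_op (\<lambda>y. c * f y) = (\<lambda>y. c * heat_op f y)"
  by (simp add: fun_eq_iff heat_op_poly_sum[OF assms order.refl] laplacian_funpow_cmult[OF assms]
      heat_op_poly_sum[OF poly_deg_le_cmult[OF assms] order.refl] sum_distrib_left mult_ac)

lemma partial_heat_op:
  assumes "poly_deg_le d f"
  shows "partial j (heat_op f) = heat_op (partial j f)"
proof -
  have "heat_op f = (\<lambda>y. \<Sum>n\<le>d. complex_of_real ((-1)^n / (2^n * fact n)) * (laplacian ^^ n) f y)"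
    using heat_op_poly_sum[OF assms order.refl] by auto
  then have "partial j (heat_op f) =
      (\<lambda>y. \<Sum>n\<le>d. complex_of_real ((-1)^n / (2^n * fact n)) * (laplacian ^^ n) (partial j f) y)"
    by (simp only: partial_sum[OF poly_deg_le_cmult[OF poly_deg_le_laplacian_funpow'[OF assms]]]
        partial_cmult[OF poly_deg_le_laplacian_funpow'[OF assms]] partial_laplacian_funpow[OF assms])
  also have "\<dots> = heat_op (partial j f)"
    using heat_op_poly_sum[OF poly_deg_le_partial'[OF assms] order.refl] by auto
  finally show ?thesis .
qed

lemma heat_op_coord:
  assumes "poly_deg_le d f"
  shows "heat_op (\<lambda>y. complex_of_real (y $ j) * f y) =
    (\<lambda>y. complex_of_real (y $ j) * heat_op f y - partial j (heat_op f) y)"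
proof
  fix y
  let ?c = "\<lambda>n. complex_of_real ((-1)^n / (2^n * fact n))"
  \<comment> \<open>The commutator of the n-th Laplacian power with y_j brings a factor 2n and
    lowers the power by one. By this recursion for the coefficients, the shifted series is the heat
    series again, with the opposite sign.\<close>
  have c: "?c (Suc n) * (2 * of_nat (Suc n)) = - ?c n" for n
  proof -
    have "(-1)^Suc n / (2^Suc n * fact (Suc n)) * (2 * real (Suc n)) = - ((-1)^n / (2^n * fact n))"
      by (simp add: field_simps del: of_nat_Suc)
    from arg_cong[OF this, of complex_of_real] show ?thesis
      by (simp only: of_real_mult of_real_numeral of_real_of_nat_eq of_real_minus)
  qed
  have "heat_op (\<lambda>y. complex_of_real (y $ j) * f y) y =
     (\<Sum>n\<le>Suc d. ?c n * (complex_of_real (y $ j) * (laplacian ^^ n) f y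
        + 2 * of_nat n * (laplacian ^^ (n - 1)) (partial j f) y))"
    by (simp only: heat_op_poly_sum[OF poly_deg_le.coord[OF assms] order.refl] laplacian_funpow_coord[OF assms])
  also have "\<dots> = complex_of_real (y $ j) * (\<Sum>n\<le>Suc d. ?c n * (laplacian ^^ n) f y)
     + (\<Sum>n\<le>Suc d. ?c n * (2 * of_nat n) * (laplacian ^^ (n - 1)) (partial j f) y)"
    by (simp only: distrib_left sum.distrib sum_distrib_left mult_ac)
  also have "(\<Sum>n\<le>Suc d. ?c n * (laplacian ^^ n) f y) = heat_op f y"
    using heat_op_poly_sum[OF assms, of "Suc d"] by simp
  also have "(\<Sum>n\<le>Suc d. ?c n * (2 * of_nat n) * (laplacian ^^ (n - 1)) (partial j f) y)
     = (\<Sum>n\<le>d. (?c (Suc n) * (2 * of_nat (Suc n))) * (laplacian ^^ n) (partial j f) y)"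
    by (subst sum.atMost_Suc_shift) simp
  also have "\<dots> = - heat_op (partial j f) y"
    by (simp only: c heat_op_poly_sum[OF poly_deg_le_partial'[OF assms] order.refl] mult_minus_left sum_negf)
  finally show "heat_op (\<lambda>y. complex_of_real (y $ j) * f y) y =
      complex_of_real (y $ j) * heat_op f y - partial j (heat_op f) y"
    by (simp add: partial_heat_op[OF assms])
qed

section \<open>Series of homogeneous polynomials\<close>

text \<open>\<open>homog_bound n M f\<close> says that \<open>f\<close> is a homogeneous polynomial of degree \<open>n\<close> whose
  coefficients have absolute sum at most \<open>M\<close>.\<close>

inductive homog_bound :: "nat \<Rightarrow> real \<Rightarrow> (real^'n \<Rightarrow> complex) \<Rightarrow> bool" where
  zero: "homog_bound n 0 (\<lambda>_. 0)"
| const: "homog_bound 0 (norm c) (\<lambda>_. c)"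
| coord: "homog_bound n M f \<Longrightarrow> homog_bound (Suc n) M (\<lambda>y. complex_of_real (y $ k) * f y)"
| add: "homog_bound n M f \<Longrightarrow> homog_bound n M' g \<Longrightarrow> homog_bound n (M + M') (\<lambda>y. f y + g y)"
| mono: "homog_bound n M f \<Longrightarrow> M \<le> M' \<Longrightarrow> homog_bound n M' f"

lemma homog_bound_nonneg: "homog_bound n M f \<Longrightarrow> 0 \<le> M"
  by (induction rule: homog_bound.induct) auto

lemma homog_bound_imp_poly: "homog_bound n M f \<Longrightarrow> poly_deg_le n f"
  by (induction rule: homog_bound.induct) (auto intro: poly_deg_le.intros)

lemma homog_bound_0: "0 \<le> M \<Longrightarrow> homog_bound n M (\<lambda>_. 0)"
  by (rule homog_bound.mono[OF homog_bound.zero])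

lemma homog_bound_cmult:
  "homog_bound n M f \<Longrightarrow> homog_bound n (norm c * M) (\<lambda>y. c * f y)"
proof (induction rule: homog_bound.induct)
  case (coord n M f k)
  from homog_bound.coord[OF coord.IH, of k] show ?case by (simp add: mult_ac)
next
  case (const a)
  show ?case using homog_bound.const[of "c * a"] by (simp add: norm_mult)
next
  case (mono n M f M')
  show ?case by (rule homog_bound.mono[OF mono.IH]) (use mono.hyps in \<open>auto intro: mult_left_mono\<close>)
qed (auto intro: homog_bound.zero homog_bound.add simp: distrib_left)

lemma homog_bound_sum:
  "(\<And>i. i \<in> I \<Longrightarrow> homog_bound n (M i) (f i)) \<Longrightarrow>
    homog_bound n (\<Sum>i\<in>I. M i) (\<lambda>y. \<Sum>i\<in>I. f i y)"
  by (induction I rule: infinite_finite_induct) (auto intro: homog_bound.zero homog_bound.add)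

lemma homog_bound_norm_le: "homog_bound n M f \<Longrightarrow> norm (f y) \<le> M * norm y ^ n"
proof (induction rule: homog_bound.induct)
  case (coord n M f k)
  have "norm (complex_of_real (y $ k) * f y) = \<bar>y $ k\<bar> * norm (f y)"
    by (simp add: norm_mult)
  also have "\<dots> \<le> norm y * (M * norm y ^ n)"
    using coord.IH by (intro mult_mono component_le_norm_cart) auto
  finally show ?case by (simp add: mult_ac)
next
  case (add n M f M' g)
  have "norm (f y + g y) \<le> norm (f y) + norm (g y)" by (rule norm_triangle_ineq)
  also have "\<dots> \<le> M * norm y ^ n + M' * norm y ^ n" using add.IH by (rule add_mono)
  finally show ?case by (simp add: distrib_right)
next
  case (mono n M f M')
  have "M * norm y ^ n \<le> M' * norm y ^ n" using mono.hyps by (intro mult_right_mono) auto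
  with mono.IH show ?case by simp
qed auto

lemma homog_bound_partial:
  fixes M :: real
  assumes "homog_bound (Suc n) M f"
  shows "homog_bound n (Suc n * M) (partial j f)"
proof -
  \<comment> \<open>The degree becomes a variable and degree 0 is included: the product rule
    differentiates a factor of one degree less, which may be constant.\<close>
  have "(m = 0 \<longrightarrow> partial j f = (\<lambda>_. 0)) \<and> (\<forall>n. m = Suc n \<longrightarrow> homog_bound n (m * M) (partial j f))"
    if "homog_bound m M f" for m and M :: real
    using that
  proof (induction rule: homog_bound.induct)
    case (zero n)
    then show ?case by (auto intro: homog_bound.zero)
  next
    case (const c)
    then show ?case by auto
  next
    case (coord n M f k)
    have M: "0 \<le> M" using coord.hyps by (rule homog_bound_nonneg)
    have "homog_bound n (norm (if k = j then 1 else 0 :: complex) * M) (\<lambda>y. (if k = j then 1 else 0) * f y)"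
      using coord.hyps by (rule homog_bound_cmult)
    then have 1: "homog_bound n M (\<lambda>y. (if k = j then 1 else 0) * f y)"
      by (rule homog_bound.mono) (use M in auto)
    have 2: "homog_bound n (n * M) (\<lambda>y. complex_of_real (y $ k) * partial j f y)"
    proof (cases n)
      case 0
      then show ?thesis using coord.IH by (auto intro: homog_bound.zero)
    next
      case (Suc m)
      then have "homog_bound m (n * M) (partial j f)" using coord.IH by auto
      from homog_bound.coord[OF this] Suc show ?thesis by auto
    qed
    have "homog_bound n (Suc n * M) (partial j (\<lambda>y. complex_of_real (y $ k) * f y))"
    proof -
      have "Suc n * M = n * M + M" by (simp add: algebra_simps)
      then show ?thesis
        by (simp only: homog_bound.add[OF 2 1] partial_coord[OF homog_bound_imp_poly[OF coord.hyps]])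
    qed
    then show ?case by auto
  next
    case (add n M f M' g)
    show ?case
      unfolding partial_add[OF homog_bound_imp_poly[OF add.hyps(1)] homog_bound_imp_poly[OF add.hyps(2)]]
        distrib_left
      using add.IH by (auto intro!: homog_bound.add simp del: of_nat_Suc)
  next
    case (mono n M f M')
    have le: "n * M \<le> n * M'" using mono.hyps by (intro mult_left_mono) auto
    show ?case
    proof (intro conjI impI allI)
      show "partial j f = (\<lambda>_. 0)" if "n = 0" using mono.IH that by simp
      fix m assume "n = Suc m"
      then have "homog_bound m (n * M) (partial j f)" using mono.IH by simp
      then show "homog_bound m (n * M') (partial j f)" using le by (rule homog_bound.mono)
    qed
  qed
  then show ?thesis using assms by blast
qed

text \<open>The degree-\<open>n\<close> part has coefficient sum at most \<open>C \<rho>\<^sup>n / n!\<close>, so the series is entire of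
  exponential type; this class is closed under partial derivatives.\<close>

definition exp_type :: "real \<Rightarrow> real \<Rightarrow> (nat \<Rightarrow> real^'n \<Rightarrow> complex) \<Rightarrow> bool" where
  "exp_type C \<rho> F \<longleftrightarrow> (\<forall>n. homog_bound n (C * \<rho> ^ n / fact n) (F n))"

lemma exp_type_poly: "exp_type C \<rho> F \<Longrightarrow> poly_deg_le n (F n)"
  by (auto simp: exp_type_def intro: homog_bound_imp_poly)

lemma exp_type_norm_le:
  assumes "exp_type C \<rho> F"
  shows "norm (F n y) \<le> C * ((\<rho> * norm y) ^ n /\<^sub>R fact n)"
proof -
  have "norm (F n y) \<le> C * \<rho> ^ n / fact n * norm y ^ n"
    using assms unfolding exp_type_def by (blast intro: homog_bound_norm_le)
  then show ?thesis by (simp add: power_mult_distrib divide_inverse mult_ac)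
qed

lemma
  assumes "exp_type C \<rho> F"
  shows exp_type_summable: "summable (\<lambda>n. F n y)"
    and exp_type_suminf_norm_le: "norm (\<Sum>n. F n y) \<le> C * exp (\<rho> * norm y)"
proof -
  have s: "summable (\<lambda>n. C * ((\<rho> * norm y) ^ n /\<^sub>R fact n))"
    by (intro summable_mult summable_exp_generic)
  show "summable (\<lambda>n. F n y)"
    by (rule summable_comparison_test'[OF s]) (use exp_type_norm_le[OF assms] in auto)
  have "norm (\<Sum>n. F n y) \<le> (\<Sum>n. C * ((\<rho> * norm y) ^ n /\<^sub>R fact n))"
    by (rule norm_suminf_le[OF exp_type_norm_le[OF assms] s])
  also have "\<dots> = C * exp (\<rho> * norm y)"
    unfolding exp_def by (rule suminf_mult[OF summable_exp_generic])
  finally show "norm (\<Sum>n. F n y) \<le> C * exp (\<rho> * norm y)" .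
qed

text \<open>The factor n + 1 from differentiating degree n + 1 cancels against the factorial. The
  rate \<rho> is thus preserved and only the constant grows, geometrically under iteration; this is
  what makes infinitely many Laplacians summable.\<close>

lemma exp_type_partial:
  assumes "exp_type C \<rho> F"
  shows "exp_type (C * \<rho>) \<rho> (\<lambda>n. partial j (F (Suc n)))"
  unfolding exp_type_def
proof
  fix n
  have "homog_bound n (Suc n * (C * \<rho> ^ Suc n / fact (Suc n))) (partial j (F (Suc n)))"
    using assms unfolding exp_type_def by (blast intro: homog_bound_partial)
  also have "Suc n * (C * \<rho> ^ Suc n / fact (Suc n)) = C * \<rho> * \<rho> ^ n / fact n"
    by (simp add: field_simps del: of_nat_Suc)
  finally show "homog_bound n (C * \<rho> * \<rho> ^ n / fact n) (partial j (F (Suc n)))" .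
qed

lemma exp_type_sum:
  assumes "\<And>k. k \<in> I \<Longrightarrow> exp_type (C k) \<rho> (F k)"
  shows "exp_type (\<Sum>k\<in>I. C k) \<rho> (\<lambda>n y. \<Sum>k\<in>I. F k n y)"
  unfolding exp_type_def
proof
  fix n
  have "homog_bound n (\<Sum>k\<in>I. C k * \<rho> ^ n / fact n) (\<lambda>y. \<Sum>k\<in>I. F k n y)"
    using assms by (intro homog_bound_sum) (auto simp: exp_type_def)
  then show "homog_bound n ((\<Sum>k\<in>I. C k) * \<rho> ^ n / fact n) (\<lambda>y. \<Sum>k\<in>I. F k n y)"
    by (simp add: sum_distrib_right sum_divide_distrib)
qed

lemma partial_exp_type_suminf:
  fixes F :: "nat \<Rightarrow> real^'n \<Rightarrow> complex" and \<rho> :: real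
  assumes F: "exp_type C \<rho> F" and \<rho>: "0 \<le> \<rho>"
  shows "partial j (\<lambda>y. \<Sum>n. F n y) = (\<lambda>y. \<Sum>n. partial j (F (Suc n)) y)"
proof (rule has_partial_imp_partial, unfold has_partial_def, rule allI)
  fix y :: "real^'n"
  let ?l = "\<lambda>t. y + t *\<^sub>R axis j (1::real)"
  have C: "0 \<le> C"
    using F homog_bound_nonneg[of 0 C "F 0"] by (auto simp: exp_type_def dest: spec[of _ 0])
  have line: "((\<lambda>t. F n (?l t)) has_derivative (\<lambda>h. h *\<^sub>R partial j (F n) (?l t))) (at t)" for n t
  proof -
    have "((\<lambda>t. F n (?l t)) has_vector_derivative partial j (F n) (?l t)) (at t)"
      by (rule has_vector_derivative_line_shift)
         (use poly_deg_le_has_partial[OF exp_type_poly[OF F], of j n] in \<open>simp add: has_partial_def\<close>)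
    then show ?thesis by (simp only: has_vector_derivative_def)
  qed
  \<comment> \<open>For parameters in (-1, 1) the segment stays in the ball of this radius.\<close>
  let ?r = "norm y + 1"
  \<comment> \<open>The majorant of the derivative series is that of \<open>exp_type_partial\<close>
    shifted by one place; the degree 0 term is constant and has derivative zero.\<close>
  define M where "M n = (case n of 0 \<Rightarrow> 0 | Suc n \<Rightarrow> C * \<rho> * ((\<rho> * ?r) ^ n /\<^sub>R fact n))" for n
  have bound: "norm (h *\<^sub>R partial j (F n) (?l t)) \<le> M n * norm h" if "t \<in> {-1<..<1}" for n t and h :: real
  proof (cases n)
    case 0
    have "partial j (F 0) = (\<lambda>_. 0)"
      using exp_type_poly[OF F, of 0] by (rule partial_degree_0) simp
    then show ?thesis by (simp add: 0 M_def)
  next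
    case (Suc m)
    have "norm (?l t) \<le> ?r"
    proof -
      have "norm (?l t) \<le> norm y + norm (t *\<^sub>R axis j (1::real) :: real^'n)" by (rule norm_triangle_ineq)
      also have "\<dots> \<le> ?r" using that by (auto simp: norm_axis_1 abs_le_iff)
      finally show ?thesis .
    qed
    then have le: "(\<rho> * norm (?l t)) ^ m \<le> (\<rho> * ?r) ^ m"
      using \<rho> by (intro power_mono mult_left_mono) auto
    have "norm (partial j (F (Suc m)) (?l t)) \<le> C * \<rho> * ((\<rho> * norm (?l t)) ^ m /\<^sub>R fact m)"
      using exp_type_norm_le[OF exp_type_partial[OF F, of j], of m "?l t"] .
    also have "\<dots> \<le> C * \<rho> * ((\<rho> * ?r) ^ m /\<^sub>R fact m)"
      using le C \<rho> by (intro mult_left_mono) auto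
    finally have "norm (partial j (F (Suc m)) (?l t)) * norm h \<le> M n * norm h"
      by (intro mult_right_mono) (simp_all add: Suc M_def)
    then show ?thesis by (simp add: Suc mult.commute)
  qed
  have "summable (\<lambda>n. M (Suc n))"
    unfolding M_def nat.case by (rule summable_mult[OF summable_exp_generic])
  then have M: "summable M" using summable_Suc_iff[of M] by blast
  have "((\<lambda>t. \<Sum>n. F n (?l t)) has_derivative (\<lambda>h. \<Sum>n. h *\<^sub>R partial j (F n) (?l 0))) (at 0)"
    by (rule has_derivative_suminf[where S="{-1<..<1}" and M=M])
       (use bound in \<open>simp_all add: M exp_type_summable[OF F] line del: norm_scaleR\<close>)
  also have "(\<lambda>h. \<Sum>n. h *\<^sub>R partial j (F n) (?l 0)) = (\<lambda>h. h *\<^sub>R (\<Sum>n. partial j (F (Suc n)) y))"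
  proof
    fix h
    have s: "summable (\<lambda>n. partial j (F (Suc n)) y)"
      by (rule exp_type_summable[OF exp_type_partial[OF F]])
    then have s': "summable (\<lambda>n. partial j (F n) y)"
      using summable_Suc_iff[of "\<lambda>n. partial j (F n) y"] by blast
    have "partial j (F 0) = (\<lambda>_. 0)"
      using exp_type_poly[OF F, of 0] by (rule partial_degree_0) simp
    then have "(\<Sum>n. partial j (F n) y) = (\<Sum>n. partial j (F (Suc n)) y)"
      using suminf_split_head[OF s'] by simp
    then show "(\<Sum>n. h *\<^sub>R partial j (F n) (?l 0)) = h *\<^sub>R (\<Sum>n. partial j (F (Suc n)) y)"
      using suminf_scaleR_right[OF s', of h] by simp
  qed
  finally show "((\<lambda>t. \<Sum>n. F n (?l t)) has_vector_derivative (\<Sum>n. partial j (F (Suc n)) y)) (at 0)"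
    by (simp add: has_vector_derivative_def)
qed

lemma
  fixes F :: "nat \<Rightarrow> real^'n \<Rightarrow> complex" and \<rho> :: real
  assumes F: "exp_type C \<rho> F" and \<rho>: "0 \<le> \<rho>"
  shows exp_type_laplacian: "exp_type (C * (CARD('n) * \<rho>\<^sup>2)) \<rho> (\<lambda>n. laplacian (F (n + 2)))"
    and laplacian_exp_type_suminf: "laplacian (\<lambda>y. \<Sum>n. F n y) = (\<lambda>y. \<Sum>n. laplacian (F (n + 2)) y)"
proof -
  have F2: "exp_type (C * \<rho> * \<rho>) \<rho> (\<lambda>n. partial k (partial k (F (n + 2))))" for k
    using exp_type_partial[OF exp_type_partial[OF F, of k], of k] by simp
  show "exp_type (C * (CARD('n) * \<rho>\<^sup>2)) \<rho> (\<lambda>n. laplacian (F (n + 2)))"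
    using exp_type_sum[of UNIV "\<lambda>_. C * \<rho> * \<rho>" \<rho>, OF F2]
    by (simp add: laplacian_def[abs_def] power2_eq_square mult_ac)
  show "laplacian (\<lambda>y. \<Sum>n. F n y) = (\<lambda>y. \<Sum>n. laplacian (F (n + 2)) y)"
  proof
    fix y
    have "laplacian (\<lambda>y. \<Sum>n. F n y) y = (\<Sum>k\<in>UNIV. \<Sum>n. partial k (partial k (F (n + 2))) y)"
      by (simp add: laplacian_def partial_exp_type_suminf[OF F \<rho>]
          partial_exp_type_suminf[OF exp_type_partial[OF F] \<rho>])
    also have "\<dots> = (\<Sum>n. \<Sum>k\<in>UNIV. partial k (partial k (F (n + 2))) y)"
      by (rule suminf_sum[symmetric]) (rule exp_type_summable[OF F2])
    finally show "laplacian (\<lambda>y. \<Sum>n. F n y) y = (\<Sum>n. laplacian (F (n + 2)) y)"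
      by (simp add: laplacian_def)
  qed
qed

lemma
  fixes F :: "nat \<Rightarrow> real^'n \<Rightarrow> complex" and \<rho> :: real
  assumes F: "exp_type C \<rho> F" and \<rho>: "0 \<le> \<rho>"
  shows exp_type_laplacian_funpow:
      "exp_type (C * (CARD('n) * \<rho>\<^sup>2) ^ k) \<rho> (\<lambda>n. (laplacian ^^ k) (F (n + 2 * k)))"
    and laplacian_funpow_exp_type_suminf:
      "(laplacian ^^ k) (\<lambda>y. \<Sum>n. F n y) = (\<lambda>y. \<Sum>n. (laplacian ^^ k) (F (n + 2 * k)) y)"
proof -
  have "exp_type (C * (CARD('n) * \<rho>\<^sup>2) ^ k) \<rho> (\<lambda>n. (laplacian ^^ k) (F (n + 2 * k))) \<and>
     (laplacian ^^ k) (\<lambda>y. \<Sum>n. F n y) = (\<lambda>y. \<Sum>n. (laplacian ^^ k) (F (n + 2 * k)) y)"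
    using F
  proof (induction k arbitrary: C F)
    case (Suc k)
    note 1 = Suc.IH[OF exp_type_laplacian[OF Suc.prems \<rho>]]
    show ?case
      using 1 by (simp add: funpow_Suc_right laplacian_exp_type_suminf[OF Suc.prems \<rho>] mult_ac add_ac
          del: funpow.simps)
  qed auto
  then show "exp_type (C * (CARD('n) * \<rho>\<^sup>2) ^ k) \<rho> (\<lambda>n. (laplacian ^^ k) (F (n + 2 * k)))"
    and "(laplacian ^^ k) (\<lambda>y. \<Sum>n. F n y) = (\<lambda>y. \<Sum>n. (laplacian ^^ k) (F (n + 2 * k)) y)" by auto
qed

text \<open>Every truncation of the series is again of exponential type with the same constants.
  Hence the k-th term of its heat series is at most \<open>C * exp (\<rho> * norm y)\<close> times
  B^k / k! with B = \<open>CARD('n) * \<rho>\<^sup>2\<close>, uniformly in N. Summing over k gives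
  the bound, and Tannery's theorem exchanges the limit in N with the heat series.\<close>

lemma
  fixes F :: "nat \<Rightarrow> real^'n \<Rightarrow> complex" and \<rho> :: real
  assumes F: "exp_type C \<rho> F" and \<rho>: "0 \<le> \<rho>"
  shows heat_op_exp_type_partial_sum_le:
      "norm (heat_op (\<lambda>y. \<Sum>n<N. F n y) y) \<le> C * exp (CARD('n) * \<rho>\<^sup>2) * exp (\<rho> * norm y)"
    and heat_op_exp_type_tendsto:
      "(\<lambda>N. heat_op (\<lambda>y. \<Sum>n<N. F n y) y) \<longlonglongrightarrow> heat_op (\<lambda>y. \<Sum>n. F n y) y"
proof -
  define B where "B = CARD('n) * \<rho>\<^sup>2"
  have B: "0 \<le> B" by (simp add: B_def)
  have C: "0 \<le> C"
    using F homog_bound_nonneg[of 0 C "F 0"] by (auto simp: exp_type_def dest: spec[of _ 0])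
  \<comment> \<open>Padding the truncation with zeros keeps it an infinite series, so the results on
    exponential type apply to it literally.\<close>
  define FN where "FN N n = (if n < N then F n else (\<lambda>_. 0))" for N n
  have FN: "exp_type C \<rho> (FN N)" for N
    using F C \<rho> by (auto simp: exp_type_def FN_def intro!: homog_bound_0)
  have sum_FN: "(\<lambda>y. \<Sum>n<N. F n y) = (\<lambda>y. \<Sum>n. FN N n y)" for N
  proof
    fix y
    have "(\<Sum>n. FN N n y) = (\<Sum>n<N. FN N n y)"
      by (rule suminf_finite) (auto simp: FN_def)
    then show "(\<Sum>n<N. F n y) = (\<Sum>n. FN N n y)" by (simp add: FN_def)
  qed
  define c where "c k = complex_of_real ((-1)^k / (2^k * fact k))" for k :: nat
  define a where "a k N = c k * (laplacian ^^ k) (\<lambda>y. \<Sum>n<N. F n y) y" for k N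
  define M where "M k = C * exp (\<rho> * norm y) * (B ^ k /\<^sub>R fact k)" for k
  have norm_c: "norm (c k) \<le> 1 / fact k" for k
  proof -
    have "norm (c k) = 1 / (2 ^ k * fact k)"
      by (simp add: c_def norm_divide norm_mult norm_power)
    also have "\<dots> \<le> 1 / (1 * fact k)"
      by (intro divide_left_mono mult_right_mono) auto
    finally show ?thesis by simp
  qed
  have a_le: "norm (a k N) \<le> M k" for k N
  proof -
    have "norm (a k N) \<le> 1 / fact k * (C * B ^ k * exp (\<rho> * norm y))"
      unfolding a_def norm_mult sum_FN laplacian_funpow_exp_type_suminf[OF FN \<rho>] B_def
      by (intro mult_mono norm_c exp_type_suminf_norm_le exp_type_laplacian_funpow FN \<rho>) auto
    then show ?thesis by (simp add: M_def field_simps)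
  qed
  have M: "summable M" unfolding M_def by (intro summable_mult summable_exp_generic)
  have suminf_M: "suminf M = C * exp B * exp (\<rho> * norm y)"
  proof -
    have "suminf M = C * exp (\<rho> * norm y) * (\<Sum>k. B ^ k /\<^sub>R fact k)"
      unfolding M_def by (rule suminf_mult[OF summable_exp_generic])
    then show ?thesis by (simp add: exp_def)
  qed
  have heat: "heat_op (\<lambda>y. \<Sum>n<N. F n y) y = (\<Sum>k. a k N)" for N
    by (simp add: heat_op_def a_def c_def)
  show "norm (heat_op (\<lambda>y. \<Sum>n<N. F n y) y) \<le> C * exp (CARD('n) * \<rho>\<^sup>2) * exp (\<rho> * norm y)"
    unfolding heat B_def[symmetric] using norm_suminf_le[OF a_le M] by (simp add: suminf_M)
  define b where "b k = c k * (laplacian ^^ k) (\<lambda>y. \<Sum>n. F n y) y" for k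
  have lim: "(\<lambda>N. a k N) \<longlonglongrightarrow> b k" for k
  proof -
    let ?g = "\<lambda>n. (laplacian ^^ k) (F (n + 2 * k)) y"
    have g: "summable ?g"
      by (rule exp_type_summable[OF exp_type_laplacian_funpow[OF F \<rho>]])
    \<comment> \<open>Index n of the new series stems from degree n + 2k, so of the degrees below N
      only N - 2k indices are left, and none when N is smaller than 2k.\<close>
    have "(laplacian ^^ k) (\<lambda>y. \<Sum>n<N. F n y) y = (\<Sum>n<N - 2 * k. ?g n)" for N
    proof -
      have "(laplacian ^^ k) (\<lambda>y. \<Sum>n<N. F n y) y = (\<Sum>n. (laplacian ^^ k) (FN N (n + 2 * k)) y)"
        by (simp add: sum_FN laplacian_funpow_exp_type_suminf[OF FN \<rho>])
      also have "\<dots> = (\<Sum>n<N - 2 * k. (laplacian ^^ k) (FN N (n + 2 * k)) y)"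
        by (rule suminf_finite) (auto simp: FN_def)
      also have "\<dots> = (\<Sum>n<N - 2 * k. ?g n)"
        by (rule sum.cong) (auto simp: FN_def)
      finally show ?thesis .
    qed
    moreover have "(\<lambda>N. \<Sum>n<N - 2 * k. ?g n) \<longlonglongrightarrow> suminf ?g"
      by (rule LIMSEQ_offset[where k="2 * k"]) (use summable_LIMSEQ[OF g] in simp)
    ultimately show ?thesis
      unfolding a_def b_def laplacian_funpow_exp_type_suminf[OF F \<rho>]
      by (intro tendsto_mult tendsto_const) simp
  qed
  have "eventually (\<lambda>(k, N). norm (a k N) \<le> M k) (at_top \<times>\<^sub>F sequentially)"
    by (rule always_eventually) (auto intro: a_le)
  from tannerys_theorem[OF lim this M] have "(\<lambda>N. \<Sum>k. a k N) \<longlonglongrightarrow> suminf b" by simp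
  moreover have "suminf b = heat_op (\<lambda>y. \<Sum>n. F n y) y"
    by (simp only: heat_op_def b_def[abs_def] c_def)
  ultimately show "(\<lambda>N. heat_op (\<lambda>y. \<Sum>n<N. F n y) y) \<longlonglongrightarrow> heat_op (\<lambda>y. \<Sum>n. F n y) y"
    by (simp only: heat)
qed

section \<open>Fourier transforms of polynomials times the Gaussian\<close>

definition gaussian :: "real^'n \<Rightarrow> complex" where
  "gaussian x = complex_of_real (exp (- (norm x)\<^sup>2 / 2))"

lemma gaussian_nonzero [simp]: "gaussian x \<noteq> 0"
  by (simp add: gaussian_def)

lemma continuous_on_gaussian [continuous_intros]: "continuous_on A gaussian"
  unfolding gaussian_def by (intro continuous_intros) auto

lemma has_partial_gaussian:
  fixes j :: "'n::finite"
  shows "has_partial j gaussian (\<lambda>x. - complex_of_real (x $ j) * gaussian x)"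
proof -
  have "((\<lambda>t. gaussian (x + t *\<^sub>R axis j 1)) has_vector_derivative - complex_of_real (x $ j) * gaussian x) (at 0)"
    for x :: "real^'n"
  proof -
    have "(norm (x + t *\<^sub>R axis j 1))\<^sup>2 = (norm x)\<^sup>2 + 2 * t * x $ j + t\<^sup>2" for t
      unfolding power2_norm_eq_inner
      by (simp add: inner_add_left inner_add_right inner_axis' inner_axis power2_eq_square algebra_simps)
    moreover have "((\<lambda>t. exp (- ((norm x)\<^sup>2 + 2 * t * x $ j + t\<^sup>2) / 2)) has_real_derivative
        - (x $ j) * exp (- (norm x)\<^sup>2 / 2)) (at 0)"
      by (auto intro!: derivative_eq_intros simp: field_simps)
    then have "((\<lambda>t. complex_of_real (exp (- ((norm x)\<^sup>2 + 2 * t * x $ j + t\<^sup>2) / 2))) has_vector_derivative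
        complex_of_real (- (x $ j) * exp (- (norm x)\<^sup>2 / 2))) (at 0)"
      by (intro has_vector_derivative_of_real) (simp add: has_real_derivative_iff_has_vector_derivative)
    ultimately show ?thesis by (simp add: gaussian_def)
  qed
  then show ?thesis by (simp add: has_partial_def)
qed

lemma poly_deg_le_continuous_on: "poly_deg_le d f \<Longrightarrow> continuous_on A f"
  by (induction rule: poly_deg_le.induct) (auto intro!: continuous_intros)

text \<open>An exponential bound is cruder than a polynomial one, but it combines with the
  exponential growth of the heat-transformed kernel into a bound of the same shape.\<close>

lemma poly_deg_le_exp_bound:
  "poly_deg_le d f \<Longrightarrow> \<exists>C. \<forall>y. norm (f y) \<le> C * exp (d * norm y)"
proof (induction rule: poly_deg_le.induct)
  case (const d c)
  have "norm c \<le> norm c * exp (d * norm y)" for y :: "real^'n"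
    using mult_left_mono[of 1 "exp (d * norm y)" "norm c"] by simp
  then show ?case by (intro exI[of _ "norm c"]) auto
next
  case (coord d f k)
  then obtain C where C: "\<And>y. norm (f y) \<le> C * exp (d * norm y)" by auto
  have "norm (complex_of_real (y $ k) * f y) \<le> C * exp (Suc d * norm y)" for y
  proof -
    have "\<bar>y $ k\<bar> \<le> exp (norm y)"
      using component_le_norm_cart[of y k] exp_ge_add_one_self[of "norm y"] by linarith
    then have "\<bar>y $ k\<bar> * norm (f y) \<le> exp (norm y) * (C * exp (d * norm y))"
      by (intro mult_mono C) auto
    moreover have "exp (Suc d * norm y) = exp (norm y) * exp (d * norm y)"
      by (simp add: exp_add[symmetric] algebra_simps)
    ultimately show ?thesis
      by (simp add: norm_mult mult_ac)
  qed
  then show ?case by auto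
next
  case (add d f g)
  then obtain C D where C: "\<And>y. norm (f y) \<le> C * exp (d * norm y)"
    and D: "\<And>y. norm (g y) \<le> D * exp (d * norm y)" by auto
  have "norm (f y + g y) \<le> (C + D) * exp (d * norm y)" for y
    using norm_triangle_le[OF add_mono[OF C D]] by (simp add: distrib_right)
  then show ?case by auto
qed

lemma integrable_exp_bound_gaussian:
  fixes h :: "real^'n \<Rightarrow> complex"
  assumes h: "h \<in> borel_measurable borel" and bound: "\<And>x. norm (h x) \<le> C * exp (r * norm x)"
  shows "integrable lborel (\<lambda>x. h x * gaussian x)"
proof (rule Bochner_Integration.integrable_bound)
  show "integrable lborel (\<lambda>x::real^'n. C * (norm x ^ 0 * exp (r * norm x) * exp (- (norm x)\<^sup>2 / 2)))"
    by (intro integrable_mult_right integrable_exp_linear_gaussian)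
  have "gaussian \<in> borel_measurable (borel :: (real^'n) measure)"
    by (intro borel_measurable_continuous_onI continuous_on_gaussian)
  then show "(\<lambda>x. h x * gaussian x) \<in> borel_measurable lborel"
    using h by simp
  have le: "norm (h x * gaussian x) \<le> C * exp (r * norm x) * exp (- (norm x)\<^sup>2 / 2)" for x
    unfolding norm_mult by (intro mult_mono bound order.trans[OF _ bound]) (auto simp: gaussian_def)
  show "AE x in lborel. norm (h x * gaussian x) \<le>
      norm (C * (norm x ^ 0 * exp (r * norm x) * exp (- (norm x)\<^sup>2 / 2)))"
    using order.trans[OF le abs_ge_self] by (intro AE_I2) (simp only: real_norm_def power_0 mult_1_left mult.assoc)
qed

lemma integrable_poly_gaussian:
  assumes "poly_deg_le d f"
  shows "integrable lborel (\<lambda>x. f x * gaussian x)"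
proof -
  obtain C where "\<And>y. norm (f y) \<le> C * exp (d * norm y)"
    using poly_deg_le_exp_bound[OF assms] by auto
  then show ?thesis
    by (intro integrable_exp_bound_gaussian[of f C "real d"] borel_measurable_continuous_onI
        poly_deg_le_continuous_on[OF assms])
qed

lemma integrable_character_poly_gaussian:
  fixes f :: "real^'n \<Rightarrow> complex"
  assumes "poly_deg_le d f"
  shows "integrable lborel (\<lambda>x. exp (- \<i> * complex_of_real (x \<bullet> y)) * (f x * gaussian x))"
proof (rule Bochner_Integration.integrable_bound[OF integrable_poly_gaussian[OF assms]])
  have "continuous_on UNIV (\<lambda>x. exp (- \<i> * complex_of_real (x \<bullet> y)) * (f x * gaussian x))"
    by (intro continuous_intros poly_deg_le_continuous_on[OF assms])
  then show "(\<lambda>x. exp (- \<i> * complex_of_real (x \<bullet> y)) * (f x * gaussian x)) \<in> borel_measurable lborel"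
    using borel_measurable_continuous_onI by simp
qed (auto simp: norm_mult)

definition fourier_gaussian :: "(real^'n \<Rightarrow> complex) \<Rightarrow> real^'n \<Rightarrow> complex" where
  "fourier_gaussian f = fourier (\<lambda>x. f x * gaussian x)"

lemma fourier_gaussian_add:
  assumes "poly_deg_le d f" "poly_deg_le e g"
  shows "fourier_gaussian (\<lambda>x. f x + g x) y = fourier_gaussian f y + fourier_gaussian g y"
  using Bochner_Integration.integral_add[OF integrable_character_poly_gaussian[OF assms(1), of y]
      integrable_character_poly_gaussian[OF assms(2), of y]]
  by (simp add: fourier_gaussian_def fourier_def distrib_left distrib_right)

lemma fourier_gaussian_cmult: "fourier_gaussian (\<lambda>x. c * f x) y = c * fourier_gaussian f y"
proof -
  have "(\<lambda>x. exp (- \<i> * complex_of_real (x \<bullet> y)) * (c * f x * gaussian x)) =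
      (\<lambda>x. c * (exp (- \<i> * complex_of_real (x \<bullet> y)) * (f x * gaussian x)))"
    by (simp add: mult_ac)
  then show ?thesis by (simp add: fourier_gaussian_def fourier_def)
qed

lemma fourier_gaussian_const:
  fixes y :: "real^'n"
  shows "fourier_gaussian (\<lambda>_. c) y = c * gaussian y"
proof -
  have "fourier_gaussian (\<lambda>_. 1) y = complex_of_real ((2 * pi) powr (- real CARD('n) / 2) *
      (sqrt (2 * pi) ^ CARD('n) * exp (- (norm y)\<^sup>2 / 2)))"
    using integral_fourier_gaussian[of y] by (simp add: fourier_gaussian_def fourier_def gaussian_def)
  also have "sqrt (2 * pi) ^ CARD('n) = (2 * pi) powr (real CARD('n) / 2)"
    by (simp add: powr_half_sqrt[symmetric] powr_realpow[symmetric] powr_powr)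
  also have "(2 * pi) powr (- real CARD('n) / 2) * ((2 * pi) powr (real CARD('n) / 2) * exp (- (norm y)\<^sup>2 / 2))
     = ((2 * pi) powr (- real CARD('n) / 2) * (2 * pi) powr (real CARD('n) / 2)) * exp (- (norm y)\<^sup>2 / 2)"
    by (simp only: mult.assoc)
  also have "\<dots> = exp (- (norm y)\<^sup>2 / 2)"
    by (simp add: powr_add[symmetric])
  finally have "fourier_gaussian (\<lambda>_. 1) y = gaussian y" by (simp add: gaussian_def)
  then show ?thesis using fourier_gaussian_cmult[of c "\<lambda>_. 1" y] by simp
qed

lemma has_partial_character:
  "has_partial j (\<lambda>x. exp (- \<i> * complex_of_real (x \<bullet> y)))
    (\<lambda>x. - \<i> * complex_of_real (y $ j) * exp (- \<i> * complex_of_real (x \<bullet> y)))"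
proof -
  have "((\<lambda>t. exp (- \<i> * complex_of_real ((x + t *\<^sub>R axis j 1) \<bullet> y))) has_vector_derivative
      - \<i> * complex_of_real (y $ j) * exp (- \<i> * complex_of_real (x \<bullet> y))) (at 0)" for x
  proof -
    have "((\<lambda>w. exp (- \<i> * (complex_of_real (x \<bullet> y) + w * complex_of_real (y $ j)))) has_field_derivative
      - \<i> * complex_of_real (y $ j) * exp (- \<i> * complex_of_real (x \<bullet> y))) (at (complex_of_real 0))"
      by (rule derivative_eq_intros refl | simp)+
    from has_vector_derivative_real_field[OF this] show ?thesis
      by (simp add: inner_add_left inner_axis' o_def)
  qed
  then show ?thesis by (simp add: has_partial_def)
qed

text \<open>The integral of the j-th derivative of character times f times Gaussian vanishes. The
  derivative of the Gaussian produces the factor - x_j, that of the character the factor - i y_j,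
  and the remaining term contains the derivative of f.\<close>

lemma fourier_gaussian_coord:
  fixes f :: "real^'n \<Rightarrow> complex"
  assumes f: "poly_deg_le d f"
  shows "fourier_gaussian (\<lambda>x. complex_of_real (x $ j) * f x) y =
    fourier_gaussian (partial j f) y - \<i> * complex_of_real (y $ j) * fourier_gaussian f y"
proof -
  let ?e = "\<lambda>x. exp (- \<i> * complex_of_real (x \<bullet> y))"
  let ?I = "\<lambda>f x. ?e x * (f x * gaussian x)"
  let ?xf = "\<lambda>x. complex_of_real (x $ j) * f x"
  let ?d = "\<lambda>x. ?I (partial j f) x - ?I ?xf x - \<i> * complex_of_real (y $ j) * ?I f x"
  note poly = f poly_deg_le_partial'[OF f, of j] poly_deg_le.coord[OF f, of j]
  note int = integrable_character_poly_gaussian[OF poly(1), of y]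
    integrable_character_poly_gaussian[OF poly(2), of y] integrable_character_poly_gaussian[OF poly(3), of y]
  have "has_partial j (?I f) ?d"
    using has_partial_mult[OF has_partial_character[of j y]
        has_partial_mult[OF poly_deg_le_has_partial[OF f, of j] has_partial_gaussian]]
    by (simp add: algebra_simps)
  moreover have "continuous_on UNIV ?d"
    by (intro continuous_intros poly_deg_le_continuous_on[OF poly(1)]
        poly_deg_le_continuous_on[OF poly(2)])
  moreover have "integrable lborel ?d"
    using int by (intro Bochner_Integration.integrable_diff integrable_mult_right) auto
  ultimately have "(LINT x|lborel. ?d x) = 0"
    using int(1) by (intro integral_directional_derivative_eq_0[where h="?I f" and v="axis j 1"])
       (auto simp: has_partial_def)
  moreover have "(LINT x|lborel. ?d x) = (LINT x|lborel. ?I (partial j f) x) - (LINT x|lborel. ?I ?xf x)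
      - \<i> * complex_of_real (y $ j) * (LINT x|lborel. ?I f x)"
    using int by (simp add: Bochner_Integration.integral_diff Bochner_Integration.integrable_diff)
  ultimately have "(LINT x|lborel. ?I ?xf x) =
      (LINT x|lborel. ?I (partial j f) x) - \<i> * complex_of_real (y $ j) * (LINT x|lborel. ?I f x)"
    by (simp add: algebra_simps)
  then show ?thesis
    unfolding fourier_gaussian_def fourier_def by (simp only: right_diff_distrib mult_ac)
qed

text \<open>In the coordinate case the claim is needed for f and also for its derivatives, which are
  not among the constituents of f in the inductive definition. A strong induction on the degree
  bound is therefore wrapped around the structural one: all of these have a smaller bound than the
  product.\<close>

lemma fourier_gaussian_poly:
  assumes "poly_deg_le d f"
  shows "\<exists>e q. poly_deg_le e q \<and> fourier_gaussian f = (\<lambda>y. q y * gaussian y) \<and>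
    (\<forall>j. fourier_gaussian (partial j f) = (\<lambda>y. \<i> * partial j q y * gaussian y))" (is "?P f")
  using assms
proof (induction d arbitrary: f rule: less_induct)
  case (less d)
  have "(\<forall>e<d. \<forall>f. poly_deg_le e f \<longrightarrow> ?P f) \<longrightarrow> ?P f"
    using less.prems
  proof (induction rule: poly_deg_le.induct)
    case (const d c)
    show ?case
      by (auto simp: fun_eq_iff fourier_gaussian_const intro!: exI[of _ "\<lambda>_. c"] poly_deg_le.const)
  next
    case (coord d f k)
    show ?case
    proof
      assume IH: "\<forall>e<Suc d. \<forall>f. poly_deg_le e f \<longrightarrow> ?P f"
      then obtain e q where q: "poly_deg_le e q" "fourier_gaussian f = (\<lambda>y. q y * gaussian y)"
        "\<And>j. fourier_gaussian (partial j f) = (\<lambda>y. \<i> * partial j q y * gaussian y)"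
        using coord.hyps by blast
      have q2: "fourier_gaussian (partial k (partial j f)) = (\<lambda>y. - partial k (partial j q) y * gaussian y)" for j
      proof -
        obtain e' q' where q': "fourier_gaussian (partial j f) = (\<lambda>y. q' y * gaussian y)"
          "fourier_gaussian (partial k (partial j f)) = (\<lambda>y. \<i> * partial k q' y * gaussian y)"
          using IH poly_deg_le_partial'[OF coord.hyps, of j] by blast
        \<comment> \<open>The Gaussian has no zeros, so the polynomial factor of a transform is
          determined by it.\<close>
        have "q' = (\<lambda>y. \<i> * partial j q y)"
          using q(3)[of j] q'(1) by (auto simp: fun_eq_iff)
        then show ?thesis
          using q'(2) by (simp only: partial_cmult[OF poly_deg_le_partial'[OF q(1)]])
            (simp add: fun_eq_iff mult.assoc[symmetric])
      qed
      let ?Q = "\<lambda>y. \<i> * partial k q y + (- \<i>) * (complex_of_real (y $ k) * q y)"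
      note pk = poly_deg_le_partial'[OF q(1), of k] and qk = poly_deg_le.coord[OF q(1), of k]
      have Q: "poly_deg_le (Suc e) ?Q"
        by (intro poly_deg_le.add poly_deg_le_cmult qk poly_deg_le_mono[OF pk]) auto
      have "fourier_gaussian (\<lambda>y. complex_of_real (y $ k) * f y) = (\<lambda>y. ?Q y * gaussian y)"
        by (rule ext, simp only: fourier_gaussian_coord[OF coord.hyps] q) (simp add: algebra_simps)
      moreover have "fourier_gaussian (partial j (\<lambda>y. complex_of_real (y $ k) * f y)) =
          (\<lambda>y. \<i> * partial j ?Q y * gaussian y)" for j
      proof
        fix y
        have "fourier_gaussian (partial j (\<lambda>y. complex_of_real (y $ k) * f y)) y =
           fourier_gaussian (\<lambda>y. complex_of_real (y $ k) * partial j f y) y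
           + (if k = j then 1 else 0) * fourier_gaussian f y"
          by (simp only: partial_coord[OF coord.hyps] fourier_gaussian_cmult
              fourier_gaussian_add[OF poly_deg_le.coord[OF poly_deg_le_partial'[OF coord.hyps]]
                poly_deg_le_cmult[OF coord.hyps]])
        also have "\<dots> = (- partial k (partial j q) y + complex_of_real (y $ k) * partial j q y
            + (if k = j then 1 else 0) * q y) * gaussian y"
          by (simp only: fourier_gaussian_coord[OF poly_deg_le_partial'[OF coord.hyps]] q q2)
             (simp add: algebra_simps)
        also have "\<dots> = \<i> * partial j ?Q y * gaussian y"
          by (simp only: partial_add[OF poly_deg_le_cmult[OF pk] poly_deg_le_cmult[OF qk]]
              partial_cmult[OF pk] partial_cmult[OF qk] partial_coord[OF q(1)] partial_commute[OF q(1), of j k])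
             (simp add: algebra_simps)
        finally show "fourier_gaussian (partial j (\<lambda>y. complex_of_real (y $ k) * f y)) y =
          \<i> * partial j ?Q y * gaussian y" .
      qed
      ultimately show "?P (\<lambda>y. complex_of_real (y $ k) * f y)"
        using Q by blast
    qed
  next
    case (add d f g)
    show ?case
    proof
      assume IH: "\<forall>e<d. \<forall>f. poly_deg_le e f \<longrightarrow> ?P f"
      obtain e q where q: "poly_deg_le e q" "fourier_gaussian f = (\<lambda>y. q y * gaussian y)"
        "\<And>j. fourier_gaussian (partial j f) = (\<lambda>y. \<i> * partial j q y * gaussian y)"
        using add.IH(1) IH by blast
      obtain e' q' where q': "poly_deg_le e' q'" "fourier_gaussian g = (\<lambda>y. q' y * gaussian y)"
        "\<And>j. fourier_gaussian (partial j g) = (\<lambda>y. \<i> * partial j q' y * gaussian y)"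
        using add.IH(2) IH by blast
      have "poly_deg_le (max e e') (\<lambda>y. q y + q' y)"
        by (intro poly_deg_le.add poly_deg_le_mono[OF q(1)] poly_deg_le_mono[OF q'(1)]) auto
      moreover have "fourier_gaussian (\<lambda>y. f y + g y) = (\<lambda>y. (q y + q' y) * gaussian y)"
        by (rule ext, simp only: fourier_gaussian_add[OF add.hyps] q q') (simp add: algebra_simps)
      moreover have "fourier_gaussian (partial j (\<lambda>y. f y + g y)) =
          (\<lambda>y. \<i> * partial j (\<lambda>y. q y + q' y) y * gaussian y)" for j
        by (rule ext, simp only: partial_add[OF add.hyps] partial_add[OF q(1) q'(1)] q q'
            fourier_gaussian_add[OF poly_deg_le_partial'[OF add.hyps(1)] poly_deg_le_partial'[OF add.hyps(2)]])
           (simp add: algebra_simps)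
      ultimately show "?P (\<lambda>y. f y + g y)" by blast
    qed
  qed
  then show ?case using less.IH by blast
qed

section \<open>The pairing that defines the intertwining operator\<close>

text \<open>\<open>Vop\<close> is this pairing with the Dunkl kernel as \<phi>. Leaving \<phi> free
  allows the homogeneous parts of the kernel to be paired one at a time.\<close>

definition heat_pairing :: "(real^'n \<Rightarrow> complex) \<Rightarrow> (real^'n \<Rightarrow> complex) \<Rightarrow> complex" where
  "heat_pairing p \<phi> = complex_of_real ((2 * pi) powr (- real CARD('n) / 2)) *
     (LINT y|lborel. heat_op \<phi> y * fourier_gaussian p y)"

lemma integrable_poly_fourier_gaussian:
  assumes p: "poly_deg_le d p" and \<phi>: "poly_deg_le e \<phi>"
  shows "integrable lborel (\<lambda>y. \<phi> y * fourier_gaussian p y)"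
proof -
  obtain e' q where q: "poly_deg_le e' q" "fourier_gaussian p = (\<lambda>y. q y * gaussian y)"
    using fourier_gaussian_poly[OF p] by blast
  show ?thesis
    using integrable_poly_gaussian[OF poly_deg_le_mult[OF \<phi> q(1)]] by (simp add: q(2) mult_ac)
qed

lemma heat_pairing_add:
  assumes "poly_deg_le d p" "poly_deg_le e \<phi>" "poly_deg_le e' \<psi>"
  shows "heat_pairing p (\<lambda>y. \<phi> y + \<psi> y) = heat_pairing p \<phi> + heat_pairing p \<psi>"
  using Bochner_Integration.integral_add[OF
      integrable_poly_fourier_gaussian[OF assms(1) poly_deg_le_heat_op[OF assms(2)]]
      integrable_poly_fourier_gaussian[OF assms(1) poly_deg_le_heat_op[OF assms(3)]]]
  by (simp add: heat_pairing_def heat_op_add[OF assms(2,3)] distrib_left distrib_right)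

lemma heat_pairing_cmult:
  assumes "poly_deg_le e \<phi>"
  shows "heat_pairing p (\<lambda>y. c * \<phi> y) = c * heat_pairing p \<phi>"
  by (simp add: heat_pairing_def heat_op_cmult[OF assms] mult.assoc)

lemma heat_pairing_0 [simp]: "heat_pairing p (\<lambda>_. 0) = 0"
  by (simp add: heat_pairing_def)

lemma heat_pairing_sum:
  assumes "poly_deg_le d p" "\<And>i. i \<in> I \<Longrightarrow> poly_deg_le e (\<phi> i)"
  shows "heat_pairing p (\<lambda>y. \<Sum>i\<in>I. \<phi> i y) = (\<Sum>i\<in>I. heat_pairing p (\<phi> i))"
  using assms(2)
proof (induction I rule: infinite_finite_induct)
  case (insert i I)
  then show ?case
    using heat_pairing_add[OF assms(1), of e "\<phi> i" e "\<lambda>y. \<Sum>i\<in>I. \<phi> i y"] poly_deg_le_sum[of I e \<phi>]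
    by auto
qed auto

text \<open>The heat operator turns y_j into y_j - d_j, which is the formal adjoint of d_j for the
  Gaussian weight. Moving it onto the polynomial factor q of the transform gives d_j q, and i d_j q
  belongs to the derivative of p.\<close>

lemma heat_pairing_coord:
  fixes p :: "real^'n \<Rightarrow> complex"
  assumes p: "poly_deg_le d p" and \<phi>: "poly_deg_le e \<phi>"
  shows "\<i> * heat_pairing p (\<lambda>y. complex_of_real (y $ j) * \<phi> y) = heat_pairing (partial j p) \<phi>"
proof -
  obtain e' q where q: "poly_deg_le e' q" "fourier_gaussian p = (\<lambda>y. q y * gaussian y)"
    "\<And>j. fourier_gaussian (partial j p) = (\<lambda>y. \<i> * partial j q y * gaussian y)"
    using fourier_gaussian_poly[OF p] by blast
  define \<psi> where "\<psi> = heat_op \<phi>"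
  have \<psi>: "poly_deg_le e \<psi>" using poly_deg_le_heat_op[OF \<phi>] by (simp add: \<psi>_def)
  let ?h = "\<lambda>y. (\<psi> y * q y) * gaussian y"
  let ?A = "\<lambda>y. \<psi> y * partial j q y * gaussian y"
  let ?B = "\<lambda>y. (complex_of_real (y $ j) * \<psi> y - partial j \<psi> y) * q y * gaussian y"
  note pm = poly_deg_le_mult[OF \<psi> q(1)]
  have intA: "integrable lborel ?A"
    by (rule integrable_poly_gaussian[OF poly_deg_le_mult[OF \<psi> poly_deg_le_partial'[OF q(1)]]])
  have intB: "integrable lborel ?B"
  proof -
    have "poly_deg_le (Suc e) (\<lambda>y. complex_of_real (y $ j) * \<psi> y + (-1) * partial j \<psi> y)"
      by (intro poly_deg_le.add poly_deg_le.coord poly_deg_le_cmult \<psi>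
          poly_deg_le_mono[OF poly_deg_le_partial'[OF \<psi>]]) auto
    from integrable_poly_gaussian[OF poly_deg_le_mult[OF this q(1)]] show ?thesis by simp
  qed
  have "has_partial j ?h (\<lambda>y. ?A y - ?B y)"
    using has_partial_mult[OF has_partial_mult[OF poly_deg_le_has_partial[OF \<psi>, of j]
          poly_deg_le_has_partial[OF q(1), of j]] has_partial_gaussian]
    by (simp add: algebra_simps)
  moreover have "continuous_on UNIV (\<lambda>y. ?A y - ?B y)"
    by (intro continuous_intros poly_deg_le_continuous_on[OF \<psi>] poly_deg_le_continuous_on[OF q(1)]
        poly_deg_le_continuous_on[OF poly_deg_le_partial'[OF \<psi>]]
        poly_deg_le_continuous_on[OF poly_deg_le_partial'[OF q(1)]])
  ultimately have "(LINT y|lborel. ?A y - ?B y) = 0"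
    using integrable_poly_gaussian[OF pm] intA intB
    by (intro integral_directional_derivative_eq_0[where h="?h" and v="axis j 1"])
       (auto simp: has_partial_def)
  then have AB: "(LINT y|lborel. ?B y) = (LINT y|lborel. ?A y)"
    using intA intB by simp
  have "heat_pairing p (\<lambda>y. complex_of_real (y $ j) * \<phi> y) =
      complex_of_real ((2 * pi) powr (- real CARD('n) / 2)) * (LINT y|lborel. ?B y)"
    unfolding heat_pairing_def heat_op_coord[OF \<phi>] q(2) \<psi>_def by (simp only: mult.assoc)
  moreover have "heat_pairing (partial j p) \<phi> =
      complex_of_real ((2 * pi) powr (- real CARD('n) / 2)) * (LINT y|lborel. \<i> * ?A y)"
    unfolding heat_pairing_def q(3) \<psi>_def by (simp only: mult_ac)
  ultimately show ?thesis unfolding AB by simp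
qed

text \<open>Each of the n coordinate factors of \<phi> can be traded for a derivative of p, and more
  than d derivatives annihilate p.\<close>

lemma heat_pairing_eq_0:
  assumes "homog_bound n M \<phi>" "poly_deg_le d p" "d < n"
  shows "heat_pairing p \<phi> = 0"
  using assms
proof (induction arbitrary: p d rule: homog_bound.induct)
  case (coord n M f k)
  have "heat_pairing (partial k p) f = 0"
  proof (cases d)
    case 0
    then have "partial k p = (\<lambda>_. 0)" using coord.prems partial_degree_0 by blast
    then show ?thesis by (simp add: heat_pairing_def fourier_gaussian_const)
  next
    case (Suc m)
    then show ?thesis using coord.prems poly_deg_le_partial[of d p k] by (intro coord.IH[of m]) auto
  qed
  then show ?case
    using heat_pairing_coord[OF coord.prems(1) homog_bound_imp_poly[OF coord.hyps], of k] by simp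
next
  case (add n M f M' g)
  then show ?case
    by (simp add: heat_pairing_add[OF add.prems(1) homog_bound_imp_poly[OF add.hyps(1)] homog_bound_imp_poly[OF add.hyps(2)]])
qed auto

text \<open>Dominated convergence applies because the bound on the heat-transformed partial sums is
  uniform in N and the Gaussian in the transform of p beats it. The resulting sequence is constant
  from N = d + 1 on, since higher degrees pair to zero.\<close>

lemma heat_pairing_exp_type:
  fixes p :: "real^'n \<Rightarrow> complex"
  assumes F: "exp_type C \<rho> F" and \<rho>: "0 \<le> \<rho>" and p: "poly_deg_le d p"
  shows "heat_pairing p (\<lambda>y. \<Sum>n. F n y) = (\<Sum>n\<le>d. heat_pairing p (F n))"
proof -
  obtain e q where q: "poly_deg_le e q" "fourier_gaussian p = (\<lambda>y. q y * gaussian y)"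
    using fourier_gaussian_poly[OF p] by blast
  obtain D where D: "\<And>y. norm (q y) \<le> D * exp (e * norm y)"
    using poly_deg_le_exp_bound[OF q(1)] by auto
  have D0: "0 \<le> D" using order.trans[OF norm_ge_zero D[of 0]] by simp
  define B where "B = C * exp (CARD('n) * \<rho>\<^sup>2)"
  let ?S = "\<lambda>N y. \<Sum>n<N. F n y"
  have poly: "poly_deg_le N (?S N)" for N
    by (intro poly_deg_le_sum poly_deg_le_mono[OF exp_type_poly[OF F]]) auto
  have meas_S: "heat_op (?S N) \<in> borel_measurable lborel" for N
    using borel_measurable_continuous_onI[OF poly_deg_le_continuous_on[OF poly_deg_le_heat_op[OF poly]]]
    by simp
  \<comment> \<open>Measurability comes from the pointwise limit of continuous partial sums.\<close>
  have meas: "heat_op (\<lambda>y. \<Sum>n. F n y) \<in> borel_measurable lborel"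
    using meas_S heat_op_exp_type_tendsto[OF F \<rho>] by (rule borel_measurable_LIMSEQ_metric)
  have meas_p: "fourier_gaussian p \<in> borel_measurable lborel"
    using borel_measurable_continuous_onI[of "fourier_gaussian p"] poly_deg_le_continuous_on[OF q(1)]
    by (auto simp: q(2) intro!: continuous_intros)
  have bound: "norm (heat_op (?S N) y * fourier_gaussian p y)
      \<le> B * D * (norm y ^ 0 * exp ((\<rho> + e) * norm y) * exp (- (norm y)\<^sup>2 / 2))" for N y
  proof -
    have 1: "norm (heat_op (?S N) y) \<le> B * exp (\<rho> * norm y)"
      unfolding B_def by (rule heat_op_exp_type_partial_sum_le[OF F \<rho>])
    have "norm (heat_op (?S N) y * fourier_gaussian p y) \<le>
        (B * exp (\<rho> * norm y)) * ((D * exp (e * norm y)) * exp (- (norm y)\<^sup>2 / 2))"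
      unfolding q(2) norm_mult
      by (intro mult_mono 1 D order.trans[OF _ 1] mult_nonneg_nonneg D0) (auto simp: gaussian_def)
    moreover have "exp ((\<rho> + e) * norm y) = exp (\<rho> * norm y) * exp (e * norm y)"
      by (simp add: exp_add[symmetric] algebra_simps)
    ultimately show ?thesis by (simp add: mult_ac)
  qed
  have "(\<lambda>N. LINT y|lborel. heat_op (?S N) y * fourier_gaussian p y) \<longlonglongrightarrow>
      (LINT y|lborel. heat_op (\<lambda>y. \<Sum>n. F n y) y * fourier_gaussian p y)"
  proof (rule integral_dominated_convergence)
    show "integrable lborel (\<lambda>y::real^'n. B * D * (norm y ^ 0 * exp ((\<rho> + e) * norm y) * exp (- (norm y)\<^sup>2 / 2)))"
      by (intro integrable_mult_right integrable_exp_linear_gaussian)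
    show "AE y in lborel. (\<lambda>N. heat_op (?S N) y * fourier_gaussian p y) \<longlonglongrightarrow>
        heat_op (\<lambda>y. \<Sum>n. F n y) y * fourier_gaussian p y"
      by (intro AE_I2 tendsto_mult tendsto_const heat_op_exp_type_tendsto[OF F \<rho>])
    show "AE y in lborel. norm (heat_op (?S N) y * fourier_gaussian p y)
      \<le> B * D * (norm y ^ 0 * exp ((\<rho> + e) * norm y) * exp (- (norm y)\<^sup>2 / 2))" for N
      by (intro AE_I2 bound)
  qed (use meas meas_S meas_p in measurable)
  then have "(\<lambda>N. heat_pairing p (?S N)) \<longlonglongrightarrow> heat_pairing p (\<lambda>y. \<Sum>n. F n y)"
    unfolding heat_pairing_def by (intro tendsto_mult tendsto_const)
  moreover have "heat_pairing p (?S N) = (\<Sum>n\<le>d. heat_pairing p (F n))" if "N > d" for N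
  proof -
    have "heat_pairing p (?S N) = (\<Sum>n<N. heat_pairing p (F n))"
      by (intro heat_pairing_sum[OF p, where e=N] poly_deg_le_mono[OF exp_type_poly[OF F]]) auto
    also have "\<dots> = (\<Sum>n\<le>d. heat_pairing p (F n))"
    proof -
      have "heat_pairing p (F n) = 0" if "d < n" for n
        using F heat_pairing_eq_0[OF _ p that] unfolding exp_type_def by blast
      then show ?thesis
        using that by (intro sum.mono_neutral_right) (auto simp: not_le)
    qed
    finally show ?thesis .
  qed
  then have "(\<lambda>N. heat_pairing p (?S N)) \<longlonglongrightarrow> (\<Sum>n\<le>d. heat_pairing p (F n))"
    by (intro tendsto_eventually eventually_mono[OF eventually_gt_at_top[of d]])
  ultimately show ?thesis by (rule LIMSEQ_unique)
qed

section \<open>From coefficient form to degree-bounded polynomials\<close>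

lemma poly_deg_le_sum_exists:
  assumes "finite I" "\<And>i. i \<in> I \<Longrightarrow> \<exists>d. poly_deg_le d (f i)"
  shows "\<exists>d. poly_deg_le d (\<lambda>y. \<Sum>i\<in>I. f i y)"
  using assms
proof (induction I)
  case empty
  show ?case by (auto intro: poly_deg_le.const)
next
  case (insert i I)
  obtain d where "poly_deg_le d (f i)" using insert.prems by auto
  moreover obtain e where "poly_deg_le e (\<lambda>y. \<Sum>i\<in>I. f i y)" using insert.IH insert.prems by auto
  ultimately have "poly_deg_le (max d e) (\<lambda>y. f i y + (\<Sum>i\<in>I. f i y))"
    by (intro poly_deg_le.add) (auto intro: poly_deg_le_mono)
  with insert.hyps show ?case by auto
qed

lemma poly_fun_imp_poly_deg_le:
  fixes p :: "real^'n \<Rightarrow> complex"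
  assumes "poly_fun p"
  shows "\<exists>d. poly_deg_le d p"
proof -
  obtain A c where A: "finite A" and p: "\<And>x. p x = (\<Sum>a\<in>A. c a * (\<Prod>k\<in>UNIV. complex_of_real (x $ k) ^ a k))"
    using assms unfolding poly_fun_def by blast
  have pow: "poly_deg_le n (\<lambda>x::real^'n. complex_of_real (x $ k) ^ n)" for k n
    by (induction n) (auto intro: poly_deg_le.intros)
  have "\<exists>d. poly_deg_le d (\<lambda>x::real^'n. \<Prod>k\<in>K. complex_of_real (x $ k) ^ a k)" if "finite K" for K a
    using that
  proof (induction K)
    case (insert k K)
    then obtain d where "poly_deg_le d (\<lambda>x::real^'n. \<Prod>k\<in>K. complex_of_real (x $ k) ^ a k)" by auto
    from poly_deg_le_mult[OF pow[of "a k" k] this] show ?case using insert.hyps by auto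
  qed (auto intro: poly_deg_le.const)
  then have "\<exists>d. poly_deg_le d (\<lambda>x. c a * (\<Prod>k\<in>UNIV. complex_of_real (x $ k) ^ a k))" for a
    using poly_deg_le_cmult by (metis finite)
  then have "\<exists>d. poly_deg_le d (\<lambda>x. \<Sum>a\<in>A. c a * (\<Prod>k\<in>UNIV. complex_of_real (x $ k) ^ a k))"
    using A by (intro poly_deg_le_sum_exists)
  then show ?thesis by (simp add: p[abs_def])
qed

section \<open>Reflections and their complexification\<close>

abbreviation rfl :: "real^'n \<Rightarrow> real^'n \<Rightarrow> real^'n" where
  "rfl \<equiv> Defs.refl"

lemma linear_rfl: "linear (rfl \<alpha>)"
  unfolding Defs.refl_def
  by (rule linearI) (simp_all add: inner_add_left add_divide_distrib algebra_simps)

lemma has_derivative_rfl: "(rfl \<alpha> has_derivative rfl \<alpha>) (at x)"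
  using linear_rfl by (intro bounded_linear_imp_has_derivative) (simp add: linear_conv_bounded_linear)

lemma inner_rfl: "rfl \<alpha> x \<bullet> y = x \<bullet> rfl \<alpha> y"
  by (simp add: Defs.refl_def inner_diff_left inner_diff_right inner_commute)

lemma rfl_rfl [simp]: "rfl \<alpha> (rfl \<alpha> x) = x"
  by (cases "\<alpha> = 0") (simp_all add: Defs.refl_def inner_diff_left scaleR_diff_left[symmetric] divide_simps)

lemma inner_rfl_rfl: "rfl \<alpha> x \<bullet> rfl \<alpha> y = x \<bullet> y"
  by (simp add: inner_rfl)

lemma norm_rfl: "norm (rfl \<alpha> x) = norm x"
  by (simp add: norm_eq_sqrt_inner inner_rfl_rfl)

text \<open>Reflections are isometries, so conjugating one by another reflects in the image root.
  Every equivariance argument below rests on this.\<close>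

lemma rfl_rfl_conj: "rfl \<beta> (rfl \<alpha> x) = rfl (rfl \<beta> \<alpha>) (rfl \<beta> x)"
proof -
  have "rfl \<beta> (rfl \<alpha> x) = rfl \<beta> x - (2 * (x \<bullet> \<alpha>) / (\<alpha> \<bullet> \<alpha>)) *\<^sub>R rfl \<beta> \<alpha>"
    by (simp add: Defs.refl_def[of \<alpha>] linear_diff[OF linear_rfl] linear_scale[OF linear_rfl])
  then show ?thesis by (simp add: Defs.refl_def[of "rfl \<beta> \<alpha>"] inner_rfl_rfl)
qed

lemma rfl_minus: "rfl (- \<alpha>) = rfl \<alpha>"
  by (simp add: Defs.refl_def fun_eq_iff)

lemma rfl_0 [simp]: "rfl \<alpha> 0 = 0"
  by (simp add: Defs.refl_def)

lemma rfl_orthogonal: "x \<bullet> \<alpha> = 0 \<Longrightarrow> rfl \<alpha> x = x"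
  by (simp add: Defs.refl_def)

definition Rev :: "complex^'n \<Rightarrow> real^'n" where "Rev z = (\<chi> k. Re (z $ k))"
definition Imv :: "complex^'n \<Rightarrow> real^'n" where "Imv z = (\<chi> k. Im (z $ k))"

text \<open>The kernel has to be holomorphic on complex vectors while the group consists of real
  maps, so these act on real and imaginary parts separately.\<close>

definition complexify :: "(real^'n \<Rightarrow> real^'n) \<Rightarrow> complex^'n \<Rightarrow> complex^'n" where
  "complexify g z = (\<chi> k. Complex (g (Rev z) $ k) (g (Imv z) $ k))"

abbreviation crfl :: "real^'n \<Rightarrow> complex^'n \<Rightarrow> complex^'n" where
  "crfl \<alpha> \<equiv> complexify (rfl \<alpha>)"

text \<open>Bilinear rather than Hermitian, as holomorphy in both arguments demands.\<close>

definition cdot :: "complex^'n \<Rightarrow> complex^'n \<Rightarrow> complex" where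
  "cdot x y = (\<Sum>k\<in>UNIV. x $ k * y $ k)"

lemma Rev_complexify [simp]: "Rev (complexify g z) = g (Rev z)"
  by (simp add: Rev_def complexify_def vec_eq_iff)

lemma Imv_complexify [simp]: "Imv (complexify g z) = g (Imv z)"
  by (simp add: Imv_def complexify_def vec_eq_iff)

lemma complex_vec_eq_iff: "z = w \<longleftrightarrow> Rev z = Rev w \<and> Imv z = Imv w"
  by (auto simp: Rev_def Imv_def vec_eq_iff complex_eq_iff)

lemma complexify_comp: "complexify g (complexify h z) = complexify (g \<circ> h) z"
  by (simp add: complex_vec_eq_iff)

lemma complexify_id [simp]: "complexify id z = z"
  by (simp add: complex_vec_eq_iff)

lemma Rev_cvec [simp]: "Rev (cvec x) = x" and Imv_cvec [simp]: "Imv (cvec x) = 0"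
  by (simp_all add: Rev_def Imv_def cvec_def vec_eq_iff)

lemma complexify_cvec: "g 0 = 0 \<Longrightarrow> complexify g (cvec x) = cvec (g x)"
  by (simp add: complex_vec_eq_iff)

lemma linear_Rev: "linear Rev" and linear_Imv: "linear Imv"
  by (auto intro!: linearI simp: Rev_def Imv_def vec_eq_iff)

lemma linear_complexify: "linear g \<Longrightarrow> linear (complexify g)"
  by (rule linearI) (simp_all add: complex_vec_eq_iff linear_add linear_scale linear_Rev linear_Imv)

lemma complexify_i:
  assumes "linear g"
  shows "complexify g (\<chi> k. \<i> * z $ k) = (\<chi> k. \<i> * complexify g z $ k)"
proof -
  have i: "Rev (\<chi> k. \<i> * z $ k) = - Imv z" "Imv (\<chi> k. \<i> * z $ k) = Rev z" for z :: "complex^'n"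
    by (simp_all add: Rev_def Imv_def vec_eq_iff)
  show ?thesis by (simp add: complex_vec_eq_iff i linear_neg[OF assms])
qed

lemma norm_power2_Rev_Imv: "(norm z)\<^sup>2 = (norm (Rev z))\<^sup>2 + (norm (Imv z))\<^sup>2"
proof -
  have "(norm z)\<^sup>2 = (\<Sum>k\<in>UNIV. (norm (z $ k))\<^sup>2)"
    by (simp add: norm_vec_def L2_set_def sum_nonneg)
  also have "\<dots> = (\<Sum>k\<in>UNIV. (Re (z $ k))\<^sup>2 + (Im (z $ k))\<^sup>2)"
    by (simp add: cmod_power2)
  also have "\<dots> = (norm (Rev z))\<^sup>2 + (norm (Imv z))\<^sup>2"
    by (simp add: norm_vec_def L2_set_def sum_nonneg sum.distrib Rev_def Imv_def)
  finally show ?thesis .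
qed

lemma norm_cvec: "norm (cvec z) = norm z"
proof -
  have "(norm (cvec z))\<^sup>2 = (norm z)\<^sup>2" by (simp add: norm_power2_Rev_Imv)
  then show ?thesis by simp
qed

lemma norm_complexify:
  assumes "\<And>x. norm (g x) = norm x"
  shows "norm (complexify g z) = norm z"
proof -
  have "(norm (complexify g z))\<^sup>2 = (norm z)\<^sup>2"
    by (simp add: norm_power2_Rev_Imv assms)
  then show ?thesis by simp
qed

lemma cdot_Rev_Imv:
  "cdot x y = Complex (Rev x \<bullet> Rev y - Imv x \<bullet> Imv y) (Rev x \<bullet> Imv y + Imv x \<bullet> Rev y)"
  by (simp add: cdot_def complex_eq_iff Re_sum Im_sum inner_vec_def Rev_def Imv_def sum_subtractf sum.distrib)

lemma cdot_commute: "cdot x y = cdot y x"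
  by (simp add: cdot_def mult.commute)

lemma cdot_complexify_rfl: "cdot (crfl \<alpha> x) y = cdot x (crfl \<alpha> y)"
  by (simp add: cdot_Rev_Imv inner_rfl)

lemma complexify_rfl_nth:
  "crfl \<alpha> z $ k = z $ k - complex_of_real (2 / (\<alpha> \<bullet> \<alpha>)) * cdot z (cvec \<alpha>) * complex_of_real (\<alpha> $ k)"
  by (simp add: complexify_def complex_eq_iff Defs.refl_def cdot_Rev_Imv) (simp add: Rev_def Imv_def)

lemma complexify_rfl_complexify_rfl [simp]: "crfl \<alpha> (crfl \<alpha> z) = z"
  by (simp add: complex_vec_eq_iff)

lemma norm_complexify_rfl: "norm (crfl \<alpha> z) = norm z"
  by (simp add: norm_complexify norm_rfl)

lemma norm_cdot_le: "norm (cdot x y) \<le> CARD('n) * norm x * norm y" for x y :: "complex^'n"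
proof -
  have "norm (cdot x y) \<le> (\<Sum>k\<in>(UNIV::'n set). norm x * norm y)"
    unfolding cdot_def
    by (rule order.trans[OF norm_sum], rule sum_mono)
       (auto simp: norm_mult intro!: mult_mono Finite_Cartesian_Product.norm_nth_le)
  then show ?thesis by simp
qed

section \<open>Averaging over the reflection group\<close>

text \<open>\<open>refl_group\<close> is generated by multiplication from the left. The recursion
  for the inverse in the group algebra multiplies from the right, hence the third claim.\<close>

lemma
  assumes "g \<in> refl_group R"
  shows refl_group_linear: "linear g"
    and refl_group_norm: "norm (g x) = norm x"
    and refl_group_comp_rfl: "\<alpha> \<in> R \<Longrightarrow> g \<circ> rfl \<alpha> \<in> refl_group R"
  using assms
proof (induction arbitrary: x rule: refl_group.induct)
  case id
  {
    case 1 show ?case by (simp add: linear_id[unfolded id_def] id_def)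
  next
    case 2 show ?case by simp
  next
    case 3 then show ?case using refl_group.step[OF refl_group.id] by simp
  }
next
  case (step g \<beta>)
  {
    case 1 show ?case by (rule linear_compose[OF step.IH(1) linear_rfl])
  next
    case 2 show ?case by (simp add: norm_rfl step.IH(2))
  next
    case 3 then show ?case using refl_group.step[OF step.IH(3) step.hyps(2)] by (simp only: comp_assoc)
  }
qed

locale dunkl_setting =
  fixes R Rp :: "(real^'n) set" and \<kappa> :: "real^'n \<Rightarrow> real"
  assumes root_system: "root_system R"
    and positive_subsystem: "positive_subsystem R Rp"
    and \<kappa>_nonneg: "\<forall>\<alpha>\<in>R. \<kappa> \<alpha> \<ge> 0"
    and \<kappa>_invariant: "\<forall>g\<in>refl_group R. \<forall>\<alpha>\<in>R. \<kappa> (g \<alpha>) = \<kappa> \<alpha>"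
begin

lemma finite_R: "finite R" and zero_notin_R: "0 \<notin> R"
  and rfl_in_R: "\<alpha> \<in> R \<Longrightarrow> \<beta> \<in> R \<Longrightarrow> rfl \<alpha> \<beta> \<in> R"
  using root_system unfolding root_system_def by auto

lemma minus_in_R: "\<alpha> \<in> R \<Longrightarrow> - \<alpha> \<in> R"
  using root_system unfolding root_system_def by (metis scaleR_minus1_left)

lemma Rp_subset_R: "Rp \<subseteq> R" and finite_Rp: "finite Rp"
  using positive_subsystem finite_R unfolding positive_subsystem_def by auto

lemma Rp_imp_R [simp]: "\<alpha> \<in> Rp \<Longrightarrow> \<alpha> \<in> R"
  using Rp_subset_R by auto

lemma \<kappa>_rfl: "\<alpha> \<in> R \<Longrightarrow> \<beta> \<in> R \<Longrightarrow> \<kappa> (rfl \<beta> \<alpha>) = \<kappa> \<alpha>"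
  using \<kappa>_invariant refl_group.step[OF refl_group.id, of \<beta> R] by auto

lemma \<kappa>_minus: "\<alpha> \<in> R \<Longrightarrow> \<kappa> (- \<alpha>) = \<kappa> \<alpha>"
proof -
  assume \<alpha>: "\<alpha> \<in> R"
  then have "\<alpha> \<noteq> 0" using zero_notin_R by auto
  then have "rfl \<alpha> \<alpha> = - \<alpha>" by (simp add: Defs.refl_def scaleR_2)
  with \<kappa>_rfl[OF \<alpha> \<alpha>] show ?thesis by simp
qed

lemma sum_R_even:
  fixes f :: "real^'n \<Rightarrow> complex"
  assumes "\<And>\<alpha>. \<alpha> \<in> R \<Longrightarrow> f (- \<alpha>) = f \<alpha>"
  shows "(\<Sum>\<alpha>\<in>R. f \<alpha>) = 2 * (\<Sum>\<alpha>\<in>Rp. f \<alpha>)"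
proof -
  obtain \<beta> where \<beta>: "\<forall>\<alpha>\<in>R. \<alpha> \<bullet> \<beta> \<noteq> 0" "Rp = {\<alpha>\<in>R. \<alpha> \<bullet> \<beta> > 0}"
    using positive_subsystem unfolding positive_subsystem_def by (elim exE conjE)
  have R: "R = Rp \<union> uminus ` Rp"
  proof (intro equalityI subsetI)
    fix \<alpha> assume \<alpha>: "\<alpha> \<in> R"
    show "\<alpha> \<in> Rp \<union> uminus ` Rp"
    proof (cases "\<alpha> \<bullet> \<beta> > 0")
      case False
      then have "\<alpha> \<bullet> \<beta> < 0" using \<beta>(1) \<alpha> by (meson linorder_neqE)
      then have "- \<alpha> \<in> Rp" using minus_in_R[OF \<alpha>] by (simp add: \<beta>(2) del: Rp_imp_R)
      then have "- (- \<alpha>) \<in> uminus ` Rp" by (rule imageI)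
      then show ?thesis by simp
    qed (use \<alpha> in \<open>simp add: \<beta>(2) del: Rp_imp_R\<close>)
  next
    fix \<alpha> assume "\<alpha> \<in> Rp \<union> uminus ` Rp"
    then show "\<alpha> \<in> R" using minus_in_R Rp_imp_R by blast
  qed
  have disj: "Rp \<inter> uminus ` Rp = {}" by (auto simp: \<beta>(2) simp del: Rp_imp_R)
  have "(\<Sum>\<alpha>\<in>R. f \<alpha>) = (\<Sum>\<alpha>\<in>Rp. f \<alpha>) + (\<Sum>\<alpha>\<in>uminus ` Rp. f \<alpha>)"
    by (subst R, rule sum.union_disjoint) (use finite_Rp disj in simp_all)
  also have "(\<Sum>\<alpha>\<in>uminus ` Rp. f \<alpha>) = (\<Sum>\<alpha>\<in>Rp. f \<alpha>)"
    by (subst sum.reindex) (auto simp: assms)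
  finally show ?thesis by simp
qed

text \<open>A reflection need not preserve \<open>Rp\<close>, but it permutes R. An even summand has
  the same value at both roots of a pair, so the sum can be doubled to R, reindexed there and halved
  again.\<close>

lemma sum_Rp_rfl:
  fixes f :: "real^'n \<Rightarrow> complex"
  assumes f: "\<And>\<alpha>. \<alpha> \<in> R \<Longrightarrow> f (- \<alpha>) = f \<alpha>" and \<beta>: "\<beta> \<in> R"
  shows "(\<Sum>\<alpha>\<in>Rp. f (rfl \<beta> \<alpha>)) = (\<Sum>\<alpha>\<in>Rp. f \<alpha>)"
proof -
  have "2 * (\<Sum>\<alpha>\<in>Rp. f (rfl \<beta> \<alpha>)) = (\<Sum>\<alpha>\<in>R. f (rfl \<beta> \<alpha>))"
    using f rfl_in_R[OF \<beta>] by (intro sum_R_even[symmetric]) (simp add: linear_neg[OF linear_rfl])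
  also have "\<dots> = (\<Sum>\<alpha>\<in>R. f \<alpha>)"
    by (rule sum.reindex_bij_witness[where i="rfl \<beta>" and j="rfl \<beta>"]) (auto intro: rfl_in_R \<beta>)
  also have "\<dots> = 2 * (\<Sum>\<alpha>\<in>Rp. f \<alpha>)" by (rule sum_R_even) (rule f)
  finally show ?thesis by simp
qed

abbreviation G where "G \<equiv> refl_group R"

lemma rfl_comp_in_G: "\<alpha> \<in> R \<Longrightarrow> g \<in> G \<Longrightarrow> rfl \<alpha> \<circ> g \<in> G"
  by (rule refl_group.step)

lemma refl_group_R: "g \<in> G \<Longrightarrow> \<alpha> \<in> R \<Longrightarrow> g \<alpha> \<in> R"
  by (induction rule: refl_group.induct) (auto intro: rfl_in_R)

lemma refl_group_orthogonal:
  assumes "g \<in> G" "\<And>\<alpha>. \<alpha> \<in> R \<Longrightarrow> x \<bullet> \<alpha> = 0"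
  shows "g x = x"
  using assms by (induction rule: refl_group.induct) (auto simp: rfl_orthogonal)

text \<open>A group element is determined by the permutation of the roots that it induces, since it fixes
  the orthogonal complement of their span.\<close>

lemma finite_G: "finite G"
proof (rule inj_on_finite)
  show "inj_on (\<lambda>g. restrict g R) G"
  proof
    fix g h assume g: "g \<in> G" and h: "h \<in> G" and eq: "restrict g R = restrict h R"
    have lin: "linear (\<lambda>x. g x - h x)"
      by (intro linear_compose_sub refl_group_linear[OF g] refl_group_linear[OF h])
    have R0: "g \<alpha> - h \<alpha> = 0" if "\<alpha> \<in> R" for \<alpha>
      using fun_cong[OF eq, of \<alpha>] that by simp
    have "g x = h x" for x
    proof -
      obtain a b where a: "a \<in> span R" and b: "\<And>w. w \<in> span R \<Longrightarrow> orthogonal b w" and x: "x = a + b"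
        using orthogonal_subspace_decomp_exists[of R x] by metis
      have "g a - h a = 0" by (rule linear_eq_0_on_span[OF lin R0 a])
      moreover have "g b = b" "h b = b"
        using b g h by (auto intro!: refl_group_orthogonal simp: orthogonal_def span_base)
      ultimately show ?thesis
        by (simp add: x linear_add[OF refl_group_linear[OF g]] linear_add[OF refl_group_linear[OF h]])
    qed
    then show "g = h" by auto
  qed
  show "(\<lambda>g. restrict g R) ` G \<subseteq> R \<rightarrow>\<^sub>E R"
    by (auto intro: refl_group_R)
  show "finite (R \<rightarrow>\<^sub>E R)"
    using finite_R by (simp add: finite_PiE)
qed

definition \<gamma> :: real where "\<gamma> = (\<Sum>\<alpha>\<in>Rp. \<kappa> \<alpha>)"

lemma \<gamma>_nonneg: "0 \<le> \<gamma>"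
  unfolding \<gamma>_def using \<kappa>_nonneg by (intro sum_nonneg) auto

text \<open>Since \<open>\<Sum> \<kappa>(\<alpha>) \<sigma>\<^sub>\<alpha>\<close> has norm at most \<open>\<gamma>\<close> in the group algebra, the element
  \<open>s + \<Sum> \<kappa>(\<alpha>) (1 - \<sigma>\<^sub>\<alpha>)\<close> is invertible for \<open>s > 0\<close>; \<open>resolvent s\<close> are the
  coefficients of its inverse, given by the Neumann series.\<close>

fun neumann :: "nat \<Rightarrow> (real^'n \<Rightarrow> real^'n) \<Rightarrow> real" where
  "neumann 0 g = (if g = id then 1 else 0)"
| "neumann (Suc k) g = (\<Sum>\<alpha>\<in>Rp. \<kappa> \<alpha> * neumann k (g \<circ> rfl \<alpha>))"

definition resolvent :: "real \<Rightarrow> (real^'n \<Rightarrow> real^'n) \<Rightarrow> real" where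
  "resolvent s g = (\<Sum>k. neumann k g / (s + \<gamma>) ^ Suc k)"

lemma neumann_bounds: "0 \<le> neumann k g \<and> neumann k g \<le> \<gamma> ^ k"
proof (induction k arbitrary: g)
  case (Suc k)
  have "(\<Sum>\<alpha>\<in>Rp. \<kappa> \<alpha> * neumann k (g \<circ> rfl \<alpha>)) \<le> (\<Sum>\<alpha>\<in>Rp. \<kappa> \<alpha> * \<gamma> ^ k)"
    using Suc.IH \<kappa>_nonneg by (intro sum_mono mult_left_mono) auto
  also have "\<dots> = \<gamma> ^ Suc k" by (simp add: \<gamma>_def sum_distrib_right)
  finally show ?case using Suc.IH \<kappa>_nonneg by (auto intro!: sum_nonneg)
qed auto

lemma summable_neumann:
  assumes "0 < s"
  shows "summable (\<lambda>k. neumann k g / (s + \<gamma>) ^ Suc k)"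
proof (rule summable_comparison_test')
  have "norm (\<gamma> / (s + \<gamma>)) < 1" using assms \<gamma>_nonneg by (simp add: field_simps)
  then show "summable (\<lambda>k. (1 / (s + \<gamma>)) * (\<gamma> / (s + \<gamma>)) ^ k)"
    by (intro summable_mult summable_geometric)
  show "norm (neumann k g / (s + \<gamma>) ^ Suc k) \<le> 1 / (s + \<gamma>) * (\<gamma> / (s + \<gamma>)) ^ k" for k
    using neumann_bounds[of k g] assms \<gamma>_nonneg
    by (simp add: power_divide abs_mult divide_right_mono)
qed

lemma resolvent_nonneg: "0 < s \<Longrightarrow> 0 \<le> resolvent s g"
  unfolding resolvent_def using neumann_bounds \<gamma>_nonneg
  by (intro suminf_nonneg summable_neumann divide_nonneg_pos) auto

text \<open>Multiplying the Neumann series by s + \<gamma> lowers every exponent by one: the first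
  term gives the identity, and the others give the series once more, composed with the
  reflections.\<close>

lemma resolvent_equation:
  assumes "0 < s"
  shows "(s + \<gamma>) * resolvent s g = (if g = id then 1 else 0) + (\<Sum>\<alpha>\<in>Rp. \<kappa> \<alpha> * resolvent s (g \<circ> rfl \<alpha>))"
proof -
  have pos: "s + \<gamma> > 0" using assms \<gamma>_nonneg by simp
  have "(s + \<gamma>) * resolvent s g = (\<Sum>k. (s + \<gamma>) * (neumann k g / (s + \<gamma>) ^ Suc k))"
    unfolding resolvent_def by (rule suminf_mult[OF summable_neumann[OF assms], symmetric])
  also have "\<dots> = (\<Sum>k. neumann k g / (s + \<gamma>) ^ k)"
    using pos by simp
  also have "\<dots> = neumann 0 g + (\<Sum>k. neumann (Suc k) g / (s + \<gamma>) ^ Suc k)"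
  proof -
    have "summable (\<lambda>k. (s + \<gamma>) * (neumann k g / (s + \<gamma>) ^ Suc k))"
      by (rule summable_mult[OF summable_neumann[OF assms]])
    then have "summable (\<lambda>k. neumann k g / (s + \<gamma>) ^ k)" using pos by simp
    from suminf_split_head[OF this] show ?thesis by simp
  qed
  also have "(\<Sum>k. neumann (Suc k) g / (s + \<gamma>) ^ Suc k) =
      (\<Sum>k. \<Sum>\<alpha>\<in>Rp. \<kappa> \<alpha> * (neumann k (g \<circ> rfl \<alpha>) / (s + \<gamma>) ^ Suc k))"
    by (simp only: neumann.simps sum_divide_distrib times_divide_eq_right)
  also have "\<dots> = (\<Sum>\<alpha>\<in>Rp. \<Sum>k. \<kappa> \<alpha> * (neumann k (g \<circ> rfl \<alpha>) / (s + \<gamma>) ^ Suc k))"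
    by (intro suminf_sum summable_mult summable_neumann assms)
  also have "\<dots> = (\<Sum>\<alpha>\<in>Rp. \<kappa> \<alpha> * resolvent s (g \<circ> rfl \<alpha>))"
    unfolding resolvent_def by (intro sum.cong HOL.refl suminf_mult summable_neumann assms)
  finally show ?thesis by simp
qed

lemma sum_G_comp_rfl:
  assumes "\<alpha> \<in> R"
  shows "(\<Sum>g\<in>G. f g (g \<circ> rfl \<alpha>)) = (\<Sum>g\<in>G. f (g \<circ> rfl \<alpha>) g)"
  by (rule sum.reindex_bij_witness[where i="\<lambda>g. g \<circ> rfl \<alpha>" and j="\<lambda>g. g \<circ> rfl \<alpha>"])
     (auto simp: refl_group_comp_rfl assms, simp_all add: comp_def)

text \<open>Summing over the group is the trivial character. It sends each 1 - \<sigma>_\<alpha> to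
  0, so the inverse of s + ... is sent to 1/s.\<close>

lemma sum_resolvent:
  assumes "0 < s"
  shows "(\<Sum>g\<in>G. resolvent s g) = 1 / s"
proof -
  let ?S = "\<Sum>g\<in>G. resolvent s g"
  have "(s + \<gamma>) * ?S = (\<Sum>g\<in>G. (if g = id then 1 else 0) + (\<Sum>\<alpha>\<in>Rp. \<kappa> \<alpha> * resolvent s (g \<circ> rfl \<alpha>)))"
    by (simp add: sum_distrib_left resolvent_equation[OF assms])
  also have "\<dots> = 1 + (\<Sum>\<alpha>\<in>Rp. \<kappa> \<alpha> * (\<Sum>g\<in>G. resolvent s (g \<circ> rfl \<alpha>)))"
    by (simp add: sum.distrib finite_G refl_group.id sum.swap[of _ Rp] sum_distrib_left)
  also have "\<dots> = 1 + \<gamma> * ?S"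
    using sum_G_comp_rfl[of _ "\<lambda>_. resolvent s"] by (simp add: \<gamma>_def sum_distrib_right)
  finally show ?thesis using assms by (simp add: field_simps)
qed

text \<open>The inverse of s + \<Sum> \<kappa>(\<alpha>) (1 - \<sigma>_\<alpha>), acting on
  functions through its group-algebra coefficients.\<close>

definition average :: "real \<Rightarrow> (complex^'n \<Rightarrow> complex) \<Rightarrow> complex^'n \<Rightarrow> complex" where
  "average s f x = (\<Sum>g\<in>G. complex_of_real (resolvent s g) * f (complexify g x))"

text \<open>Substituting g composed with the reflection moves the reflection from the argument of f
  to the coefficients. There the resolvent equation applies and leaves only the identity
  term.\<close>

lemma average_equation:
  assumes "0 < s"
  shows "complex_of_real s * average s f x +
    (\<Sum>\<alpha>\<in>Rp. complex_of_real (\<kappa> \<alpha>) * (average s f x - average s f (crfl \<alpha> x))) = f x"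
proof -
  let ?r = "\<lambda>g. complex_of_real (resolvent s g)" and ?f = "\<lambda>g. f (complexify g x)"
  have "(\<Sum>\<alpha>\<in>Rp. complex_of_real (\<kappa> \<alpha>) * average s f (crfl \<alpha> x)) =
      (\<Sum>\<alpha>\<in>Rp. complex_of_real (\<kappa> \<alpha>) * (\<Sum>g\<in>G. ?r g * ?f (g \<circ> rfl \<alpha>)))"
    by (simp add: average_def complexify_comp)
  also have "\<dots> = (\<Sum>\<alpha>\<in>Rp. complex_of_real (\<kappa> \<alpha>) * (\<Sum>g\<in>G. ?r (g \<circ> rfl \<alpha>) * ?f g))"
    using sum_G_comp_rfl[of _ "\<lambda>g h. ?r g * ?f h"] by simp
  also have "\<dots> = (\<Sum>\<alpha>\<in>Rp. \<Sum>g\<in>G. complex_of_real (\<kappa> \<alpha> * resolvent s (g \<circ> rfl \<alpha>)) * ?f g)"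
    by (simp add: sum_distrib_left mult.assoc)
  also have "\<dots> = (\<Sum>g\<in>G. complex_of_real (\<Sum>\<alpha>\<in>Rp. \<kappa> \<alpha> * resolvent s (g \<circ> rfl \<alpha>)) * ?f g)"
    by (subst sum.swap) (simp only: of_real_sum sum_distrib_right)
  also have "\<dots> = (\<Sum>g\<in>G. complex_of_real ((s + \<gamma>) * resolvent s g - (if g = id then 1 else 0)) * ?f g)"
    by (simp only: resolvent_equation[OF assms] add_diff_cancel_left')
  also have "\<dots> = complex_of_real (s + \<gamma>) * average s f x - (\<Sum>g\<in>G. (if g = id then ?f g else 0))"
    by (simp add: average_def sum_subtractf left_diff_distrib sum_distrib_left mult.assoc if_distrib[of complex_of_real]
        if_distrib[of "\<lambda>c. c * _"] cong: if_cong)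
  also have "(\<Sum>g\<in>G. (if g = id then ?f g else 0)) = f x"
    by (simp add: finite_G refl_group.id)
  finally show ?thesis
    by (simp add: right_diff_distrib sum_subtractf sum_distrib_right \<gamma>_def distrib_right)
qed

text \<open>At a maximum over the group the inequality reads \<open>(s + \<gamma>) N \<le> \<gamma> N\<close>.\<close>

lemma maximum_principle:
  assumes s: "0 < s"
    and le: "\<And>g. g \<in> G \<Longrightarrow> (s + \<gamma>) * N g \<le> (\<Sum>\<alpha>\<in>Rp. \<kappa> \<alpha> * N (rfl \<alpha> \<circ> g))"
    and g: "g \<in> G"
  shows "N g \<le> 0"
proof -
  have fin: "finite (N ` G)" and ne: "N ` G \<noteq> {}" using finite_G refl_group.id by auto
  obtain h where h: "h \<in> G" "N h = Max (N ` G)" using Max_in[OF fin ne] by auto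
  have max: "N g \<le> N h" if "g \<in> G" for g using that fin by (simp add: h)
  have "(s + \<gamma>) * N h \<le> (\<Sum>\<alpha>\<in>Rp. \<kappa> \<alpha> * N (rfl \<alpha> \<circ> h))" by (rule le[OF h(1)])
  also have "\<dots> \<le> (\<Sum>\<alpha>\<in>Rp. \<kappa> \<alpha> * N h)"
    using \<kappa>_nonneg by (intro sum_mono mult_left_mono max rfl_comp_in_G h) auto
  also have "\<dots> = \<gamma> * N h" by (simp add: \<gamma>_def sum_distrib_right)
  finally have "s * N h \<le> 0" by (simp add: algebra_simps)
  then have "N h \<le> 0" using s by (simp add: mult_le_0_iff)
  with max[OF g] show ?thesis by simp
qed

text \<open>Only the values of f on the finite orbit of x enter. Taking norms turns the equation
  into the inequality of the maximum principle for their absolute values.\<close>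

lemma average_equation_unique:
  fixes f :: "complex^'n \<Rightarrow> complex"
  assumes s: "0 < s"
    and eq: "\<And>x. complex_of_real s * f x +
      (\<Sum>\<alpha>\<in>Rp. complex_of_real (\<kappa> \<alpha>) * (f x - f (crfl \<alpha> x))) = 0"
  shows "f x = 0"
proof -
  have "(s + \<gamma>) * norm (f x) \<le> (\<Sum>\<alpha>\<in>Rp. \<kappa> \<alpha> * norm (f (crfl \<alpha> x)))" for x
  proof -
    have "complex_of_real (s + \<gamma>) * f x = (\<Sum>\<alpha>\<in>Rp. complex_of_real (\<kappa> \<alpha>) * f (crfl \<alpha> x))"
    proof -
      have "(\<Sum>\<alpha>\<in>Rp. complex_of_real (\<kappa> \<alpha>) * (f x - f (crfl \<alpha> x))) =
          complex_of_real \<gamma> * f x - (\<Sum>\<alpha>\<in>Rp. complex_of_real (\<kappa> \<alpha>) * f (crfl \<alpha> x))"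
        by (simp add: right_diff_distrib sum_subtractf sum_distrib_right \<gamma>_def)
      then have "complex_of_real s * f x + (complex_of_real \<gamma> * f x -
          (\<Sum>\<alpha>\<in>Rp. complex_of_real (\<kappa> \<alpha>) * f (crfl \<alpha> x))) = 0"
        using eq[of x] by simp
      then show ?thesis by (simp add: algebra_simps del: sum_subtractf)
    qed
    then have "norm (complex_of_real (s + \<gamma>) * f x) \<le>
        (\<Sum>\<alpha>\<in>Rp. norm (complex_of_real (\<kappa> \<alpha>) * f (crfl \<alpha> x)))"
      by (simp only: norm_sum)
    also have "\<dots> = (\<Sum>\<alpha>\<in>Rp. \<kappa> \<alpha> * norm (f (crfl \<alpha> x)))"
      using \<kappa>_nonneg by (intro sum.cong) (auto simp: norm_mult)
    finally show ?thesis using s \<gamma>_nonneg by (simp only: norm_mult norm_of_real abs_of_nonneg add_nonneg_nonneg less_imp_le)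
  qed
  then have "norm (f (complexify id x)) \<le> 0"
    by (intro maximum_principle[OF s, where N="\<lambda>g. norm (f (complexify g x))" and g=id])
       (auto simp: complexify_comp[symmetric] refl_group.id simp del: complexify_id)
  then show ?thesis by simp
qed

end

section \<open>Dunkl operators\<close>

lemma has_derivative_line:
  assumes "(f has_derivative D) (at x)"
  shows "((\<lambda>t. f (x + t *\<^sub>R v)) has_vector_derivative D v) (at 0)"
proof -
  have "((\<lambda>t::real. x + t *\<^sub>R v) has_derivative (\<lambda>t. t *\<^sub>R v)) (at 0)"
    by (auto intro!: derivative_eq_intros)
  moreover have "(f has_derivative D) (at (x + 0 *\<^sub>R v))" using assms by simp
  ultimately have "((\<lambda>t. f (x + t *\<^sub>R v)) has_derivative (\<lambda>t. D (t *\<^sub>R v))) (at 0)"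
    by (rule has_derivative_compose)
  then show ?thesis
    by (simp add: has_vector_derivative_def linear_scale[OF has_derivative_linear[OF assms]])
qed

lemma
  assumes "(f has_derivative D) (at x)"
  shows partial_eq_derivative: "partial j f x = D (axis j 1)"
    and dir_deriv_eq_derivative: "dir_deriv v f x = D v"
  using has_derivative_line[OF assms] by (simp_all add: partial_def dir_deriv_def vector_derivative_at)

lemma dunkl_diff_minus:
  assumes "(f has_derivative D) (at x)"
  shows "dunkl_diff (- \<alpha>) f x = - dunkl_diff \<alpha> f x"
  by (simp add: dunkl_diff_def dir_deriv_eq_derivative[OF assms] linear_neg[OF has_derivative_linear[OF assms]] rfl_minus)

lemma dunkl_diff_rfl: "dunkl_diff \<alpha> (\<lambda>x. f (rfl \<beta> x)) x = dunkl_diff (rfl \<beta> \<alpha>) f (rfl \<beta> x)"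
proof -
  have "dir_deriv \<alpha> (\<lambda>x. f (rfl \<beta> x)) x = dir_deriv (rfl \<beta> \<alpha>) f (rfl \<beta> x)"
    by (simp add: dir_deriv_def linear_add[OF linear_rfl] linear_scale[OF linear_rfl])
  then show ?thesis
    by (simp add: dunkl_diff_def inner_rfl_rfl rfl_rfl_conj[of \<beta> \<alpha>])
qed

lemma dunkl_op_add:
  assumes f: "(f has_derivative D) (at x)" and g: "(g has_derivative D') (at x)"
  shows "dunkl_op Rp \<kappa> j (\<lambda>x. f x + g x) x = dunkl_op Rp \<kappa> j f x + dunkl_op Rp \<kappa> j g x"
proof -
  have "dunkl_diff \<alpha> (\<lambda>x. f x + g x) x = dunkl_diff \<alpha> f x + dunkl_diff \<alpha> g x" for \<alpha>
    by (simp add: dunkl_diff_def dir_deriv_eq_derivative[OF f] dir_deriv_eq_derivative[OF g]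
        dir_deriv_eq_derivative[OF has_derivative_add[OF f g]] distrib_left add_divide_distrib diff_divide_distrib)
  then show ?thesis
    by (simp add: dunkl_op_def partial_eq_derivative[OF f] partial_eq_derivative[OF g]
        partial_eq_derivative[OF has_derivative_add[OF f g]] distrib_left sum.distrib)
qed

lemma dunkl_op_cmult:
  assumes f: "(f has_derivative D) (at x)"
  shows "dunkl_op Rp \<kappa> j (\<lambda>x. c * f x) x = c * dunkl_op Rp \<kappa> j f x"
proof -
  have cf: "((\<lambda>x. c * f x) has_derivative (\<lambda>h. c * D h)) (at x)"
    by (rule has_derivative_mult_right[OF f])
  have "dunkl_diff \<alpha> (\<lambda>x. c * f x) x = c * dunkl_diff \<alpha> f x" for \<alpha>
    by (simp add: dunkl_diff_def dir_deriv_eq_derivative[OF f] dir_deriv_eq_derivative[OF cf]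
        right_diff_distrib[symmetric])
  then show ?thesis
    by (simp add: dunkl_op_def partial_eq_derivative[OF f] partial_eq_derivative[OF cf]
        distrib_left sum_distrib_left mult_ac)
qed

lemma dunkl_op_const: "dunkl_op Rp \<kappa> j (\<lambda>_. c) x = 0"
proof -
  have c: "((\<lambda>_. c) has_derivative (\<lambda>_. 0)) (at x)" by simp
  have "dunkl_diff \<alpha> (\<lambda>_. c) x = 0" for \<alpha>
    by (simp add: dunkl_diff_def dir_deriv_eq_derivative[OF c])
  then show ?thesis
    by (simp add: dunkl_op_def partial_eq_derivative[OF c])
qed

lemma dunkl_op_sum:
  assumes "\<And>i. i \<in> I \<Longrightarrow> (f i has_derivative D i) (at x)"
  shows "dunkl_op Rp \<kappa> j (\<lambda>x. \<Sum>i\<in>I. f i x) x = (\<Sum>i\<in>I. dunkl_op Rp \<kappa> j (f i) x)"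
  using assms
proof (induction I rule: infinite_finite_induct)
  case (insert i I)
  then have "((\<lambda>x. \<Sum>i\<in>I. f i x) has_derivative (\<lambda>h. \<Sum>i\<in>I. D i h)) (at x)"
    by (intro has_derivative_sum) auto
  from dunkl_op_add[OF insert.prems[OF insertI1] this] show ?case
    using insert.hyps insert.IH[OF insert.prems[OF insertI2]] by simp
qed (auto simp: dunkl_op_const)

lemma cdot_cvec_add: "cdot (cvec (x + y)) z = cdot (cvec x) z + cdot (cvec y) z"
  and cdot_cvec_scaleR: "cdot (cvec (c *\<^sub>R x)) z = complex_of_real c * cdot (cvec x) z"
  and cdot_cvec_axis: "cdot (cvec (axis j 1)) z = z $ j"
  by (simp_all add: cdot_def cvec_def sum.distrib distrib_right sum_distrib_left mult.assoc axis_def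
      if_distrib[of complex_of_real] if_distrib[of "\<lambda>c. c * _"] cong: if_cong)

lemma bounded_linear_cdot_cvec: "bounded_linear (\<lambda>x. cdot (cvec x) z)"
  by (rule linear_conv_bounded_linear[THEN iffD1], rule linearI)
     (simp_all only: cdot_cvec_add cdot_cvec_scaleR, simp add: scaleR_conv_of_real)

text \<open>Leibniz rule for a linear factor. The difference quotient of
  \<open>cdot (cvec x) y\<close> does not depend on x, and the product splits so that it multiplies
  f at the reflected point. On the hyperplane the reflected point is x, and the ordinary product
  rule gives the same formula.\<close>

lemma dunkl_op_cdot_mult:
  assumes f: "(f has_derivative D) (at x)"
  shows "dunkl_op Rp \<kappa> j (\<lambda>x. cdot (cvec x) y * f x) x =
    cdot (cvec x) y * dunkl_op Rp \<kappa> j f x + y $ j * f x +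
    (\<Sum>\<alpha>\<in>Rp. complex_of_real (\<kappa> \<alpha> * \<alpha> $ j) * (complex_of_real (2 / (\<alpha> \<bullet> \<alpha>)) * cdot (cvec \<alpha>) y * f (rfl \<alpha> x)))"
proof -
  let ?l = "\<lambda>x. cdot (cvec x) y"
  have l: "(?l has_derivative ?l) (at x)"
    by (rule bounded_linear.has_derivative[OF bounded_linear_cdot_cvec has_derivative_ident])
  have lf: "((\<lambda>x. ?l x * f x) has_derivative (\<lambda>h. ?l x * D h + ?l h * f x)) (at x)"
    by (rule has_derivative_mult[OF l f])
  have "dunkl_diff \<alpha> (\<lambda>x. ?l x * f x) x =
      ?l x * dunkl_diff \<alpha> f x + complex_of_real (2 / (\<alpha> \<bullet> \<alpha>)) * ?l \<alpha> * f (rfl \<alpha> x)" for \<alpha>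
  proof (cases "x \<bullet> \<alpha> = 0")
    case True
    then show ?thesis
      by (simp add: dunkl_diff_def dir_deriv_eq_derivative[OF f] dir_deriv_eq_derivative[OF lf] rfl_orthogonal)
         (simp add: algebra_simps add_divide_distrib)
  next
    case False
    have "rfl \<alpha> x = x + (- (2 * (x \<bullet> \<alpha>) / (\<alpha> \<bullet> \<alpha>))) *\<^sub>R \<alpha>" by (simp add: Defs.refl_def)
    then have "?l (rfl \<alpha> x) = ?l x - complex_of_real (2 * (x \<bullet> \<alpha>) / (\<alpha> \<bullet> \<alpha>)) * ?l \<alpha>"
      by (simp only: cdot_cvec_add cdot_cvec_scaleR) simp
    then have "(?l x - ?l (rfl \<alpha> x)) / complex_of_real (x \<bullet> \<alpha>) = complex_of_real (2 / (\<alpha> \<bullet> \<alpha>)) * ?l \<alpha>"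
      using False by simp
    moreover have "(?l x * f x - ?l (rfl \<alpha> x) * f (rfl \<alpha> x)) / complex_of_real (x \<bullet> \<alpha>) =
      ?l x * ((f x - f (rfl \<alpha> x)) / complex_of_real (x \<bullet> \<alpha>)) +
      (?l x - ?l (rfl \<alpha> x)) / complex_of_real (x \<bullet> \<alpha>) * f (rfl \<alpha> x)"
      using False by (simp add: field_simps)
    ultimately show ?thesis
      using False by (simp add: dunkl_diff_def inner_commute[of \<alpha> x])
  qed
  then have "(\<Sum>\<alpha>\<in>Rp. complex_of_real (\<kappa> \<alpha> * \<alpha> $ j) * dunkl_diff \<alpha> (\<lambda>x. ?l x * f x) x) =
     ?l x * (\<Sum>\<alpha>\<in>Rp. complex_of_real (\<kappa> \<alpha> * \<alpha> $ j) * dunkl_diff \<alpha> f x) +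
     (\<Sum>\<alpha>\<in>Rp. complex_of_real (\<kappa> \<alpha> * \<alpha> $ j) * (complex_of_real (2 / (\<alpha> \<bullet> \<alpha>)) * ?l \<alpha> * f (rfl \<alpha> x)))"
    by (simp add: distrib_left sum.distrib sum_distrib_left mult_ac)
  then show ?thesis
    unfolding dunkl_op_def partial_eq_derivative[OF f] partial_eq_derivative[OF lf] cdot_cvec_axis
    by (simp add: algebra_simps)
qed

lemma derivative_eq_sum_partial:
  assumes "(f has_derivative D) (at x)"
  shows "D v = (\<Sum>k\<in>UNIV. complex_of_real (v $ k) * partial k f x)"
proof -
  have lin: "linear D" by (rule has_derivative_linear[OF assms])
  have "v = (\<Sum>k\<in>UNIV. v $ k *\<^sub>R axis k 1)"
    by (simp add: vec_eq_iff axis_def if_distrib[of "\<lambda>c. _ * c"] cong: if_cong)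
  then have "D v = (\<Sum>k\<in>UNIV. v $ k *\<^sub>R D (axis k 1))"
    using linear_sum[OF lin, of "\<lambda>k. v $ k *\<^sub>R axis k 1" UNIV] linear_scale[OF lin] by simp
  then show ?thesis by (simp add: partial_eq_derivative[OF assms] scaleR_conv_of_real)
qed

lemma sum_dunkl_op:
  assumes "(f has_derivative D) (at x)"
  shows "(\<Sum>k\<in>UNIV. complex_of_real (v $ k) * dunkl_op Rp \<kappa> k f x) =
    D v + (\<Sum>\<alpha>\<in>Rp. complex_of_real (\<kappa> \<alpha> * (\<alpha> \<bullet> v)) * dunkl_diff \<alpha> f x)"
proof -
  have "(\<Sum>k\<in>UNIV. complex_of_real (v $ k) * (\<Sum>\<alpha>\<in>Rp. complex_of_real (\<kappa> \<alpha> * \<alpha> $ k) * dunkl_diff \<alpha> f x))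
     = (\<Sum>\<alpha>\<in>Rp. \<Sum>k\<in>UNIV. complex_of_real (\<kappa> \<alpha> * (\<alpha> $ k * v $ k)) * dunkl_diff \<alpha> f x)"
    by (subst sum.swap) (simp add: sum_distrib_left mult_ac)
  also have "\<dots> = (\<Sum>\<alpha>\<in>Rp. complex_of_real (\<kappa> \<alpha> * (\<alpha> \<bullet> v)) * dunkl_diff \<alpha> f x)"
    by (simp only: sum_distrib_right[symmetric] of_real_sum[symmetric] sum_distrib_left[symmetric])
       (simp add: inner_vec_def)
  finally show ?thesis
    by (simp add: dunkl_op_def distrib_left sum.distrib derivative_eq_sum_partial[OF assms])
qed

text \<open>Contracting with x cancels the denominators of the difference quotients; on a root
  hyperplane both sides of the cancelled term are zero. The reflection part of the Euler operator
  thus involves no division.\<close>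

lemma sum_dunkl_op_euler:
  assumes f: "(f has_derivative D) (at x)"
  shows "(\<Sum>k\<in>UNIV. complex_of_real (x $ k) * dunkl_op Rp \<kappa> k f x) =
    D x + (\<Sum>\<alpha>\<in>Rp. complex_of_real (\<kappa> \<alpha>) * (f x - f (rfl \<alpha> x)))"
proof -
  have "complex_of_real (\<kappa> \<alpha> * (\<alpha> \<bullet> x)) * dunkl_diff \<alpha> f x = complex_of_real (\<kappa> \<alpha>) * (f x - f (rfl \<alpha> x))" for \<alpha>
    by (cases "x \<bullet> \<alpha> = 0") (simp_all add: dunkl_diff_def rfl_orthogonal inner_commute[of \<alpha> x])
  then show ?thesis by (simp only: sum_dunkl_op[OF f])
qed

context dunkl_setting
begin

definition dunkl_vec :: "(real^'n \<Rightarrow> complex) \<Rightarrow> real^'n \<Rightarrow> complex^'n" where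
  "dunkl_vec f x = (\<chi> j. dunkl_op Rp \<kappa> j f x)"

text \<open>Each summand is even in the root, because both the difference quotient and the
  coordinate change sign. Together with the invariance of \<kappa>, the sum over \<open>Rp\<close>
  can be reindexed by the reflection, which then acts on the vector index.\<close>

lemma dunkl_vec_rfl:
  assumes \<beta>: "\<beta> \<in> R" and f: "(f has_derivative D) (at (rfl \<beta> x))"
  shows "dunkl_vec (\<lambda>x. f (rfl \<beta> x)) x = crfl \<beta> (dunkl_vec f (rfl \<beta> x))"
proof (subst vec_eq_iff, rule allI)
  fix j
  let ?dd = "\<lambda>\<alpha>. dunkl_diff \<alpha> f (rfl \<beta> x)"
  let ?b = "complex_of_real (2 / (\<beta> \<bullet> \<beta>))"
  have g: "((\<lambda>x. f (rfl \<beta> x)) has_derivative (\<lambda>h. D (rfl \<beta> h))) (at x)"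
    using has_derivative_rfl f by (rule has_derivative_compose)
  have lin: "linear D" by (rule has_derivative_linear[OF f])
  have D: "D (rfl \<beta> (axis j 1)) = D (axis j 1) - ?b * D \<beta> * complex_of_real (\<beta> $ j)"
    by (simp only: Defs.refl_def linear_diff[OF lin] linear_scale[OF lin])
       (simp add: inner_axis' scaleR_conv_of_real[of _ "D \<beta>"])
  define \<psi> where "\<psi> \<alpha> = complex_of_real (\<kappa> \<alpha> * rfl \<beta> \<alpha> $ j) * ?dd \<alpha>" for \<alpha>
  have "(\<Sum>\<alpha>\<in>Rp. complex_of_real (\<kappa> \<alpha> * \<alpha> $ j) * dunkl_diff \<alpha> (\<lambda>x. f (rfl \<beta> x)) x) = (\<Sum>\<alpha>\<in>Rp. \<psi> (rfl \<beta> \<alpha>))"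
    using \<beta> by (intro sum.cong) (auto simp: \<psi>_def dunkl_diff_rfl \<kappa>_rfl)
  also have "\<dots> = (\<Sum>\<alpha>\<in>Rp. \<psi> \<alpha>)"
    using \<beta> by (intro sum_Rp_rfl) (auto simp: \<psi>_def \<kappa>_minus dunkl_diff_minus[OF f] linear_neg[OF linear_rfl])
  also have "\<dots> = (\<Sum>\<alpha>\<in>Rp. complex_of_real (\<kappa> \<alpha> * \<alpha> $ j) * ?dd \<alpha>)
      - ?b * complex_of_real (\<beta> $ j) * (\<Sum>\<alpha>\<in>Rp. complex_of_real (\<kappa> \<alpha> * (\<alpha> \<bullet> \<beta>)) * ?dd \<alpha>)"
    unfolding \<psi>_def by (simp add: Defs.refl_def sum_distrib_left sum_subtractf[symmetric])
      (intro sum.cong HOL.refl, simp add: algebra_simps)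
  finally have S: "(\<Sum>\<alpha>\<in>Rp. complex_of_real (\<kappa> \<alpha> * \<alpha> $ j) * dunkl_diff \<alpha> (\<lambda>x. f (rfl \<beta> x)) x) =
     (\<Sum>\<alpha>\<in>Rp. complex_of_real (\<kappa> \<alpha> * \<alpha> $ j) * ?dd \<alpha>)
      - ?b * complex_of_real (\<beta> $ j) * (\<Sum>\<alpha>\<in>Rp. complex_of_real (\<kappa> \<alpha> * (\<alpha> \<bullet> \<beta>)) * ?dd \<alpha>)" .
  have c: "cdot (dunkl_vec f (rfl \<beta> x)) (cvec \<beta>) =
      D \<beta> + (\<Sum>\<alpha>\<in>Rp. complex_of_real (\<kappa> \<alpha> * (\<alpha> \<bullet> \<beta>)) * ?dd \<alpha>)"
    using sum_dunkl_op[OF f, of \<beta> Rp \<kappa>] by (simp add: cdot_def dunkl_vec_def cvec_def mult.commute)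
  show "dunkl_vec (\<lambda>x. f (rfl \<beta> x)) x $ j = crfl \<beta> (dunkl_vec f (rfl \<beta> x)) $ j"
    unfolding complexify_rfl_nth c
    unfolding dunkl_vec_def vec_lambda_beta dunkl_op_def S partial_eq_derivative[OF g] partial_eq_derivative[OF f] D
    by (simp only: distrib_left distrib_right mult_ac) (simp only: algebra_simps)
qed

section \<open>Homogeneous components of the Dunkl kernel\<close>

text \<open>Expanding the recursion E_(n+1) = average of \<open>cdot x y\<close> times E_n along
  words separates the variables: these are the coefficients in x, while the dependence on y is
  through ordinary monomials.\<close>

fun dunkl_monomial :: "'n list \<Rightarrow> complex^'n \<Rightarrow> complex" where
  "dunkl_monomial [] x = 1"
| "dunkl_monomial (k # w) x = average (real (Suc (length w))) (\<lambda>x. x $ k * dunkl_monomial w x) x"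

definition monomial :: "'n list \<Rightarrow> complex^'n \<Rightarrow> complex" where
  "monomial w y = prod_list (map (\<lambda>k. y $ k) w)"

text \<open>Words instead of multi-indices avoid multinomial coefficients. The price is their number
  \<open>CARD('n) ^ n\<close>, the source of the factor \<open>CARD('n)\<close> in the growth
  rates.\<close>

definition words :: "nat \<Rightarrow> 'n list set" where
  "words n = {w. length w = n}"

definition kernel_part :: "nat \<Rightarrow> complex^'n \<Rightarrow> complex^'n \<Rightarrow> complex" where
  "kernel_part n x y = (\<Sum>w\<in>words n. dunkl_monomial w x * monomial w y)"

lemma card_words: "card (words n) = CARD('n) ^ n"
  using card_lists_length_eq[of "UNIV :: 'n set" n] by (simp add: words_def)

lemma words_0: "words 0 = {[]}"
  by (auto simp: words_def)

lemma sum_words_Suc: "(\<Sum>w\<in>words (Suc n). f w) = (\<Sum>k\<in>UNIV. \<Sum>w\<in>words n. f (k # w))"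
proof -
  have "(\<Sum>w\<in>words (Suc n). f w) = (\<Sum>(k, w)\<in>UNIV \<times> words n. f (k # w))"
    by (rule sum.reindex_bij_witness[where i="\<lambda>(k, w). k # w" and j="\<lambda>w. (hd w, tl w)"])
       (auto simp: words_def length_Suc_conv)
  then show ?thesis by (simp add: sum.cartesian_product)
qed

lemma kernel_part_0 [simp]: "kernel_part 0 x y = 1"
  by (simp add: kernel_part_def words_0 monomial_def)

lemma kernel_part_Suc:
  "kernel_part (Suc n) x y = average (real (Suc n)) (\<lambda>x. cdot x y * kernel_part n x y) x"
proof -
  have "kernel_part (Suc n) x y =
      (\<Sum>k\<in>UNIV. \<Sum>w\<in>words n. average (real (Suc n)) (\<lambda>x. x $ k * dunkl_monomial w x) x * (y $ k * monomial w y))"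
    unfolding kernel_part_def sum_words_Suc
    by (intro sum.cong HOL.refl) (auto simp: words_def monomial_def)
  also have "\<dots> = (\<Sum>k\<in>UNIV. \<Sum>w\<in>words n. \<Sum>g\<in>G. complex_of_real (resolvent (real (Suc n)) g) *
      (complexify g x $ k * dunkl_monomial w (complexify g x) * (y $ k * monomial w y)))"
    by (simp add: average_def sum_distrib_right mult.assoc)
  also have "\<dots> = (\<Sum>g\<in>G. \<Sum>k\<in>UNIV. \<Sum>w\<in>words n. complex_of_real (resolvent (real (Suc n)) g) *
      (complexify g x $ k * dunkl_monomial w (complexify g x) * (y $ k * monomial w y)))"
    by (subst (2) sum.swap, subst sum.swap) (rule HOL.refl)
  also have "\<dots> = average (real (Suc n)) (\<lambda>x. cdot x y * kernel_part n x y) x"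
    unfolding average_def cdot_def kernel_part_def sum_product
    unfolding sum_distrib_left by (intro sum.cong HOL.refl) (simp only: mult_ac)
  finally show ?thesis .
qed

text \<open>The Euler equation in degree n + 1, with the radial derivative replaced by its
  eigenvalue on homogeneous functions. In this algebraic form it determines a function without
  reference to derivatives, so \<open>kernel_part_unique\<close> serves to recognise homogeneous
  parts.\<close>

lemma kernel_part_equation:
  "of_nat (Suc n) * kernel_part (Suc n) x y + (\<Sum>\<alpha>\<in>Rp. complex_of_real (\<kappa> \<alpha>) *
     (kernel_part (Suc n) x y - kernel_part (Suc n) (crfl \<alpha> x) y)) = cdot x y * kernel_part n x y"
  using average_equation[of "real (Suc n)" "\<lambda>x. cdot x y * kernel_part n x y" x]
  by (simp only: kernel_part_Suc[abs_def] of_real_of_nat_eq of_nat_0_less_iff zero_less_Suc)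

lemma kernel_part_unique:
  assumes "\<And>x. of_nat (Suc n) * f x + (\<Sum>\<alpha>\<in>Rp. complex_of_real (\<kappa> \<alpha>) *
     (f x - f (crfl \<alpha> x))) = cdot x y * kernel_part n x y"
  shows "f x = kernel_part (Suc n) x y"
proof -
  have "complex_of_real (real (Suc n)) * (f x - kernel_part (Suc n) x y) + (\<Sum>\<alpha>\<in>Rp. complex_of_real (\<kappa> \<alpha>) *
     ((f x - kernel_part (Suc n) x y) - (f (crfl \<alpha> x) - kernel_part (Suc n) (crfl \<alpha> x) y))) = 0"
    for x
  proof -
    have "(\<Sum>\<alpha>\<in>Rp. complex_of_real (\<kappa> \<alpha>) *
     ((f x - kernel_part (Suc n) x y) - (f (crfl \<alpha> x) - kernel_part (Suc n) (crfl \<alpha> x) y)))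
      = (\<Sum>\<alpha>\<in>Rp. complex_of_real (\<kappa> \<alpha>) * (f x - f (crfl \<alpha> x)))
       - (\<Sum>\<alpha>\<in>Rp. complex_of_real (\<kappa> \<alpha>) *
         (kernel_part (Suc n) x y - kernel_part (Suc n) (crfl \<alpha> x) y))"
      unfolding sum_subtractf[symmetric] by (intro sum.cong HOL.refl) (simp add: algebra_simps)
    then show ?thesis
      using assms[of x] kernel_part_equation[of n x y]
      by (simp only: of_real_of_nat_eq right_diff_distrib) (simp add: algebra_simps del: of_nat_Suc)
  qed
  then show ?thesis
    using average_equation_unique[where f="\<lambda>x. f x - kernel_part (Suc n) x y" and s="real (Suc n)" and x=x]
    by simp
qed

text \<open>The function on the left solves the defining equation of the one on the right:
  conjugation by \<beta> only permutes the reflection terms, and \<open>cdot\<close> is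
  invariant.\<close>

lemma kernel_part_rfl_rfl:
  assumes \<beta>: "\<beta> \<in> R"
  shows "kernel_part n (crfl \<beta> x) (crfl \<beta> y) = kernel_part n x y"
proof (induction n arbitrary: x)
  case (Suc n)
  let ?c = "crfl \<beta>"
  show ?case
  proof (rule kernel_part_unique)
    fix x
    define \<phi> where "\<phi> \<alpha> = complex_of_real (\<kappa> \<alpha>) * (kernel_part (Suc n) (?c x) (?c y) -
        kernel_part (Suc n) (crfl \<alpha> (?c x)) (?c y))" for \<alpha>
    have conj: "?c (crfl \<alpha> x) = complexify (rfl (rfl \<beta> \<alpha>)) (?c x)" for \<alpha>
      by (simp add: complexify_comp fun_eq_iff comp_def) (simp add: rfl_rfl_conj[symmetric])
    have "(\<Sum>\<alpha>\<in>Rp. complex_of_real (\<kappa> \<alpha>) * (kernel_part (Suc n) (?c x) (?c y) -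
        kernel_part (Suc n) (?c (crfl \<alpha> x)) (?c y))) = (\<Sum>\<alpha>\<in>Rp. \<phi> (rfl \<beta> \<alpha>))"
      using \<beta> by (intro sum.cong) (auto simp: \<phi>_def conj \<kappa>_rfl)
    also have "\<dots> = (\<Sum>\<alpha>\<in>Rp. \<phi> \<alpha>)"
      using \<beta> by (intro sum_Rp_rfl) (auto simp: \<phi>_def \<kappa>_minus rfl_minus)
    finally show "of_nat (Suc n) * kernel_part (Suc n) (?c x) (?c y) + (\<Sum>\<alpha>\<in>Rp. complex_of_real (\<kappa> \<alpha>) *
       (kernel_part (Suc n) (?c x) (?c y) - kernel_part (Suc n) (?c (crfl \<alpha> x)) (?c y))) =
       cdot x y * kernel_part n x y"
      using kernel_part_equation[of n "?c x" "?c y"] Suc.IH[of x]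
      by (simp only: \<phi>_def cdot_complexify_rfl complexify_rfl_complexify_rfl)
  qed
qed simp

text \<open>By the previous invariance the recursion is symmetric in the two arguments.\<close>

lemma kernel_part_commute: "kernel_part n x y = kernel_part n y x"
proof (induction n arbitrary: x y)
  case (Suc n)
  have "kernel_part (Suc n) y x = kernel_part (Suc n) x y"
  proof (rule kernel_part_unique)
    fix x
    have "kernel_part (Suc n) y (crfl \<alpha> x) = kernel_part (Suc n) (crfl \<alpha> y) x"
      if "\<alpha> \<in> Rp" for \<alpha>
      using kernel_part_rfl_rfl[of \<alpha> "Suc n" "crfl \<alpha> y" x] that by simp
    then show "of_nat (Suc n) * kernel_part (Suc n) y x + (\<Sum>\<alpha>\<in>Rp. complex_of_real (\<kappa> \<alpha>) *
       (kernel_part (Suc n) y x - kernel_part (Suc n) y (crfl \<alpha> x))) = cdot x y * kernel_part n x y"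
      using kernel_part_equation[of n y x] Suc.IH[of x y] by (simp add: cdot_commute)
  qed
  then show ?case by simp
qed simp

end

section \<open>Convergence and holomorphy of the kernel\<close>

abbreviation imul :: "complex^'n \<Rightarrow> complex^'n" where
  "imul v \<equiv> (\<chi> k. \<i> * v $ k)"

lemma norm_mult_mono:
  fixes a b :: "'a::real_normed_algebra"
  assumes "norm a \<le> A" "norm b \<le> B"
  shows "norm (a * b) \<le> A * B"
  using assms by (intro order.trans[OF norm_mult_ineq] mult_mono order.trans[OF norm_ge_zero assms(1)]) auto

context dunkl_setting
begin

text \<open>The coefficients are nonnegative with sum 1/s and the group preserves norms. Applied
  with s = 1, ..., n this produces the factor 1/n!.\<close>

lemma average_norm_le:
  assumes s: "0 < s" and f: "\<And>x'. norm x' = norm x \<Longrightarrow> norm (f x') \<le> B"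
  shows "norm (average s f x) \<le> B / s"
proof -
  have "norm (average s f x) \<le> (\<Sum>g\<in>G. norm (complex_of_real (resolvent s g) * f (complexify g x)))"
    unfolding average_def by (rule norm_sum)
  also have "\<dots> \<le> (\<Sum>g\<in>G. resolvent s g * B)"
    using resolvent_nonneg[OF s]
    by (intro sum_mono) (auto simp: norm_mult norm_complexify refl_group_norm intro!: mult_left_mono f)
  also have "\<dots> = B / s" by (simp add: sum_distrib_right[symmetric] sum_resolvent[OF s])
  finally show ?thesis .
qed

lemma average_has_derivative:
  assumes "\<And>x. (f has_derivative D x) (at x)"
  shows "(average s f has_derivative
    (\<lambda>h. \<Sum>g\<in>G. complex_of_real (resolvent s g) * D (complexify g x) (complexify g h))) (at x)"
proof -
  have "((\<lambda>x. f (complexify g x)) has_derivative (\<lambda>h. D (complexify g x) (complexify g h))) (at x)"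
    if "g \<in> G" for g
  proof -
    have "(complexify g has_derivative complexify g) (at x)"
      using linear_complexify[OF refl_group_linear[OF that]]
      by (intro bounded_linear_imp_has_derivative) (simp add: linear_conv_bounded_linear)
    then show ?thesis by (rule has_derivative_compose) (rule assms)
  qed
  then show ?thesis
    unfolding average_def[abs_def] by (intro has_derivative_sum has_derivative_mult_right)
qed

lemma dunkl_monomial_norm_le: "norm x \<le> \<rho> \<Longrightarrow> norm (dunkl_monomial w x) \<le> \<rho> ^ length w / fact (length w)"
proof (induction w arbitrary: x)
  case (Cons k w)
  have "norm (average (real (Suc (length w))) (\<lambda>x. x $ k * dunkl_monomial w x) x) \<le>
      (\<rho> * (\<rho> ^ length w / fact (length w))) / real (Suc (length w))"
  proof (rule average_norm_le)
    fix x' :: "complex^'n" assume "norm x' = norm x"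
    then have x': "norm x' \<le> \<rho>" using Cons.prems by simp
    show "norm (x' $ k * dunkl_monomial w x') \<le> \<rho> * (\<rho> ^ length w / fact (length w))"
      by (intro norm_mult_mono Cons.IH[OF x'] order.trans[OF Finite_Cartesian_Product.norm_nth_le x'])
  qed simp
  then show ?case by (simp add: field_simps)
qed simp

text \<open>The bound has the exponent \<open>length w\<close> where \<open>length w - 1\<close>
  would be sharp. Taking \<rho> at least 1 pays for this and keeps truncated subtraction out of the
  induction.\<close>

lemma dunkl_monomial_derivative:
  "\<exists>D. (\<forall>x. (dunkl_monomial w has_derivative D x) (at x)) \<and> (\<forall>x h. D x (imul h) = \<i> * D x h) \<and>
    (\<forall>(\<rho>::real) x h. 1 \<le> \<rho> \<longrightarrow> norm x \<le> \<rho> \<longrightarrow>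
      norm (D x h) \<le> length w * \<rho> ^ length w / fact (length w) * norm h)"
proof (induction w)
  case Nil
  show ?case by (intro exI[of _ "\<lambda>_ _. 0"]) (auto simp: fun_eq_iff intro!: derivative_eq_intros)
next
  case (Cons k w)
  then obtain D where D: "\<And>x. (dunkl_monomial w has_derivative D x) (at x)"
    "\<And>x h. D x (imul h) = \<i> * D x h"
    "\<And>(\<rho>::real) x h. 1 \<le> \<rho> \<Longrightarrow> norm x \<le> \<rho> \<Longrightarrow> norm (D x h) \<le> length w * \<rho> ^ length w / fact (length w) * norm h"
    by blast
  let ?s = "real (Suc (length w))"
  let ?f = "\<lambda>x. x $ k * dunkl_monomial w x"
  define D1 where "D1 x h = x $ k * D x h + h $ k * dunkl_monomial w x" for x h
  define D2 where "D2 x h = (\<Sum>g\<in>G. complex_of_real (resolvent ?s g) * D1 (complexify g x) (complexify g h))" for x h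
  have D1: "(?f has_derivative D1 x) (at x)" for x
  proof -
    have "((\<lambda>x. x $ k) has_derivative (\<lambda>h. h $ k)) (at x)"
      by (rule bounded_linear.has_derivative[OF bounded_linear_vec_nth has_derivative_ident])
    from has_derivative_mult[OF this D(1)] show ?thesis by (simp add: D1_def[abs_def])
  qed
  have "(dunkl_monomial (k # w) has_derivative D2 x) (at x)" for x
  proof -
    have "dunkl_monomial (k # w) = average ?s ?f" by (rule ext) (rule dunkl_monomial.simps)
    then show ?thesis using average_has_derivative[of ?f D1, OF D1] by (simp only: D2_def[abs_def])
  qed
  moreover have "D2 x (imul h) = \<i> * D2 x h" for x h
  proof -
    have "D2 x (imul h) = (\<Sum>g\<in>G. complex_of_real (resolvent ?s g) * (\<i> * D1 (complexify g x) (complexify g h)))"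
      unfolding D2_def
      by (intro sum.cong HOL.refl) (simp add: complexify_i refl_group_linear D1_def D(2) algebra_simps)
    then show ?thesis by (simp add: D2_def sum_distrib_left mult_ac)
  qed
  moreover have "norm (D2 x h) \<le> length (k # w) * \<rho> ^ length (k # w) / fact (length (k # w)) * norm h"
    if \<rho>: "1 \<le> \<rho>" and x: "norm x \<le> \<rho>" for \<rho> :: real and x h
  proof -
    let ?n = "length w"
    let ?B = "real (Suc ?n) * \<rho> ^ Suc ?n / fact ?n * norm h"
    have D1_le: "norm (D1 x' h') \<le> ?B" if x': "norm x' \<le> \<rho>" and h': "norm h' = norm h" for x' h'
    proof -
      have "norm (D1 x' h') \<le> \<rho> * (?n * \<rho> ^ ?n / fact ?n * norm h) + norm h * (\<rho> ^ ?n / fact ?n)"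
        unfolding D1_def
        using D(3)[OF \<rho> x', of h'] Finite_Cartesian_Product.norm_nth_le[of h' k] unfolding h'
        by (intro order.trans[OF norm_triangle_ineq] add_mono norm_mult_mono dunkl_monomial_norm_le[OF x']
            order.trans[OF Finite_Cartesian_Product.norm_nth_le x'])
      also have "norm h * (\<rho> ^ ?n / fact ?n) \<le> norm h * (\<rho> ^ Suc ?n / fact ?n)"
        using \<rho> by (intro mult_left_mono divide_right_mono power_increasing) auto
      finally show ?thesis by (simp add: field_simps)
    qed
    have "norm (D2 x h) \<le> (\<Sum>g\<in>G. resolvent ?s g * ?B)"
      unfolding D2_def
    proof (rule order.trans[OF norm_sum], rule sum_mono, rule norm_mult_mono)
      fix g assume g: "g \<in> G"
      show "norm (complex_of_real (resolvent ?s g)) \<le> resolvent ?s g"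
        using resolvent_nonneg[of ?s g] by simp
      show "norm (D1 (complexify g x) (complexify g h)) \<le> ?B"
        using x by (intro D1_le) (simp_all add: norm_complexify refl_group_norm[OF g])
    qed
    also have "\<dots> = ?B / ?s"
      using sum_resolvent[of ?s] by (simp only: sum_distrib_right[symmetric] of_nat_0_less_iff zero_less_Suc) simp
    also have "\<dots> = length (k # w) * \<rho> ^ length (k # w) / fact (length (k # w)) * norm h"
      by (simp add: field_simps)
    finally show ?thesis .
  qed
  ultimately show ?case by blast
qed

lemma monomial_norm_le: "norm y \<le> \<rho> \<Longrightarrow> norm (monomial w y) \<le> \<rho> ^ length w"
proof (induction w)
  case (Cons k w)
  have "norm (y $ k) * norm (monomial w y) \<le> \<rho> * \<rho> ^ length w"
    by (intro mult_mono Cons order.trans[OF norm_ge_zero Cons.prems]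
        order.trans[OF Finite_Cartesian_Product.norm_nth_le Cons.prems]) simp
  then show ?case by (simp add: monomial_def norm_mult)
qed (simp add: monomial_def)

lemma monomial_derivative:
  "\<exists>D. (\<forall>x. (monomial w has_derivative D x) (at x)) \<and> (\<forall>x h. D x (imul h) = \<i> * D x h) \<and>
    (\<forall>(\<rho>::real) x h. 1 \<le> \<rho> \<longrightarrow> norm x \<le> \<rho> \<longrightarrow> norm (D x h) \<le> length w * \<rho> ^ length w * norm h)"
proof (induction w)
  case Nil
  show ?case by (intro exI[of _ "\<lambda>_ _. 0"]) (auto simp: monomial_def[abs_def])
next
  case (Cons k w)
  then obtain D where D: "\<And>x. (monomial w has_derivative D x) (at x)"
    "\<And>x h. D x (imul h) = \<i> * D x h"
    "\<And>(\<rho>::real) x h. 1 \<le> \<rho> \<Longrightarrow> norm x \<le> \<rho> \<Longrightarrow> norm (D x h) \<le> length w * \<rho> ^ length w * norm h"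
    by blast
  define D1 where "D1 x h = x $ k * D x h + h $ k * monomial w x" for x h
  have "((\<lambda>x. x $ k * monomial w x) has_derivative D1 x) (at x)" for x
  proof -
    have "((\<lambda>x. x $ k) has_derivative (\<lambda>h. h $ k)) (at x)"
      by (rule bounded_linear.has_derivative[OF bounded_linear_vec_nth has_derivative_ident])
    from has_derivative_mult[OF this D(1)] show ?thesis by (simp add: D1_def[abs_def])
  qed
  then have "(monomial (k # w) has_derivative D1 x) (at x)" for x
    by (simp add: monomial_def[abs_def])
  moreover have "D1 x (imul h) = \<i> * D1 x h" for x h
    by (simp add: D1_def D(2) algebra_simps)
  moreover have "norm (D1 x h) \<le> length (k # w) * \<rho> ^ length (k # w) * norm h"
    if \<rho>: "1 \<le> \<rho>" and x: "norm x \<le> \<rho>" for \<rho> :: real and x h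
  proof -
    let ?n = "length w"
    have "norm (D1 x h) \<le> \<rho> * (?n * \<rho> ^ ?n * norm h) + norm h * \<rho> ^ ?n"
      unfolding D1_def
      by (intro order.trans[OF norm_triangle_ineq] add_mono norm_mult_mono monomial_norm_le[OF x] D(3)[OF \<rho> x]
          order.trans[OF Finite_Cartesian_Product.norm_nth_le x] Finite_Cartesian_Product.norm_nth_le)
    also have "norm h * \<rho> ^ ?n \<le> norm h * \<rho> ^ Suc ?n"
      using \<rho> by (intro mult_left_mono power_increasing) auto
    finally show ?thesis by (simp add: algebra_simps)
  qed
  ultimately show ?case by blast
qed

text \<open>In the constant, 2 comes from the two terms of the product rule,
  \<open>\<rho>\<^sup>2\<close> from bounding both arguments by the norm of the pair, and
  \<open>CARD('n) ^ n\<close> from the number of words.\<close>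

lemma kernel_part_derivative:
  "\<exists>D. (\<forall>p. ((\<lambda>q. kernel_part n (fst q) (snd q)) has_derivative D p) (at p)) \<and>
    (\<forall>p h. D p (imul2 h) = \<i> * D p h) \<and>
    (\<forall>(\<rho>::real) p h. 1 \<le> \<rho> \<longrightarrow> norm p \<le> \<rho> \<longrightarrow> norm (D p h) \<le> 2 * real n * (CARD('n) * \<rho>\<^sup>2) ^ n / fact n * norm h)"
proof -
  have "\<forall>w. \<exists>D. (\<forall>x. (dunkl_monomial w has_derivative D x) (at x)) \<and> (\<forall>x h. D x (imul h) = \<i> * D x h) \<and>
    (\<forall>(\<rho>::real) x h. 1 \<le> \<rho> \<longrightarrow> norm x \<le> \<rho> \<longrightarrow>
      norm (D x h) \<le> length w * \<rho> ^ length w / fact (length w) * norm h)"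
    using dunkl_monomial_derivative by blast
  from choice[OF this] obtain DU where DU: "\<And>w x. (dunkl_monomial w has_derivative DU w x) (at x)"
    "\<And>w x h. DU w x (imul h) = \<i> * DU w x h"
    "\<And>w (\<rho>::real) x h. 1 \<le> \<rho> \<Longrightarrow> norm x \<le> \<rho> \<Longrightarrow>
      norm (DU w x h) \<le> length w * \<rho> ^ length w / fact (length w) * norm h"
    by blast
  have "\<forall>w. \<exists>D. (\<forall>x. (monomial w has_derivative D x) (at x)) \<and> (\<forall>x h. D x (imul h) = \<i> * D x h) \<and>
    (\<forall>(\<rho>::real) x h. 1 \<le> \<rho> \<longrightarrow> norm x \<le> \<rho> \<longrightarrow> norm (D x h) \<le> length w * \<rho> ^ length w * norm h)"
    using monomial_derivative by blast
  from choice[OF this] obtain DM where DM: "\<And>w x. (monomial w has_derivative DM w x) (at x)"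
    "\<And>w x h. DM w x (imul h) = \<i> * DM w x h"
    "\<And>w (\<rho>::real) x h. 1 \<le> \<rho> \<Longrightarrow> norm x \<le> \<rho> \<Longrightarrow> norm (DM w x h) \<le> length w * \<rho> ^ length w * norm h"
    by blast
  define Dw where "Dw w p h = dunkl_monomial w (fst p) * DM w (snd p) (snd h)
      + DU w (fst p) (fst h) * monomial w (snd p)" for w and p h :: "(complex^'n) \<times> (complex^'n)"
  define D where "D p h = (\<Sum>w\<in>words n. Dw w p h)" for p h
  have "((\<lambda>q. dunkl_monomial w (fst q) * monomial w (snd q)) has_derivative Dw w p) (at p)" for w p
  proof -
    have "((\<lambda>q. dunkl_monomial w (fst q)) has_derivative (\<lambda>h. DU w (fst p) (fst h))) (at p)"
      by (rule has_derivative_compose[OF _ DU(1)]) (rule has_derivative_fst[OF has_derivative_ident])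
    moreover have "((\<lambda>q. monomial w (snd q)) has_derivative (\<lambda>h. DM w (snd p) (snd h))) (at p)"
      by (rule has_derivative_compose[OF _ DM(1)]) (rule has_derivative_snd[OF has_derivative_ident])
    ultimately show ?thesis unfolding Dw_def[abs_def] by (rule has_derivative_mult)
  qed
  then have deriv: "((\<lambda>q. kernel_part n (fst q) (snd q)) has_derivative D p) (at p)" for p
    unfolding kernel_part_def D_def[abs_def] by (intro has_derivative_sum)
  have clin: "D p (imul2 h) = \<i> * D p h" for p h
    by (simp add: D_def Dw_def imul2_def DU(2) DM(2) sum_distrib_left distrib_left mult_ac)
  have bound: "norm (D p h) \<le> 2 * real n * (CARD('n) * \<rho>\<^sup>2) ^ n / fact n * norm h"
    if \<rho>: "1 \<le> \<rho>" and p: "norm p \<le> \<rho>" for \<rho> :: real and p h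
  proof -
    have p1: "norm (fst p) \<le> \<rho>" and p2: "norm (snd p) \<le> \<rho>"
      using norm_fst_le[of "fst p" "snd p"] norm_snd_le[of "snd p" "fst p"] p by auto
    have h: "norm (fst h) \<le> norm h" "norm (snd h) \<le> norm h"
      using norm_fst_le[of "fst h" "snd h"] norm_snd_le[of "snd h" "fst h"] by auto
    have Dw_le: "norm (Dw w p h) \<le> 2 * real n * (\<rho>\<^sup>2) ^ n / fact n * norm h" if w: "w \<in> words n" for w
    proof -
      have len: "length w = n" using w by (simp add: words_def)
      have 1: "norm (DM w (snd p) (snd h)) \<le> n * \<rho> ^ n * norm h"
        using DM(3)[OF \<rho> p2, of w "snd h"] mult_left_mono[OF h(2), of "n * \<rho> ^ n"] \<rho> len by simp
      have 2: "norm (DU w (fst p) (fst h)) \<le> n * \<rho> ^ n / fact n * norm h"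
        using DU(3)[OF \<rho> p1, of w "fst h"] mult_left_mono[OF h(1), of "n * \<rho> ^ n / fact n"] \<rho> len by simp
      have "norm (Dw w p h) \<le> (\<rho> ^ n / fact n) * (n * \<rho> ^ n * norm h) + (n * \<rho> ^ n / fact n * norm h) * \<rho> ^ n"
        unfolding Dw_def
        using dunkl_monomial_norm_le[OF p1, of w] monomial_norm_le[OF p2, of w] unfolding len
        by (intro order.trans[OF norm_triangle_ineq] add_mono norm_mult_mono 1 2)
      also have "\<dots> = 2 * real n * (\<rho>\<^sup>2) ^ n / fact n * norm h"
        by (simp add: power2_eq_square power_mult_distrib)
      finally show ?thesis .
    qed
    have "norm (D p h) \<le> (\<Sum>w\<in>words n. 2 * real n * (\<rho>\<^sup>2) ^ n / fact n * norm h)"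
      unfolding D_def by (intro order.trans[OF norm_sum] sum_mono Dw_le)
    also have "\<dots> = 2 * real n * (CARD('n) * \<rho>\<^sup>2) ^ n / fact n * norm h"
      by (simp add: card_words power_mult_distrib)
    finally show ?thesis .
  qed
  show ?thesis
    by (intro exI[of _ D] conjI allI impI, rule deriv, rule clin, rule bound)
qed

lemma kernel_part_norm_le:
  "norm (kernel_part n x y) \<le> (CARD('n) * norm x * norm y) ^ n /\<^sub>R fact n"
proof -
  have "norm (kernel_part n x y) \<le> (\<Sum>w\<in>words n. norm x ^ n / fact n * norm y ^ n)"
    unfolding kernel_part_def
  proof (rule order.trans[OF norm_sum], rule sum_mono)
    fix w assume "w \<in> words n"
    then have len: "length w = n" by (simp add: words_def)
    show "norm (dunkl_monomial w x * monomial w y) \<le> norm x ^ n / fact n * norm y ^ n"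
      using dunkl_monomial_norm_le[of x "norm x" w] monomial_norm_le[of y "norm y" w] unfolding len
      by (intro norm_mult_mono) auto
  qed
  then show ?thesis by (simp add: card_words power_mult_distrib field_simps)
qed

definition kernel :: "complex^'n \<Rightarrow> complex^'n \<Rightarrow> complex" where
  "kernel x y = (\<Sum>n. kernel_part n x y)"

lemma summable_kernel: "summable (\<lambda>n. kernel_part n x y)"
  by (rule summable_comparison_test'[OF summable_exp_generic[of "CARD('n) * norm x * norm y"]])
     (use kernel_part_norm_le in blast)

lemma kernel_commute: "kernel x y = kernel y x"
  unfolding kernel_def by (simp add: kernel_part_commute[of _ x])

lemma kernel_0: "kernel 0 y = 1"
proof -
  have "kernel 0 y = (\<Sum>n\<in>{0}. kernel_part n 0 y)"
    unfolding kernel_def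
  proof (rule suminf_finite)
    fix n :: nat assume "n \<notin> {0}"
    then show "kernel_part n 0 y = 0" using kernel_part_norm_le[of n 0 y] by (simp add: power_0_left)
  qed simp
  then show ?thesis by simp
qed

text \<open>The derivatives of the parts are exported along with their sum, so that complex
  linearity and the Dunkl operators can be passed through the series term by term.\<close>

lemma kernel_derivative:
  "\<exists>D. (\<forall>n p. ((\<lambda>q. kernel_part n (fst q) (snd q)) has_derivative D n p) (at p)) \<and>
    (\<forall>n p h. D n p (imul2 h) = \<i> * D n p h) \<and> (\<forall>p h. summable (\<lambda>n. D n p h)) \<and>
    (\<forall>p. ((\<lambda>q. kernel (fst q) (snd q)) has_derivative (\<lambda>h. \<Sum>n. D n p h)) (at p))"
proof -
  have "\<forall>n. \<exists>D. (\<forall>p. ((\<lambda>q. kernel_part n (fst q) (snd q)) has_derivative D p) (at p)) \<and>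
    (\<forall>p h. D p (imul2 h) = \<i> * D p h) \<and>
    (\<forall>(\<rho>::real) p h. 1 \<le> \<rho> \<longrightarrow> norm p \<le> \<rho> \<longrightarrow> norm (D p h) \<le> 2 * real n * (CARD('n) * \<rho>\<^sup>2) ^ n / fact n * norm h)"
    using kernel_part_derivative by blast
  from choice[OF this] obtain D where D: "\<And>n p. ((\<lambda>q. kernel_part n (fst q) (snd q)) has_derivative D n p) (at p)"
    "\<And>n p h. D n p (imul2 h) = \<i> * D n p h"
    "\<And>n (\<rho>::real) p h. 1 \<le> \<rho> \<Longrightarrow> norm p \<le> \<rho> \<Longrightarrow> norm (D n p h) \<le> 2 * real n * (CARD('n) * \<rho>\<^sup>2) ^ n / fact n * norm h"
    by blast
  define M where "M \<rho> n = 2 * real n * (CARD('n) * \<rho>\<^sup>2) ^ n / fact n" for \<rho> :: real and n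
  have M: "summable (M \<rho>)" for \<rho>
  proof -
    have "M \<rho> (Suc n) = 2 * (CARD('n) * \<rho>\<^sup>2) * ((CARD('n) * \<rho>\<^sup>2) ^ n /\<^sub>R fact n)" for n
      by (simp add: M_def field_simps del: of_nat_Suc)
    then have "summable (\<lambda>n. M \<rho> (Suc n))"
      by (simp only:) (rule summable_mult[OF summable_exp_generic])
    then show ?thesis using summable_Suc_iff[of "M \<rho>"] by blast
  qed
  have summ: "summable (\<lambda>n. D n p h)" for p h
  proof (rule summable_comparison_test'[OF summable_mult2[OF M[of "norm p + 1"], of "norm h"]])
    show "norm (D n p h) \<le> M (norm p + 1) n * norm h" for n
      unfolding M_def by (rule D(3)) auto
  qed
  have deriv: "((\<lambda>q. kernel (fst q) (snd q)) has_derivative (\<lambda>h. \<Sum>n. D n p h)) (at p)" for p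
    unfolding kernel_def
  proof (rule has_derivative_suminf[where S="ball p 1" and M="M (norm p + 1)"])
    show "norm (D n q h) \<le> M (norm p + 1) n * norm h" if "q \<in> ball p 1" for n q h
    proof -
      have "norm q \<le> norm p + 1"
        using that norm_triangle_sub[of q p] by (simp add: dist_norm norm_minus_commute)
      then show ?thesis unfolding M_def by (intro D(3)) auto
    qed
  qed (simp_all add: D(1) M summable_kernel)
  show ?thesis
    by (intro exI[of _ D] conjI allI, rule D(1), rule D(2), rule summ, rule deriv)
qed

lemma holo2_kernel: "holo2 kernel"
proof -
  obtain D where D: "\<And>n p h. D n p (imul2 h) = \<i> * D n p h" "\<And>p h. summable (\<lambda>n. D n p h)"
    "\<And>p. ((\<lambda>q. kernel (fst q) (snd q)) has_derivative (\<lambda>h. \<Sum>n. D n p h)) (at p)"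
    using kernel_derivative by blast
  have "(\<Sum>n. D n p (imul2 v)) = \<i> * (\<Sum>n. D n p v)" for p v
    by (simp only: D(1) suminf_mult[OF D(2)])
  then show ?thesis unfolding holo2_def using D(3) by blast
qed

end

context dunkl_setting
begin

section \<open>The eigenvalue equation\<close>

lemma bounded_linear_cvec: "bounded_linear cvec"
  by (rule linear_conv_bounded_linear[THEN iffD1], rule linearI) (simp_all add: cvec_def vec_eq_iff scaleR_conv_of_real[where 'a=complex])

lemma has_derivative_cvec_pair: "((\<lambda>x. (cvec x, y)) has_derivative (\<lambda>h. (cvec h, 0))) (at x)"
  by (intro has_derivative_Pair bounded_linear_imp_has_derivative bounded_linear_cvec has_derivative_const)

lemma kernel_part_cvec_derivative: "\<exists>D. ((\<lambda>x. kernel_part n (cvec x) y) has_derivative D) (at x)"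
proof -
  obtain D where D: "\<And>p. ((\<lambda>q. kernel_part n (fst q) (snd q)) has_derivative D p) (at p)"
    using kernel_part_derivative[of n] by blast
  from has_derivative_compose[OF has_derivative_cvec_pair[of y x] D] show ?thesis by auto
qed

text \<open>All components are treated together because reflections mix them. They do so by
  isometries of the vector index, so the norm of the error vector W still obeys the maximum
  principle.\<close>

lemma dunkl_vec_kernel_part_Suc:
  "dunkl_vec (\<lambda>x. kernel_part (Suc n) (cvec x) y) x = (\<chi> j. y $ j * kernel_part n (cvec x) y)"
proof (induction n arbitrary: x rule: nat_less_induct)
  case (1 n)
  define F where "F x = kernel_part (Suc n) (cvec x) y" for x
  define F0 where "F0 x = kernel_part n (cvec x) y" for x
  have F_deriv: "\<exists>D. (F has_derivative D) (at x)" for x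
    using kernel_part_cvec_derivative[of "Suc n" y x] by (simp add: F_def[abs_def])
  have F0_deriv: "\<exists>D. (F0 has_derivative D) (at x)" for x
    using kernel_part_cvec_derivative[of n y x] by (simp add: F0_def[abs_def])
  have F_eq: "(\<lambda>x. of_nat (Suc n) * F x + (\<Sum>\<alpha>\<in>Rp. complex_of_real (\<kappa> \<alpha>) * (F x - F (rfl \<alpha> x)))) =
      (\<lambda>x. cdot (cvec x) y * F0 x)"
    using kernel_part_equation[of n "cvec _" y]
    by (simp add: F_def F0_def complexify_cvec fun_eq_iff del: of_nat_Suc)
  \<comment> \<open>By induction T_j F0 is y_j times the part of one degree less, and multiplying
    that part by \<open>cdot (cvec x) y\<close> gives the Euler operator applied to F0. For n = 0
    the function F0 is constant and both sides vanish.\<close>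
  have F0_eq: "cdot (cvec x) y * dunkl_op Rp \<kappa> j F0 x =
      y $ j * (of_nat n * F0 x + (\<Sum>\<alpha>\<in>Rp. complex_of_real (\<kappa> \<alpha>) * (F0 x - F0 (rfl \<alpha> x))))" for x j
  proof (cases n)
    case 0
    then show ?thesis by (simp add: F0_def[abs_def] dunkl_op_const)
  next
    case (Suc m)
    then have "dunkl_vec F0 x = (\<chi> j. y $ j * kernel_part m (cvec x) y)"
      using 1 by (auto simp: F0_def[abs_def])
    then have "dunkl_op Rp \<kappa> j F0 x = y $ j * kernel_part m (cvec x) y"
      by (simp add: dunkl_vec_def vec_eq_iff)
    then show ?thesis
      using kernel_part_equation[of m "cvec x" y] by (simp add: F0_def Suc complexify_cvec mult_ac del: of_nat_Suc)
  qed
  define W where "W x = (\<chi> j. dunkl_op Rp \<kappa> j F x - y $ j * F0 x)" for x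
  have W_eq: "of_nat (Suc n) * W x $ j + (\<Sum>\<alpha>\<in>Rp. complex_of_real (\<kappa> \<alpha>) *
      (W x $ j - crfl \<alpha> (W (rfl \<alpha> x)) $ j)) = 0" for x j
  proof -
    obtain DF where DF: "\<And>x. (F has_derivative DF x) (at x)" using choice[of "\<lambda>x D. (F has_derivative D) (at x)"] F_deriv by blast
    obtain D0 where D0: "(F0 has_derivative D0) (at x)" using F0_deriv by blast
    have Fr: "((\<lambda>x. F (rfl \<alpha> x)) has_derivative (\<lambda>h. DF (rfl \<alpha> x) (rfl \<alpha> h))) (at x)" for \<alpha>
      using has_derivative_rfl DF by (rule has_derivative_compose)
    have Frm: "((\<lambda>x. F x - F (rfl \<alpha> x)) has_derivative (\<lambda>h. DF x h - DF (rfl \<alpha> x) (rfl \<alpha> h))) (at x)" for \<alpha>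
      by (rule has_derivative_diff[OF DF Fr])
    let ?T = "\<lambda>f. dunkl_op Rp \<kappa> j f x"
    have T_diff: "?T (\<lambda>x. F x - F (rfl \<alpha> x)) = ?T F - ?T (\<lambda>x. F (rfl \<alpha> x))" for \<alpha>
      using dunkl_op_add[OF DF[of x] has_derivative_mult_right[OF Fr[of \<alpha>], of "-1"], of Rp \<kappa> j]
        dunkl_op_cmult[OF Fr[of \<alpha>], of Rp \<kappa> j "-1"]
      by simp
    have "?T (\<lambda>x. of_nat (Suc n) * F x + (\<Sum>\<alpha>\<in>Rp. complex_of_real (\<kappa> \<alpha>) * (F x - F (rfl \<alpha> x)))) =
        ?T (\<lambda>x. of_nat (Suc n) * F x) + ?T (\<lambda>x. \<Sum>\<alpha>\<in>Rp. complex_of_real (\<kappa> \<alpha>) * (F x - F (rfl \<alpha> x)))"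
      by (rule dunkl_op_add[OF has_derivative_mult_right[OF DF] has_derivative_sum[OF has_derivative_mult_right[OF Frm]]])
    also have "?T (\<lambda>x. of_nat (Suc n) * F x) = of_nat (Suc n) * ?T F"
      by (rule dunkl_op_cmult[OF DF])
    also have "?T (\<lambda>x. \<Sum>\<alpha>\<in>Rp. complex_of_real (\<kappa> \<alpha>) * (F x - F (rfl \<alpha> x))) =
        (\<Sum>\<alpha>\<in>Rp. complex_of_real (\<kappa> \<alpha>) * (?T F - ?T (\<lambda>x. F (rfl \<alpha> x))))"
      by (simp only: dunkl_op_sum[OF has_derivative_mult_right[OF Frm]] dunkl_op_cmult[OF Frm] T_diff)
    also have "\<dots> = (\<Sum>\<alpha>\<in>Rp. complex_of_real (\<kappa> \<alpha>) * (?T F - crfl \<alpha> (dunkl_vec F (rfl \<alpha> x)) $ j))"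
    proof (rule sum.cong)
      fix \<alpha> assume "\<alpha> \<in> Rp"
      then have "?T (\<lambda>x. F (rfl \<alpha> x)) = crfl \<alpha> (dunkl_vec F (rfl \<alpha> x)) $ j"
        using dunkl_vec_rfl[OF _ DF, of \<alpha> x] by (simp add: dunkl_vec_def vec_eq_iff)
      then show "complex_of_real (\<kappa> \<alpha>) * (?T F - ?T (\<lambda>x. F (rfl \<alpha> x))) =
          complex_of_real (\<kappa> \<alpha>) * (?T F - crfl \<alpha> (dunkl_vec F (rfl \<alpha> x)) $ j)" by simp
    qed simp
    finally have lhs: "?T (\<lambda>x. cdot (cvec x) y * F0 x) = of_nat (Suc n) * ?T F +
        (\<Sum>\<alpha>\<in>Rp. complex_of_real (\<kappa> \<alpha>) * (?T F - crfl \<alpha> (dunkl_vec F (rfl \<alpha> x)) $ j))"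
      by (simp only: F_eq)
    have "?T (\<lambda>x. cdot (cvec x) y * F0 x) =
        y $ j * (of_nat n * F0 x + (\<Sum>\<alpha>\<in>Rp. complex_of_real (\<kappa> \<alpha>) * (F0 x - F0 (rfl \<alpha> x)))) + y $ j * F0 x +
        (\<Sum>\<alpha>\<in>Rp. complex_of_real (\<kappa> \<alpha> * \<alpha> $ j) *
          (complex_of_real (2 / (\<alpha> \<bullet> \<alpha>)) * cdot (cvec \<alpha>) y * F0 (rfl \<alpha> x)))"
      by (simp only: dunkl_op_cdot_mult[OF D0] F0_eq)
    also have "\<dots> = of_nat (Suc n) * (y $ j * F0 x) +
       ((\<Sum>\<alpha>\<in>Rp. y $ j * (complex_of_real (\<kappa> \<alpha>) * (F0 x - F0 (rfl \<alpha> x)))) +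
       (\<Sum>\<alpha>\<in>Rp. complex_of_real (\<kappa> \<alpha> * \<alpha> $ j) *
          (complex_of_real (2 / (\<alpha> \<bullet> \<alpha>)) * cdot (cvec \<alpha>) y * F0 (rfl \<alpha> x))))"
      unfolding sum_distrib_left[symmetric]
      by (simp add: distrib_left distrib_right mult.left_commute)
    \<comment> \<open>The Leibniz correction supplies exactly what turns y_j into the j-th
      coordinate of the reflected y in front of the reflected F0. The right-hand side thereby takes
      the same form as the left-hand one.\<close>
    also have "\<dots> = of_nat (Suc n) * (y $ j * F0 x) +
       (\<Sum>\<alpha>\<in>Rp. complex_of_real (\<kappa> \<alpha>) * (y $ j * F0 x - crfl \<alpha> y $ j * F0 (rfl \<alpha> x)))"
      unfolding sum.distrib[symmetric]
      by (intro arg_cong2[of _ _ _ _ "(+)"] sum.cong HOL.refl)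
         (simp add: complexify_rfl_nth cdot_commute[of "cvec _"] algebra_simps)
    finally have rhs: "?T (\<lambda>x. cdot (cvec x) y * F0 x) = of_nat (Suc n) * (y $ j * F0 x) +
       (\<Sum>\<alpha>\<in>Rp. complex_of_real (\<kappa> \<alpha>) * (y $ j * F0 x - crfl \<alpha> y $ j * F0 (rfl \<alpha> x)))" .
    have CW: "crfl \<alpha> (W z) $ j =
        crfl \<alpha> (dunkl_vec F z) $ j - crfl \<alpha> y $ j * F0 z" for \<alpha> z
    proof -
      have "cdot (W z) (cvec \<alpha>) = cdot (dunkl_vec F z) (cvec \<alpha>) - cdot y (cvec \<alpha>) * F0 z"
        unfolding cdot_def W_def dunkl_vec_def sum_distrib_right sum_subtractf[symmetric]
        by (intro sum.cong HOL.refl) (simp add: algebra_simps)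
      then show ?thesis
        by (simp only: complexify_rfl_nth) (simp add: W_def dunkl_vec_def algebra_simps)
    qed
    have "of_nat (Suc n) * W x $ j + (\<Sum>\<alpha>\<in>Rp. complex_of_real (\<kappa> \<alpha>) *
      (W x $ j - crfl \<alpha> (W (rfl \<alpha> x)) $ j)) =
      (of_nat (Suc n) * ?T F + (\<Sum>\<alpha>\<in>Rp. complex_of_real (\<kappa> \<alpha>) * (?T F - crfl \<alpha> (dunkl_vec F (rfl \<alpha> x)) $ j)))
      - (of_nat (Suc n) * (y $ j * F0 x) +
       (\<Sum>\<alpha>\<in>Rp. complex_of_real (\<kappa> \<alpha>) * (y $ j * F0 x - crfl \<alpha> y $ j * F0 (rfl \<alpha> x))))"
      unfolding CW add_diff_add sum_subtractf[symmetric]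
      by (intro arg_cong2[of _ _ _ _ "(+)"] sum.cong HOL.refl) (simp_all add: W_def algebra_simps)
    also have "\<dots> = 0" using lhs rhs by simp
    finally show ?thesis .
  qed
  have W_le: "(real (Suc n) + \<gamma>) * norm (W x) \<le> (\<Sum>\<alpha>\<in>Rp. \<kappa> \<alpha> * norm (W (rfl \<alpha> x)))" for x
  proof -
    have "(real (Suc n) + \<gamma>) *\<^sub>R W x = (\<Sum>\<alpha>\<in>Rp. \<kappa> \<alpha> *\<^sub>R crfl \<alpha> (W (rfl \<alpha> x)))"
    proof (subst vec_eq_iff, rule allI)
      fix j
      have "(\<Sum>\<alpha>\<in>Rp. complex_of_real (\<kappa> \<alpha>) * (W x $ j - crfl \<alpha> (W (rfl \<alpha> x)) $ j)) =
         complex_of_real \<gamma> * W x $ j - (\<Sum>\<alpha>\<in>Rp. complex_of_real (\<kappa> \<alpha>) * crfl \<alpha> (W (rfl \<alpha> x)) $ j)"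
        by (simp add: right_diff_distrib sum_subtractf sum_distrib_right \<gamma>_def)
      then have "of_nat (Suc n) * W x $ j + (complex_of_real \<gamma> * W x $ j -
          (\<Sum>\<alpha>\<in>Rp. complex_of_real (\<kappa> \<alpha>) * crfl \<alpha> (W (rfl \<alpha> x)) $ j)) = 0"
        using W_eq[of x j] by simp
      then have "of_nat (Suc n) * W x $ j + complex_of_real \<gamma> * W x $ j =
          (\<Sum>\<alpha>\<in>Rp. complex_of_real (\<kappa> \<alpha>) * crfl \<alpha> (W (rfl \<alpha> x)) $ j)"
        by (simp add: algebra_simps)
      then show "((real (Suc n) + \<gamma>) *\<^sub>R W x) $ j = (\<Sum>\<alpha>\<in>Rp. \<kappa> \<alpha> *\<^sub>R crfl \<alpha> (W (rfl \<alpha> x))) $ j"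
        by (simp add: sum_component scaleR_conv_of_real[where 'a=complex] distrib_right)
    qed
    then have "norm ((real (Suc n) + \<gamma>) *\<^sub>R W x) \<le> (\<Sum>\<alpha>\<in>Rp. norm (\<kappa> \<alpha> *\<^sub>R crfl \<alpha> (W (rfl \<alpha> x))))"
      by (simp only: norm_sum)
    also have "\<dots> = (\<Sum>\<alpha>\<in>Rp. \<kappa> \<alpha> * norm (W (rfl \<alpha> x)))"
      using \<kappa>_nonneg by (intro sum.cong) (auto simp: norm_complexify_rfl)
    finally show ?thesis using \<gamma>_nonneg by simp
  qed
  have "norm (W (id x)) \<le> 0"
  proof (rule maximum_principle[where s="real (Suc n)" and N="\<lambda>g. norm (W (g x))"])
    show "(real (Suc n) + \<gamma>) * norm (W (g x)) \<le> (\<Sum>\<alpha>\<in>Rp. \<kappa> \<alpha> * norm (W ((rfl \<alpha> \<circ> g) x)))" for g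
      using W_le[of "g x"] by simp
  qed (rule refl_group.id | simp)+
  then show ?case by (simp add: W_def vec_eq_iff dunkl_vec_def F_def[abs_def] F0_def)
qed

lemma dunkl_op_kernel_part_Suc:
  "dunkl_op Rp \<kappa> j (\<lambda>x. kernel_part (Suc n) (cvec x) y) x = y $ j * kernel_part n (cvec x) y"
  using dunkl_vec_kernel_part_Suc[of n y x] by (simp add: dunkl_vec_def vec_eq_iff)

text \<open>At a fixed x a Dunkl operator needs only finitely many values and directional
  derivatives, all of which are sums of convergent series. The constant part is annihilated, and the
  remaining terms reproduce the series after a shift of the index.\<close>

lemma dunkl_op_kernel: "dunkl_op Rp \<kappa> j (\<lambda>x. kernel (cvec x) y) x = y $ j * kernel (cvec x) y"
proof -
  obtain D where D: "\<And>n p. ((\<lambda>q. kernel_part n (fst q) (snd q)) has_derivative D n p) (at p)"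
    "\<And>p h. summable (\<lambda>n. D n p h)"
    "\<And>p. ((\<lambda>q. kernel (fst q) (snd q)) has_derivative (\<lambda>h. \<Sum>n. D n p h)) (at p)"
    using kernel_derivative by blast
  let ?f = "\<lambda>n x. kernel_part n (cvec x) y"
  let ?F = "\<lambda>x. kernel (cvec x) y"
  define E where "E n h = D n (cvec x, y) (cvec h, 0)" for n h
  have fE: "(?f n has_derivative E n) (at x)" for n
    using has_derivative_compose[OF has_derivative_cvec_pair[of y x] D(1)] by (simp add: E_def[abs_def])
  have FE: "(?F has_derivative (\<lambda>h. \<Sum>n. E n h)) (at x)"
    using has_derivative_compose[OF has_derivative_cvec_pair[of y x] D(3)] by (simp add: E_def)
  have E: "(\<lambda>n. E n h) sums (\<Sum>n. E n h)" for h
    unfolding E_def by (rule summable_sums[OF D(2)])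
  have f: "(\<lambda>n. ?f n x) sums ?F x" for x
    unfolding kernel_def by (rule summable_sums[OF summable_kernel])
  have "(\<lambda>n. dunkl_diff \<alpha> (?f n) x) sums dunkl_diff \<alpha> ?F x" for \<alpha>
  proof (cases "x \<bullet> \<alpha> = 0")
    case True
    then show ?thesis
      unfolding dunkl_diff_def dir_deriv_eq_derivative[OF fE] dir_deriv_eq_derivative[OF FE]
      by (simp only: if_True simp_thms) (rule sums_mult[OF E])
  next
    case False
    then show ?thesis
      unfolding dunkl_diff_def by (simp only: if_False) (intro sums_divide sums_diff f)
  qed
  then have "(\<lambda>n. dunkl_op Rp \<kappa> j (?f n) x) sums dunkl_op Rp \<kappa> j ?F x"
    unfolding dunkl_op_def partial_eq_derivative[OF fE] partial_eq_derivative[OF FE]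
    by (intro sums_add E sums_sum sums_mult)
  moreover have "(\<lambda>n. dunkl_op Rp \<kappa> j (?f n) x) sums (y $ j * ?F x)"
  proof -
    have "(\<lambda>n. dunkl_op Rp \<kappa> j (?f (Suc n)) x) sums (y $ j * ?F x)"
      by (simp only: dunkl_op_kernel_part_Suc) (rule sums_mult[OF f])
    then have "(\<lambda>n. dunkl_op Rp \<kappa> j (?f n) x) sums (y $ j * ?F x + dunkl_op Rp \<kappa> j (?f 0) x)"
      by (rule sums_Suc)
    then show ?thesis by (simp add: dunkl_op_const)
  qed
  ultimately show ?thesis by (rule sums_unique2)
qed

section \<open>Uniqueness of the kernel\<close>

text \<open>The sum of \<open>|H|\<^sup>2\<close> over the orbit of \<open>t x\<close> satisfies \<open>m' \<le> 2 C m\<close>, because the reflection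
  terms contribute a nonpositive amount.\<close>

lemma dunkl_eigenfunction_eq_0:
  fixes H :: "real^'n \<Rightarrow> complex" and y :: "complex^'n"
  assumes deriv: "\<And>x. (H has_derivative D x) (at x)"
    and eigen: "\<And>j x. dunkl_op Rp \<kappa> j H x = y $ j * H x"
    and H0: "H 0 = 0"
  shows "H x = 0"
proof -
  define h where "h g t = H (t *\<^sub>R g x)" for g :: "real^'n \<Rightarrow> real^'n" and t :: real
  define h' where "h' g t = D (t *\<^sub>R g x) (g x)" for g :: "real^'n \<Rightarrow> real^'n" and t :: real
  define c where "c g = cdot (cvec (g x)) y" for g :: "real^'n \<Rightarrow> real^'n"
  define C where "C = CARD('n) * norm x * norm y"
  define m where "m t = (\<Sum>g\<in>G. h g t \<bullet> h g t)" for t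
  have hd: "(h g has_vector_derivative h' g t) (at t)" for g t
  proof -
    have "((\<lambda>t. t *\<^sub>R g x) has_derivative (\<lambda>s. s *\<^sub>R g x)) (at t)"
      by (auto intro!: derivative_eq_intros)
    from has_derivative_compose[OF this deriv] show ?thesis
      unfolding h_def h'_def has_vector_derivative_def
      by (simp add: linear_scale[OF has_derivative_linear[OF deriv]])
  qed
  have md: "(m has_real_derivative (\<Sum>g\<in>G. 2 * (h g t \<bullet> h' g t))) (at t)" for t
  proof -
    have "((\<lambda>t. h g t \<bullet> h g t) has_derivative (\<lambda>s. (2 * (h g t \<bullet> h' g t)) * s)) (at t)" for g
      using has_derivative_inner[OF hd[of g t, unfolded has_vector_derivative_def] hd[of g t, unfolded has_vector_derivative_def]]
      by (simp add: inner_commute algebra_simps)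
    then have "((\<lambda>t. \<Sum>g\<in>G. h g t \<bullet> h g t) has_derivative (\<lambda>s. \<Sum>g\<in>G. (2 * (h g t \<bullet> h' g t)) * s)) (at t)"
      by (intro has_derivative_sum)
    moreover have "(\<lambda>s. \<Sum>g\<in>G. (2 * (h g t \<bullet> h' g t)) * s) = (*) (\<Sum>g\<in>G. 2 * (h g t \<bullet> h' g t))"
      by (auto simp: sum_distrib_right)
    ultimately show ?thesis
      by (simp only: has_field_derivative_def m_def[abs_def])
  qed
  have euler: "t *\<^sub>R h' g t = complex_of_real t * c g * h g t -
      (\<Sum>\<alpha>\<in>Rp. complex_of_real (\<kappa> \<alpha>) * (h g t - h (rfl \<alpha> \<circ> g) t))" for g t
  proof -
    let ?v = "t *\<^sub>R g x"
    have "(\<Sum>k\<in>UNIV. complex_of_real (?v $ k) * (y $ k * H ?v)) = D ?v ?v +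
        (\<Sum>\<alpha>\<in>Rp. complex_of_real (\<kappa> \<alpha>) * (H ?v - H (rfl \<alpha> ?v)))"
      using sum_dunkl_op_euler[OF deriv, of ?v Rp \<kappa>] by (simp only: eigen)
    moreover have "(\<Sum>k\<in>UNIV. complex_of_real (?v $ k) * (y $ k * H ?v)) = cdot (cvec ?v) y * H ?v"
      by (simp add: cdot_def cvec_def sum_distrib_right mult.assoc)
    moreover have "cdot (cvec ?v) y = complex_of_real t * c g"
      by (simp only: cdot_cvec_scaleR c_def)
    ultimately show ?thesis
      unfolding h_def h'_def
      by (simp add: linear_scale[OF linear_rfl] linear_scale[OF has_derivative_linear[OF deriv]] algebra_simps)
  qed
  \<comment> \<open>Polarisation: twice the inner product of a with a - b is the square of |a - b|
    plus the difference of the squares of |a| and |b|. That difference cancels in the sum over the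
    group.\<close>
  have refl_sum: "0 \<le> (\<Sum>g\<in>G. h g t \<bullet> (h g t - h (rfl \<alpha> \<circ> g) t))" if "\<alpha> \<in> Rp" for \<alpha> t
  proof -
    have *: "(\<Sum>g\<in>G. h (rfl \<alpha> \<circ> g) t \<bullet> h (rfl \<alpha> \<circ> g) t) = (\<Sum>g\<in>G. h g t \<bullet> h g t)"
      using that
      by (intro sum.reindex_bij_witness[where i="\<lambda>g. rfl \<alpha> \<circ> g" and j="\<lambda>g. rfl \<alpha> \<circ> g"])
         (simp_all add: rfl_comp_in_G fun_eq_iff)
    have "2 * (a \<bullet> (a - b)) = (a - b) \<bullet> (a - b) + (a \<bullet> a - b \<bullet> b)" for a b :: complex
      by (simp add: inner_diff_left inner_diff_right inner_commute)
    then have "2 * (\<Sum>g\<in>G. h g t \<bullet> (h g t - h (rfl \<alpha> \<circ> g) t)) =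
       (\<Sum>g\<in>G. (h g t - h (rfl \<alpha> \<circ> g) t) \<bullet> (h g t - h (rfl \<alpha> \<circ> g) t)) +
       ((\<Sum>g\<in>G. h g t \<bullet> h g t) - (\<Sum>g\<in>G. h (rfl \<alpha> \<circ> g) t \<bullet> h (rfl \<alpha> \<circ> g) t))"
      by (simp only: sum_distrib_left sum.distrib sum_subtractf)
    also have "\<dots> \<ge> 0" by (simp add: * sum_nonneg)
    finally show ?thesis by simp
  qed
  have m_le: "(\<Sum>g\<in>G. 2 * (h g t \<bullet> h' g t)) \<le> 2 * C * m t" if t: "0 < t" for t
  proof -
    have c_le: "h g t \<bullet> (complex_of_real t * c g * h g t) \<le> t * C * (h g t \<bullet> h g t)" if "g \<in> G" for g
    proof -
      have "h g t \<bullet> (complex_of_real t * c g * h g t) \<le> norm (h g t) * norm (complex_of_real t * c g * h g t)"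
        by (rule norm_cauchy_schwarz)
      also have "\<dots> = t * norm (c g) * (norm (h g t))\<^sup>2"
        using t by (simp add: norm_mult power2_eq_square)
      also have "\<dots> \<le> t * C * (norm (h g t))\<^sup>2"
      proof (intro mult_right_mono mult_left_mono)
        show "norm (c g) \<le> C"
          using norm_cdot_le[of "cvec (g x)" y] by (simp add: c_def C_def norm_cvec refl_group_norm[OF that])
      qed (use t in auto)
      finally show ?thesis by (simp add: power2_norm_eq_inner)
    qed
    have "t * (h g t \<bullet> h' g t) = h g t \<bullet> (complex_of_real t * c g * h g t) -
        (\<Sum>\<alpha>\<in>Rp. \<kappa> \<alpha> * (h g t \<bullet> (h g t - h (rfl \<alpha> \<circ> g) t)))" for g
    proof -
      have "t * (h g t \<bullet> h' g t) = h g t \<bullet> (t *\<^sub>R h' g t)" by simp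
      then show ?thesis
        by (simp only: euler inner_diff_right inner_sum_right scaleR_conv_of_real[symmetric] inner_scaleR_right)
    qed
    then have "t * (\<Sum>g\<in>G. h g t \<bullet> h' g t) = (\<Sum>g\<in>G. h g t \<bullet> (complex_of_real t * c g * h g t)) -
        (\<Sum>\<alpha>\<in>Rp. \<kappa> \<alpha> * (\<Sum>g\<in>G. h g t \<bullet> (h g t - h (rfl \<alpha> \<circ> g) t)))"
      by (simp add: sum_distrib_left sum_subtractf sum.swap[of _ G Rp])
    also have "\<dots> \<le> (\<Sum>g\<in>G. t * C * (h g t \<bullet> h g t)) - 0"
    proof (rule diff_mono, rule sum_mono, rule c_le)
      show "0 \<le> (\<Sum>\<alpha>\<in>Rp. \<kappa> \<alpha> * (\<Sum>g\<in>G. h g t \<bullet> (h g t - h (rfl \<alpha> \<circ> g) t)))"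
        by (rule sum_nonneg, rule mult_nonneg_nonneg) (use \<kappa>_nonneg refl_sum in simp_all)
    qed
    finally have "t * (\<Sum>g\<in>G. h g t \<bullet> h' g t) \<le> t * (C * m t)"
      by (simp add: m_def sum_distrib_left mult.assoc)
    then have "(\<Sum>g\<in>G. h g t \<bullet> h' g t) \<le> C * m t"
      using t by simp
    then show ?thesis by (simp add: sum_distrib_left[symmetric])
  qed
  \<comment> \<open>Gronwall's integrating factor. The Euler identity bounds t m' and so m' only for
    t > 0; continuity takes care of the endpoint 0.\<close>
  let ?\<phi> = "\<lambda>t. exp (- 2 * C * t) * m t"
  have \<phi>d: "(?\<phi> has_real_derivative exp (- 2 * C * t) * ((\<Sum>g\<in>G. 2 * (h g t \<bullet> h' g t)) - 2 * C * m t)) (at t)" for t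
    by (auto intro!: derivative_eq_intros md simp: algebra_simps)
  have "?\<phi> 1 \<le> ?\<phi> 0"
  proof (rule DERIV_nonpos_imp_decreasing_open[where f="?\<phi>" and a=0 and b=1])
    show "continuous_on {0..1} ?\<phi>"
      using \<phi>d by (intro continuous_at_imp_continuous_on ballI) (rule DERIV_isCont)
    fix t :: real assume "0 < t" "t < 1"
    have "exp (- 2 * C * t) * ((\<Sum>g\<in>G. 2 * (h g t \<bullet> h' g t)) - 2 * C * m t) \<le> 0"
      using m_le[OF \<open>0 < t\<close>] by (intro mult_nonneg_nonpos) auto
    with \<phi>d[of t] show "\<exists>y. DERIV ?\<phi> t :> y \<and> y \<le> 0" by blast
  qed simp
  also have "?\<phi> 0 = 0" by (simp add: m_def h_def H0)
  finally have "m 1 \<le> 0" by (simp add: mult_le_0_iff)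
  moreover have "h id 1 \<bullet> h id 1 \<le> m 1"
    unfolding m_def by (rule member_le_sum) (rule refl_group.id | simp add: finite_G)+
  ultimately have "h id 1 \<bullet> h id 1 = 0" using inner_ge_zero[of "h id 1"] by linarith
  then show ?thesis by (simp add: h_def)
qed

end

text \<open>The complex line t -> Re z + t Im z passes through real vectors for real t and through z
  at t = i, so the one-variable identity theorem suffices.\<close>

lemma entire_vanishing_on_reals_eq_0:
  fixes H :: "complex^'n \<Rightarrow> complex"
  assumes deriv: "\<And>z. (H has_derivative D z) (at z)" and clin: "\<And>z v. D z (imul v) = \<i> * D z v"
    and real: "\<And>x. H (cvec x) = 0"
  shows "H z = 0"
proof -
  define w where "w = cvec (Imv z)"
  define L where "L t = cvec (Rev z) + (\<chi> k. t * w $ k)" for t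
  have D: "D p (\<chi> k. t * w $ k) = D p w * t" for p t
  proof -
    have lin: "linear (D p)" by (rule has_derivative_linear[OF deriv])
    have "(\<chi> k. t * w $ k) = Re t *\<^sub>R w + Im t *\<^sub>R imul w"
      by (simp add: vec_eq_iff complex_eq_iff)
    then have "D p (\<chi> k. t * w $ k) = Re t *\<^sub>R D p w + Im t *\<^sub>R (\<i> * D p w)"
      by (simp only: linear_add[OF lin] linear_scale[OF lin] clin)
    also have "\<dots> = D p w * t"
      by (simp add: complex_eq_iff algebra_simps)
    finally show ?thesis .
  qed
  have "((\<lambda>t. H (L t)) has_field_derivative D (L t) w) (at t)" for t
  proof -
    have "linear (\<lambda>t. (\<chi> k. t * w $ k) :: complex^'n)"
      by (rule linearI) (simp_all add: vec_eq_iff distrib_right)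
    then have "((\<lambda>t. (\<chi> k. t * w $ k) :: complex^'n) has_derivative (\<lambda>t. \<chi> k. t * w $ k)) (at t)"
      by (intro bounded_linear_imp_has_derivative) (simp add: linear_conv_bounded_linear)
    then have "(L has_derivative (\<lambda>t. \<chi> k. t * w $ k)) (at t)"
      unfolding L_def[abs_def] by (auto intro!: derivative_eq_intros)
    from has_derivative_compose[OF this deriv] show ?thesis
      by (simp add: has_field_derivative_def D[abs_def])
  qed
  then have hol: "(\<lambda>t. H (L t)) holomorphic_on UNIV"
    by (intro holomorphic_onI) (auto simp: field_differentiable_def)
  have zero: "H (L (complex_of_real t)) = 0" for t
  proof -
    have "L (complex_of_real t) = cvec (Rev z + t *\<^sub>R Imv z)"
      by (simp add: L_def w_def cvec_def vec_eq_iff)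
    then show ?thesis by (simp add: real)
  qed
  have lim: "(0::complex) islimpt range complex_of_real"
  proof (rule islimptI)
    fix T :: "complex set" assume "0 \<in> T" "open T"
    then obtain e where e: "e > 0" "ball 0 e \<subseteq> T" by (auto simp: open_contains_ball)
    then have "complex_of_real (e / 2) \<in> T" by (auto simp: subset_iff)
    moreover have "complex_of_real (e / 2) \<noteq> 0" using e by simp
    ultimately show "\<exists>y\<in>range complex_of_real. y \<in> T \<and> y \<noteq> 0" by blast
  qed
  have "H (L \<i>) = 0"
    by (rule analytic_continuation[OF hol open_UNIV connected_UNIV subset_UNIV UNIV_I lim]) (use zero in auto)
  moreover have "L \<i> = z"
    by (simp add: L_def w_def cvec_def Rev_def Imv_def vec_eq_iff complex_eq_iff)
  ultimately show ?thesis by simp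
qed

lemma holo2_derivative_fst:
  assumes "holo2 F"
  shows "\<exists>D. ((\<lambda>x. F x y) has_derivative D) (at x) \<and> (\<forall>v. D (imul v) = \<i> * D v)"
proof -
  obtain D where D: "((\<lambda>q. F (fst q) (snd q)) has_derivative D) (at (x, y))" "\<And>v. D (imul2 v) = \<i> * D v"
    using assms unfolding holo2_def by blast
  have "((\<lambda>x. (x, y)) has_derivative (\<lambda>h. (h, 0))) (at x)"
    by (intro has_derivative_Pair has_derivative_ident has_derivative_const)
  from has_derivative_compose[OF this D(1)] have "((\<lambda>x. F x y) has_derivative (\<lambda>h. D (h, 0))) (at x)"
    by simp
  moreover have "D (imul v, 0) = \<i> * D (v, 0)" for v
  proof -
    have "imul2 (v, 0) = (imul v, 0)" by (simp add: imul2_def vec_eq_iff)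
    with D(2)[of "(v, 0)"] show ?thesis by simp
  qed
  ultimately show ?thesis by blast
qed

context dunkl_setting
begin

text \<open>For each fixed y, the difference of two candidates is an eigenfunction on the real
  vectors with value 0 at the origin, so it vanishes on them; holomorphy in the first argument
  carries this to all complex vectors.\<close>

lemma dunkl_kernel_eq_kernel: "dunkl_kernel Rp \<kappa> = kernel"
  unfolding dunkl_kernel_def
proof (rule the_equality)
  show "holo2 kernel \<and> (\<forall>y. kernel 0 y = 1) \<and>
      (\<forall>y j x. dunkl_op Rp \<kappa> j (\<lambda>x'. kernel (cvec x') y) x = y $ j * kernel (cvec x) y)"
    using holo2_kernel kernel_0 dunkl_op_kernel by blast
  fix F assume F: "holo2 F \<and> (\<forall>y. F 0 y = 1) \<and>
      (\<forall>y j x. dunkl_op Rp \<kappa> j (\<lambda>x'. F (cvec x') y) x = y $ j * F (cvec x) y)"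
  have "F x y = kernel x y" for x y
  proof -
    have "\<forall>x. \<exists>D. ((\<lambda>x. F x y) has_derivative D) (at x) \<and> (\<forall>v. D (imul v) = \<i> * D v)"
      using holo2_derivative_fst[of F] F by blast
    from choice[OF this] obtain D1 where D1: "\<And>x. ((\<lambda>x. F x y) has_derivative D1 x) (at x)"
      "\<And>x v. D1 x (imul v) = \<i> * D1 x v" by blast
    have "\<forall>x. \<exists>D. ((\<lambda>x. kernel x y) has_derivative D) (at x) \<and> (\<forall>v. D (imul v) = \<i> * D v)"
      using holo2_derivative_fst[OF holo2_kernel] by blast
    from choice[OF this] obtain D2 where D2: "\<And>x. ((\<lambda>x. kernel x y) has_derivative D2 x) (at x)"
      "\<And>x v. D2 x (imul v) = \<i> * D2 x v" by blast
    have cvec: "(cvec has_derivative cvec) (at x)" for x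
      by (rule bounded_linear_imp_has_derivative[OF bounded_linear_cvec])
    have Fc: "((\<lambda>x. F (cvec x) y) has_derivative (\<lambda>h. D1 (cvec x) (cvec h))) (at x)" for x
      by (rule has_derivative_compose[OF cvec D1(1)])
    have Kc: "((\<lambda>x. kernel (cvec x) y) has_derivative (\<lambda>h. D2 (cvec x) (cvec h))) (at x)" for x
      by (rule has_derivative_compose[OF cvec D2(1)])
    have "F (cvec x) y - kernel (cvec x) y = 0" for x
    proof (rule dunkl_eigenfunction_eq_0[where H="\<lambda>x. F (cvec x) y - kernel (cvec x) y" and y=y])
      show "((\<lambda>x. F (cvec x) y - kernel (cvec x) y) has_derivative
          (\<lambda>h. D1 (cvec x) (cvec h) - D2 (cvec x) (cvec h))) (at x)" for x
        by (rule has_derivative_diff[OF Fc Kc])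
      show "dunkl_op Rp \<kappa> j (\<lambda>x. F (cvec x) y - kernel (cvec x) y) x = y $ j * (F (cvec x) y - kernel (cvec x) y)" for j x
        using dunkl_op_add[OF Fc[of x] has_derivative_mult_right[OF Kc[of x], of "-1"], of Rp \<kappa> j]
          dunkl_op_cmult[OF Kc[of x], of Rp \<kappa> j "-1"] F
        by (simp add: dunkl_op_kernel right_diff_distrib)
      have "cvec 0 = (0 :: complex^'n)" by (simp add: cvec_def vec_eq_iff)
      then show "F (cvec 0) y - kernel (cvec 0) y = 0" using F by (simp add: kernel_0)
    qed
    note zero = this
    have "F x y - kernel x y = 0"
    proof (rule entire_vanishing_on_reals_eq_0[where H="\<lambda>x. F x y - kernel x y"])
      show "((\<lambda>x. F x y - kernel x y) has_derivative (\<lambda>h. D1 z h - D2 z h)) (at z)" for z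
        by (rule has_derivative_diff[OF D1(1) D2(1)])
      show "D1 z (imul v) - D2 z (imul v) = \<i> * (D1 z v - D2 z v)" for z v
        by (simp only: D1(2) D2(2) right_diff_distrib)
      show "F (cvec x) y - kernel (cvec x) y = 0" for x by (rule zero)
    qed
    then show ?thesis by simp
  qed
  then show "F = kernel" by (intro ext)
qed

end

section \<open>The intertwining relation\<close>

context dunkl_setting
begin

lemma homog_bound_monomial_ivec:
  "homog_bound (length w) 1 (\<lambda>y. monomial w (ivec y))"
proof (induction w)
  case Nil
  show ?case using homog_bound.const[of 1] by (simp add: monomial_def)
next
  case (Cons k w)
  from homog_bound_cmult[OF homog_bound.coord[OF Cons, of k], of \<i>] show ?case
    by (simp add: monomial_def ivec_def mult.assoc)
qed

lemma poly_deg_le_monomial_ivec: "w \<in> words n \<Longrightarrow> poly_deg_le n (\<lambda>y. monomial w (ivec y))"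
  using homog_bound_imp_poly[OF homog_bound_monomial_ivec[of w]] by (simp add: words_def)

lemma exp_type_kernel_part:
  "exp_type 1 (CARD('n) * norm z) (\<lambda>n y. kernel_part n (cvec z) (ivec y))"
  unfolding exp_type_def
proof
  fix n
  have 1: "homog_bound n (\<Sum>w\<in>words n. norm (dunkl_monomial w (cvec z)) * 1)
      (\<lambda>y. \<Sum>w\<in>words n. dunkl_monomial w (cvec z) * monomial w (ivec y))"
  proof (intro homog_bound_sum homog_bound_cmult)
    fix w assume "w \<in> words n"
    then show "homog_bound n 1 (\<lambda>y. monomial w (ivec y))"
      using homog_bound_monomial_ivec[of w] by (simp add: words_def)
  qed
  have "(\<Sum>w\<in>words n. norm (dunkl_monomial w (cvec z)) * 1) \<le> (\<Sum>w\<in>words n. norm z ^ n / fact n)"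
  proof (rule sum_mono)
    fix w assume "w \<in> words n"
    then show "norm (dunkl_monomial w (cvec z)) * 1 \<le> norm z ^ n / fact n"
      using dunkl_monomial_norm_le[of "cvec z" "norm z" w] by (simp add: words_def norm_cvec)
  qed
  also have "\<dots> = 1 * (CARD('n) * norm z) ^ n / fact n"
    by (simp add: card_words power_mult_distrib)
  finally show "homog_bound n (1 * (CARD('n) * norm z) ^ n / fact n) (\<lambda>y. kernel_part n (cvec z) (ivec y))"
    unfolding kernel_part_def by (rule homog_bound.mono[OF 1])
qed

text \<open>Symmetry moves z into the first argument, where the Dunkl operators act.\<close>

lemma Vop_eq_heat_pairing: "Vop Rp \<kappa> p z = heat_pairing p (\<lambda>y. \<Sum>n. kernel_part n (cvec z) (ivec y))"
proof -
  have "(\<lambda>y'. dunkl_kernel Rp \<kappa> (ivec y') (cvec z)) = (\<lambda>y. \<Sum>n. kernel_part n (cvec z) (ivec y))"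
    by (simp add: dunkl_kernel_eq_kernel kernel_commute[of "ivec _"] kernel_def[of "cvec z"])
  then show ?thesis
    by (simp only: Vop_def Kfun_def heat_pairing_def fourier_gaussian_def gaussian_def)
qed

lemma Vop_eq_sum:
  assumes "poly_deg_le d p"
  shows "Vop Rp \<kappa> p z = (\<Sum>n\<le>d. heat_pairing p (\<lambda>y. kernel_part n (cvec z) (ivec y)))"
  unfolding Vop_eq_heat_pairing by (rule heat_pairing_exp_type[OF exp_type_kernel_part _ assms]) simp

lemma heat_pairing_words:
  assumes "poly_deg_le d p"
  shows "heat_pairing p (\<lambda>y. \<Sum>w\<in>words n. a w * monomial w (ivec y)) =
    (\<Sum>w\<in>words n. a w * heat_pairing p (\<lambda>y. monomial w (ivec y)))"
proof -
  have "heat_pairing p (\<lambda>y. \<Sum>w\<in>words n. a w * monomial w (ivec y)) =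
      (\<Sum>w\<in>words n. heat_pairing p (\<lambda>y. a w * monomial w (ivec y)))"
    by (rule heat_pairing_sum[OF assms, where e=n]) (rule poly_deg_le_cmult[OF poly_deg_le_monomial_ivec])
  also have "\<dots> = (\<Sum>w\<in>words n. a w * heat_pairing p (\<lambda>y. monomial w (ivec y)))"
    by (rule sum.cong[OF HOL.refl], rule heat_pairing_cmult[OF poly_deg_le_monomial_ivec])
  finally show ?thesis .
qed

text \<open>As a function of z the pairing is a finite combination of \<open>dunkl_monomial\<close>
  functions with constant coefficients, so T_j passes through by linearity alone and meets the
  kernel part inside. There it acts as i y_j, which \<open>heat_pairing_coord\<close> converts into
  a derivative of p.\<close>

lemma dunkl_op_heat_pairing_kernel_part:
  assumes p: "poly_deg_le d p"
  shows "\<exists>D. ((\<lambda>z. heat_pairing p (\<lambda>y. kernel_part n (cvec z) (ivec y))) has_derivative D) (at z)"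
    and "dunkl_op Rp \<kappa> j (\<lambda>z. heat_pairing p (\<lambda>y. kernel_part n (cvec z) (ivec y))) z =
      (case n of 0 \<Rightarrow> 0 | Suc m \<Rightarrow> heat_pairing (partial j p) (\<lambda>y. kernel_part m (cvec z) (ivec y)))"
proof -
  have "\<exists>D. ((\<lambda>z. dunkl_monomial w (cvec z)) has_derivative D) (at z)" for w
  proof -
    obtain D where "\<And>x. (dunkl_monomial w has_derivative D x) (at x)"
      using dunkl_monomial_derivative[of w] by blast
    from has_derivative_compose[OF bounded_linear_imp_has_derivative[OF bounded_linear_cvec] this] show ?thesis
      by blast
  qed
  then have "\<forall>w. \<exists>D. ((\<lambda>z. dunkl_monomial w (cvec z)) has_derivative D) (at z)" by blast
  from choice[OF this] obtain D where D: "\<And>w. ((\<lambda>z. dunkl_monomial w (cvec z)) has_derivative D w) (at z)"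
    by blast
  let ?c = "\<lambda>w. heat_pairing p (\<lambda>y. monomial w (ivec y))"
  let ?T = "\<lambda>w. dunkl_op Rp \<kappa> j (\<lambda>z. dunkl_monomial w (cvec z)) z"
  have eq: "(\<lambda>z. heat_pairing p (\<lambda>y. kernel_part n (cvec z) (ivec y))) =
      (\<lambda>z. \<Sum>w\<in>words n. ?c w * dunkl_monomial w (cvec z))"
    unfolding kernel_part_def heat_pairing_words[OF p] by (simp only: mult.commute)
  have cD: "((\<lambda>z. c * dunkl_monomial w (cvec z)) has_derivative (\<lambda>h. c * D w h)) (at z)" for c w
    by (rule has_derivative_mult_right[OF D])
  show "\<exists>D. ((\<lambda>z. heat_pairing p (\<lambda>y. kernel_part n (cvec z) (ivec y))) has_derivative D) (at z)"
    unfolding eq by (intro exI, rule has_derivative_sum[OF cD])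
  have T: "(\<Sum>w\<in>words n. ?T w * monomial w y) = dunkl_op Rp \<kappa> j (\<lambda>z. kernel_part n (cvec z) y) z" for y
  proof -
    have "dunkl_op Rp \<kappa> j (\<lambda>z. \<Sum>w\<in>words n. monomial w y * dunkl_monomial w (cvec z)) z =
        (\<Sum>w\<in>words n. monomial w y * ?T w)"
      by (simp only: dunkl_op_sum[OF cD] dunkl_op_cmult[OF D])
    then show ?thesis by (simp only: kernel_part_def mult.commute)
  qed
  have "dunkl_op Rp \<kappa> j (\<lambda>z. heat_pairing p (\<lambda>y. kernel_part n (cvec z) (ivec y))) z = (\<Sum>w\<in>words n. ?c w * ?T w)"
    unfolding eq by (simp only: dunkl_op_sum[OF cD] dunkl_op_cmult[OF D])
  also have "\<dots> = heat_pairing p (\<lambda>y. \<Sum>w\<in>words n. ?T w * monomial w (ivec y))"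
    by (subst heat_pairing_words[OF p]) (simp only: mult.commute)
  also have "\<dots> = heat_pairing p (\<lambda>y. dunkl_op Rp \<kappa> j (\<lambda>z. kernel_part n (cvec z) (ivec y)) z)"
    by (simp only: T)
  also have "\<dots> = (case n of 0 \<Rightarrow> 0 | Suc m \<Rightarrow> heat_pairing (partial j p) (\<lambda>y. kernel_part m (cvec z) (ivec y)))"
  proof (cases n)
    case 0
    then show ?thesis by (simp add: dunkl_op_const)
  next
    case (Suc m)
    let ?k = "\<lambda>y. kernel_part m (cvec z) (ivec y)"
    have k: "poly_deg_le m ?k" by (rule exp_type_poly[OF exp_type_kernel_part])
    have "(\<lambda>y. dunkl_op Rp \<kappa> j (\<lambda>z. kernel_part n (cvec z) (ivec y)) z) =
        (\<lambda>y. \<i> * (complex_of_real (y $ j) * ?k y))"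
      unfolding Suc dunkl_op_kernel_part_Suc by (simp add: ivec_def mult.assoc)
    then show ?thesis
      using heat_pairing_coord[OF p k, of j] heat_pairing_cmult[OF poly_deg_le.coord[OF k], of p \<i> j]
      by (simp add: Suc)
  qed
  finally show "dunkl_op Rp \<kappa> j (\<lambda>z. heat_pairing p (\<lambda>y. kernel_part n (cvec z) (ivec y))) z =
      (case n of 0 \<Rightarrow> 0 | Suc m \<Rightarrow> heat_pairing (partial j p) (\<lambda>y. kernel_part m (cvec z) (ivec y)))" .
qed

lemma Vop_partial:
  assumes "poly_deg_le d p"
  shows "Vop Rp \<kappa> (partial j p) z = dunkl_op Rp \<kappa> j (Vop Rp \<kappa> p) z"
proof -
  \<comment> \<open>The weaker bound makes the ranges match: degrees up to d + 1 for p become, after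
    the shift caused by T_j, degrees up to d for its derivative.\<close>
  have p: "poly_deg_le (Suc d) p" using assms by (rule poly_deg_le_mono) simp
  let ?f = "\<lambda>n z. heat_pairing p (\<lambda>y. kernel_part n (cvec z) (ivec y))"
  have "\<forall>n. \<exists>D. (?f n has_derivative D) (at z)"
    using dunkl_op_heat_pairing_kernel_part(1)[OF p] by blast
  from choice[OF this] obtain D where D: "\<And>n. (?f n has_derivative D n) (at z)" by blast
  have "dunkl_op Rp \<kappa> j (Vop Rp \<kappa> p) z = dunkl_op Rp \<kappa> j (\<lambda>z. \<Sum>n\<le>Suc d. ?f n z) z"
  proof -
    have "Vop Rp \<kappa> p = (\<lambda>z. \<Sum>n\<le>Suc d. ?f n z)" by (rule ext) (rule Vop_eq_sum[OF p])
    then show ?thesis by simp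
  qed
  also have "\<dots> = (\<Sum>n\<le>Suc d. dunkl_op Rp \<kappa> j (?f n) z)"
    by (rule dunkl_op_sum[OF D])
  also have "\<dots> = (\<Sum>n\<le>d. heat_pairing (partial j p) (\<lambda>y. kernel_part n (cvec z) (ivec y)))"
    by (simp only: dunkl_op_heat_pairing_kernel_part(2)[OF p] sum.atMost_Suc_shift nat.case add_0_left)
  also have "\<dots> = Vop Rp \<kappa> (partial j p) z"
    by (rule Vop_eq_sum[OF poly_deg_le_partial'[OF assms], symmetric])
  finally show ?thesis by simp
qed

end

theorem mainTheorem4:
  fixes R Rp :: "(real^'n) set" and \<kappa> :: "real^'n \<Rightarrow> real"
    and p :: "real^'n \<Rightarrow> complex" and j :: 'n
  assumes "root_system R"
    and "positive_subsystem R Rp"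
    and "\<forall>\<alpha>\<in>R. \<kappa> \<alpha> \<ge> 0"
    and "\<forall>g\<in>refl_group R. \<forall>\<alpha>\<in>R. \<kappa> (g \<alpha>) = \<kappa> \<alpha>"
    and "poly_fun p"
  shows "\<forall>z. Vop Rp \<kappa> (partial j p) z = dunkl_op Rp \<kappa> j (Vop Rp \<kappa> p) z"
proof -
  interpret dunkl_setting R Rp \<kappa>
    using assms(1-4) by unfold_locales
  obtain d where "poly_deg_le d p"
    using poly_fun_imp_poly_deg_le[OF assms(5)] by blast
  then show ?thesis by (intro allI Vop_partial)
qed

end
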